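(* In the setting of the context, let $S$ be a finite set of height-one primes of $\mathcal A$, $S=S_E\sqcup S_M$ its split into type E and type M primes, and let $u\in L^*$ have $\operatorname{div}_{\mathcal A}(u)$ supported on $S$. For $P\in S_M$ let $p_P\in T$ be its monic irreducible and $n_P:=v_P(u)$. Then $$u=w\cdot\prod_{P\in S_M}p_P^{\,n_P},\qquad w\in K_0(y)^*,$$ and $$\operatorname{div}_{\mathcal O}(w)=\iota\bigl(\operatorname{div}_{\mathcal A}(u)\big|_{S_E}\bigr)-\sum_{P\in S_M}n_P\,\gamma(p_P),$$ where $\iota$ contracts extended primes to $\mathcal O$. In particular $w$ is an $S'$-unit of $\mathcal O$ (its divisor is supported on $S'$) for the finite set $S':=\iota(S_E)\cup\bigcup_{P\in S_M}\operatorname{supp}\gamma(p_P)$.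
   Context: All fields have characteristic $0$; $\overline F$ is an algebraic closure of $F$. $(L,D)$ is a differential field built as follows. (T1) $K_0=F(t_1,\dots,t_j)$ with $DF\subseteq F$, each $t_i$ transcendental over $F(t_1,\dots,t_{i-1})$ and $Dt_i\in F(t_1,\dots,t_i)$; $R_0=F[t_1,\dots,t_j]$. (T2) $y^m=q\in R_0$, where $q$ is $m$-th-power-free and $Y^m-q$ is irreducible over $\overline F(t_1,\dots,t_j)$. (T3) $t_{j+1},\dots,t_n$ are successively transcendental over the field below, with $Dt_i\in K_0(y)(t_{j+1},\dots,t_i)$. (T4) $L=K_0(y)(t_{j+1},\dots,t_n)$ has field of constants $F$. $\mathcal O$ is the integral closure of $R_0$ in $K_0(y)$ and $\mathcal A=\mathcal O[t_{j+1},\dots,t_n]$, a Krull domain; $v_P$ is the valuation of a height-one prime $P$ and $\operatorname{div}$ denotes the Weil divisor. Type E (extended) primes: $P=\mathfrak p\mathcal A$ with $\mathfrak p$ a height-one prime of $\mathcal O$; $\iota(\mathfrak p\mathcal A)=\mathfrak p$, extended linearly to divisors. Type M (moving) primes: $P\cap\mathcal O=0$; these correspond to the monic irreducibles (irreducibles normalised up to $K_0(y)^*$) of the UFD $T:=K_0(y)[t_{j+1},\dots,t_n]$. For a monic irreducible $p=\sum_\alpha p_\alpha t^\alpha\in T$ (multi-index over the upper variables, $p_\alpha\in K_0(y)$) the content divisor is $\gamma(p):=\sum_{\mathfrak p}\bigl(\min_\alpha v_{\mathfrak p}(p_\alpha)\bigr)\mathfrak p\in\operatorname{Div}(\mathcal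 O)$, the sum over height-one primes of $\mathcal O$. *)

theory Defs
  imports "HOL-Algebra.Algebra" "HOL-Algebra.Algebraic_Closure_Type" "HOL-Library.Poly_Mapping"
begin

text \<open>The big field \<open>L\<close> is an arbitrary type of class \<^class>\<open>field_char_0\<close>; its subrings and
  subfields are sets of elements, to which the notions of HOL-Algebra are applied through
  \<open>ring_on\<close>.\<close>

abbreviation ring_on :: "'a::comm_ring_1 set \<Rightarrow> 'a ring" where
  "ring_on A \<equiv> ring_of_type_algebra\<lparr>carrier := A\<rparr>"

definition ring_adjoin :: "'a::comm_ring_1 set \<Rightarrow> 'a set \<Rightarrow> 'a set" where
  "ring_adjoin B Z = generate_ring (ring_on UNIV) (B \<union> Z)"

definition field_adjoin :: "'a::field set \<Rightarrow> 'a set \<Rightarrow> 'a set" where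
  "field_adjoin B Z = generate_field (ring_on UNIV) (B \<union> Z)"

definition poly_over :: "'a::comm_ring_1 set \<Rightarrow> 'a poly set" where
  "poly_over B = {f. \<forall>i. coeff f i \<in> B}"

definition algebraic_over :: "'a::field set \<Rightarrow> 'a \<Rightarrow> bool" where
  "algebraic_over B x \<longleftrightarrow> (\<exists>f\<in>poly_over B. f \<noteq> 0 \<and> poly f x = 0)"

definition integral_closure :: "'a::field set \<Rightarrow> 'a set \<Rightarrow> 'a set" where
  "integral_closure R K = {x \<in> K. \<exists>f\<in>poly_over R. lead_coeff f = 1 \<and> poly f x = 0}"

definition derivation :: "('a::field \<Rightarrow> 'a) \<Rightarrow> bool" where
  "derivation D \<longleftrightarrow> (\<forall>x y. D (x + y) = D x + D y) \<and> (\<forall>x y. D (x * y) = D x * y + x * D y)"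

definition power_free :: "'a::comm_ring_1 set \<Rightarrow> nat \<Rightarrow> 'a \<Rightarrow> bool" where
  "power_free R m q \<longleftrightarrow> (\<forall>a\<in>R. (a ^ m) divides\<^bsub>ring_on R\<^esub> q \<longrightarrow> a \<in> Units (ring_on R))"

text \<open>The algebraic closure of a subfield \<open>F\<close> of \<open>L\<close>, realised inside the algebraic closure of
  \<open>L\<close> (into which \<^term>\<open>to_ac\<close> embeds \<open>L\<close>).\<close>

definition alg_closure_of :: "'a::field set \<Rightarrow> 'a alg_closure set" where
  "alg_closure_of F = {z. algebraic_over (to_ac ` F) z}"

text \<open>The field \<open>L\<close> of the tower is the whole type. For \<open>i = 1\<close> resp. \<open>i = j + 1\<close> the field below
  \<open>t i\<close> is \<open>F\<close> resp. \<open>K\<^sub>0(y)\<close>.\<close>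

locale differential_tower =
  fixes F :: "'a::field_char_0 set" and D :: "'a \<Rightarrow> 'a"
    and j m n :: nat and q y :: 'a and t :: "nat \<Rightarrow> 'a"
  assumes subfield_F: "subfield F (ring_on UNIV)"
    and derivation_D: "derivation D"
    and j_le_n: "j \<le> n"
    and D_F: "D ` F \<subseteq> F"
    and lower_transcendental:
      "i \<in> {1..j} \<Longrightarrow> \<not> algebraic_over (field_adjoin F (t ` {1..<i})) (t i)"
    and lower_D: "i \<in> {1..j} \<Longrightarrow> D (t i) \<in> field_adjoin F (t ` {1..i})"
    and m_pos: "1 \<le> m"
    and q_in: "q \<in> ring_adjoin F (t ` {1..j})"
    and y_power: "y ^ m = q"
    and q_power_free: "power_free (ring_adjoin F (t ` {1..j})) m q"
    and irreducible_Y: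
      "ring_irreducible\<^bsub>ring_on (poly_over (field_adjoin (alg_closure_of F) (to_ac ` t ` {1..j})))\<^esub>
         (monom 1 m - [:to_ac q:])"
    and upper_transcendental:
      "i \<in> {j+1..n} \<Longrightarrow>
         \<not> algebraic_over (field_adjoin F (insert y (t ` {1..j}) \<union> t ` {j+1..<i})) (t i)"
    and upper_D:
      "i \<in> {j+1..n} \<Longrightarrow> D (t i) \<in> field_adjoin F (insert y (t ` {1..j}) \<union> t ` {j+1..i})"
    and generates_L: "field_adjoin F (insert y (t ` {1..n})) = UNIV"
    and constants: "{x. D x = 0} = F"

definition height_one_prime :: "'a::field set \<Rightarrow> 'a set \<Rightarrow> bool" where
  "height_one_prime A P \<longleftrightarrow>
     primeideal P (ring_on A) \<and> P \<noteq> {0} \<and>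
     (\<forall>Q. primeideal Q (ring_on A) \<and> Q \<subseteq> P \<longrightarrow> Q = {0} \<or> Q = P)"

definition localization :: "'a::field set \<Rightarrow> 'a set \<Rightarrow> 'a set" where
  "localization A P = {a / s | a s. a \<in> A \<and> s \<in> A - P}"

definition uniformizer :: "'a::field set \<Rightarrow> 'a set \<Rightarrow> 'a \<Rightarrow> bool" where
  "uniformizer A P \<pi> \<longleftrightarrow>
     {a / s | a s. a \<in> P \<and> s \<in> A - P} = PIdl\<^bsub>ring_on (localization A P)\<^esub> \<pi>"

text \<open>The normalised valuation of the discrete valuation ring \<open>A\<^sub>P\<close>, for a height-one prime \<open>P\<close> of a
  Krull domain \<open>A\<close>. It is meant for nonzero elements of the fraction field only: at \<open>0\<close>, where the
  valuation is infinite, the value is unspecified.\<close>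

definition val :: "'a::field set \<Rightarrow> 'a set \<Rightarrow> 'a \<Rightarrow> int" where
  "val A P x =
     (THE k. \<exists>\<pi> e. uniformizer A P \<pi> \<and> e \<in> Units (ring_on (localization A P)) \<and> x = e * \<pi> powi k)"

text \<open>A divisor of \<open>A\<close> is rendered as the function giving the coefficient of each height-one prime,
  extended by \<open>0\<close> to all other sets.\<close>

type_synonym 'a divisor = "'a set \<Rightarrow> int"

definition div_supp :: "'a divisor \<Rightarrow> 'a set set" where
  "div_supp E = {P. E P \<noteq> 0}"

definition Div :: "'a::field set \<Rightarrow> 'a \<Rightarrow> 'a divisor" where
  "Div A x = (\<lambda>P. if height_one_prime A P then val A P x else 0)"

definition div_restrict :: "'a divisor \<Rightarrow> 'a set set \<Rightarrow> 'a divisor" where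
  "div_restrict E S = (\<lambda>P. if P \<in> S then E P else 0)"

definition type_E :: "'a::field set \<Rightarrow> 'a set \<Rightarrow> 'a set \<Rightarrow> bool" where
  "type_E A B P \<longleftrightarrow> height_one_prime A P \<and> (\<exists>\<pp>. height_one_prime B \<pp> \<and> P = Idl\<^bsub>ring_on A\<^esub> \<pp>)"

definition type_M :: "'a::field set \<Rightarrow> 'a set \<Rightarrow> 'a set \<Rightarrow> bool" where
  "type_M A B P \<longleftrightarrow> height_one_prime A P \<and> P \<inter> B = {0}"

text \<open>Contraction of primes to the subring \<open>B\<close>, which sends an extended prime \<open>\<pp>A\<close> to \<open>\<pp>\<close>, and its
  linear extension to divisors (of finite support).\<close>

definition contract :: "'a set \<Rightarrow> 'a set \<Rightarrow> 'a set" where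
  "contract B P = P \<inter> B"

definition div_contract :: "'a set \<Rightarrow> 'a divisor \<Rightarrow> 'a divisor" where
  "div_contract B E = (\<lambda>\<pp>. \<Sum>P | P \<in> div_supp E \<and> contract B P = \<pp>. E P)"

text \<open>The coefficients \<open>p\<^sub>\<alpha> \<in> K\<close> of \<open>p = \<Sum>\<^sub>\<alpha> p\<^sub>\<alpha> t\<^sup>\<alpha>\<close>, where the multi-indices \<open>\<alpha>\<close> are supported in \<open>I\<close>.
  They are unique when the \<open>t i\<close>, \<open>i \<in> I\<close>, are algebraically independent over \<open>K\<close>.\<close>

definition monomial_at :: "(nat \<Rightarrow> 'a::field) \<Rightarrow> (nat \<Rightarrow>\<^sub>0 nat) \<Rightarrow> 'a" where
  "monomial_at t \<alpha> = (\<Prod>i\<in>Poly_Mapping.keys \<alpha>. t i ^ Poly_Mapping.lookup \<alpha> i)"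

definition coeffs_in :: "'a::field set \<Rightarrow> nat set \<Rightarrow> (nat \<Rightarrow> 'a) \<Rightarrow> 'a \<Rightarrow> (nat \<Rightarrow>\<^sub>0 nat) \<Rightarrow>\<^sub>0 'a" where
  "coeffs_in K I t p =
     (THE c. (\<forall>\<alpha>\<in>Poly_Mapping.keys c. Poly_Mapping.lookup c \<alpha> \<in> K \<and> Poly_Mapping.keys \<alpha> \<subseteq> I) \<and>
             p = (\<Sum>\<alpha>\<in>Poly_Mapping.keys c. Poly_Mapping.lookup c \<alpha> * monomial_at t \<alpha>))"

text \<open>The minimum may be restricted to the nonzero coefficients, since the others have infinite
  valuation.\<close>

definition content_divisor ::
  "'a::field set \<Rightarrow> 'a set \<Rightarrow> nat set \<Rightarrow> (nat \<Rightarrow> 'a) \<Rightarrow> 'a \<Rightarrow> 'a divisor" where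
  "content_divisor B K I t p = (\<lambda>\<pp>. if height_one_prime B \<pp>
     then Min ((\<lambda>\<alpha>. val B \<pp> (Poly_Mapping.lookup (coeffs_in K I t p) \<alpha>)) ` Poly_Mapping.keys (coeffs_in K I t p))
     else 0)"

end

theory Submission
  imports Defs "Jordan_Normal_Form.Char_Poly"
begin

text \<open>A nonzero \<open>u\<close> factors in the unique factorization domain \<open>T = K[t\<^sub>j\<^sub>+\<^sub>1, \<dots>, t\<^sub>n]\<close> as a unit
  \<open>w \<in> K\<close> times powers of prime elements. For a prime element \<open>p\<close> the contraction \<open>\<A> \<inter> p T\<close> is a
  moving prime with local ring \<open>T\<^bsub>(p)\<^esub>\<close>, so the exponents are the values \<open>v\<^sub>P(u)\<close> and only \<open>P \<in> S\<^sub>M\<close>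
  occur. At an extended prime \<open>\<pp>\<A>\<close> the valuation is the Gauss extension of \<open>v\<^bsub>\<pp>\<^esub>\<close>: it sends a
  polynomial to the minimum of the values of its coefficients. Evaluating it on both sides of the
  factorization yields the divisor of \<open>w\<close>.

  This needs that \<open>\<O>\<close> is a discrete valuation ring at each height-one prime \<open>\<pp>\<close>, and that a nonzero
  element lies in finitely many of these. Since \<open>R\<^sub>0\<close> is factorial, going down gives
  \<open>\<pp> \<inter> R\<^sub>0 = \<pi> R\<^sub>0\<close> with \<open>\<pi>\<close> prime. As \<open>K\<close> has finite degree over the fraction field of \<open>R\<^sub>0\<close>,
  sufficiently many elements of \<open>K\<close> satisfy a linear relation over \<open>R\<^sub>0\<close> whose coefficients are not
  all divisible by \<open>\<pi>\<close>; this replaces all Noetherian arguments.\<close>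


section \<open>Prime ideals and unique factorization\<close>

text \<open>All rings are subsets of one field, so \<open>x / p \<in> R\<close> expresses
  divisibility, and associates, fractions and local rings are compared by membership alone. The
  obstacle that shapes the proof is that \<open>val\<close> is a definite description: it means
  nothing until a uniformizer is exhibited. The predicate \<open>dvr\<close> therefore carries a
  uniformizer along, and both the laws of \<open>val\<close> and height one are deduced from it. The
  exponents in the factorization are checked rather than computed: \<open>w\<close> is defined as
  the quotient of \<open>u\<close> by the product. Its value at every moving prime is 0, so
  \<open>w\<close> and its inverse lie in \<open>T\<close>, and the units of a polynomial ring over
  a field are constants. "Sufficiently many" means m + 1: the powers of \<open>y\<close> below
  \<open>m\<close> span \<open>K\<close> over the fraction field of
  \<open>R\<^sub>0\<close>.\<close>

locale subrng =
  fixes A :: "'a::field set"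
  assumes zero [simp, intro]: "0 \<in> A" and one [simp, intro]: "1 \<in> A"
    and add [intro]: "x \<in> A \<Longrightarrow> y \<in> A \<Longrightarrow> x + y \<in> A"
    and uminus [intro]: "x \<in> A \<Longrightarrow> - x \<in> A"
    and mult [intro]: "x \<in> A \<Longrightarrow> y \<in> A \<Longrightarrow> x * y \<in> A"
begin

lemma diff [intro]: "x \<in> A \<Longrightarrow> y \<in> A \<Longrightarrow> x - y \<in> A"
  using add[of x "- y"] uminus by simp

lemma power [intro]: "x \<in> A \<Longrightarrow> x ^ k \<in> A"
  by (induction k) auto

lemma sum [intro]: "(\<And>i. i \<in> I \<Longrightarrow> f i \<in> A) \<Longrightarrow> sum f I \<in> A"
  by (induction I rule: infinite_finite_induct) auto

lemma prod [intro]: "(\<And>i. i \<in> I \<Longrightarrow> f i \<in> A) \<Longrightarrow> prod f I \<in> A"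
  by (induction I rule: infinite_finite_induct) auto

end

locale ideal_of = subrng A for A :: "'a::field set" +
  fixes I :: "'a set"
  assumes sub: "I \<subseteq> A" and zero_in [simp, intro]: "0 \<in> I"
    and add_in [intro]: "x \<in> I \<Longrightarrow> y \<in> I \<Longrightarrow> x + y \<in> I"
    and mult_in: "a \<in> A \<Longrightarrow> x \<in> I \<Longrightarrow> a * x \<in> I"
begin

lemma mult_in': "x \<in> I \<Longrightarrow> a \<in> A \<Longrightarrow> x * a \<in> I"
  using mult_in[of a x] by (simp add: mult.commute)

lemma uminus_in: "x \<in> I \<Longrightarrow> - x \<in> I"
  using mult_in[of "-1" x] by auto

lemma diff_in: "x \<in> I \<Longrightarrow> y \<in> I \<Longrightarrow> x - y \<in> I"
  using add_in[of x "- y"] uminus_in by simp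

lemma sum_in: "(\<And>i. i \<in> Z \<Longrightarrow> f i \<in> I) \<Longrightarrow> sum f Z \<in> I"
  by (induction Z rule: infinite_finite_induct) auto

end

locale prime_of = ideal_of A P for A P :: "'a::field set" +
  assumes one_notin: "1 \<notin> P"
    and prime: "a \<in> A \<Longrightarrow> b \<in> A \<Longrightarrow> a * b \<in> P \<Longrightarrow> a \<in> P \<or> b \<in> P"
begin

lemma prime_power: "a \<in> A \<Longrightarrow> a ^ k \<in> P \<Longrightarrow> a \<in> P"
  by (induction k) (use one_notin prime in auto)

lemma prime_prod: "finite I \<Longrightarrow> (\<And>i. i \<in> I \<Longrightarrow> f i \<in> A) \<Longrightarrow> prod f I \<in> P \<Longrightarrow> \<exists>i\<in>I. f i \<in> P"
proof (induction I rule: finite_induct)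
  case (insert x F)
  then have "f x \<in> P \<or> prod f F \<in> P"
    by (intro prime) auto
  then show ?case using insert by auto
qed (use one_notin in auto)

lemma diff_mult: "a \<in> A - P \<Longrightarrow> b \<in> A - P \<Longrightarrow> a * b \<in> A - P"
  using prime by auto

end

text \<open>An ideal maximal among those missing the multiplicative set \<open>M\<close> is prime:
  if \<open>a\<close> and \<open>b\<close> lie outside it, adjoining either one produces an element
  of \<open>M\<close>, and the product of these two elements is in \<open>M\<close> but would be in
  \<open>P\<close> if \<open>a * b\<close> were. Applied to products of primes in
  \<open>kaplansky_criterion\<close> and to a mixed set in \<open>going_down\<close>.\<close>

lemma prime_avoiding_exists:
  assumes "ideal_of A I" "I \<inter> M = {}" "1 \<in> M" "M \<subseteq> A" "\<And>x y. x \<in> M \<Longrightarrow> y \<in> M \<Longrightarrow> x * y \<in> M"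
  shows "\<exists>P. prime_of A P \<and> I \<subseteq> P \<and> P \<inter> M = {}"
proof -
  interpret I: ideal_of A I by fact
  define C where "C = {J. ideal_of A J \<and> I \<subseteq> J \<and> J \<inter> M = {}}"
  have "\<exists>P\<in>C. \<forall>Z\<in>C. P \<subseteq> Z \<longrightarrow> Z = P"
  proof (rule subset_Zorn_nonempty)
    show "C \<noteq> {}" using assms by (auto simp: C_def)
  next
    fix \<C> assume ne: "\<C> \<noteq> {}" and ch: "subset.chain C \<C>"
    have idl: "ideal_of A J" "I \<subseteq> J" "J \<inter> M = {}" if "J \<in> \<C>" for J
      using ch that by (auto simp: subset.chain_def C_def)
    have "ideal_of A (\<Union>\<C>)"
    proof unfold_locales
      show "\<Union>\<C> \<subseteq> A" using idl(1) ideal_of.sub by blast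
      show "0 \<in> \<Union>\<C>" using ne idl(1) ideal_of.zero_in by blast
      show "a * x \<in> \<Union>\<C>" if "a \<in> A" "x \<in> \<Union>\<C>" for a x
        using that idl(1) ideal_of.mult_in by blast
      fix x y assume "x \<in> \<Union>\<C>" "y \<in> \<Union>\<C>"
      then obtain Z Y where XY: "Z \<in> \<C>" "x \<in> Z" "Y \<in> \<C>" "y \<in> Y" by auto
      then have "Z \<subseteq> Y \<or> Y \<subseteq> Z" using ch by (meson subset.chain_def subset_chain_def)
      then show "x + y \<in> \<Union>\<C>"
        using XY idl(1) ideal_of.add_in by (metis UnionI subsetD)
    qed
    then show "\<Union>\<C> \<in> C" using idl ne by (auto simp: C_def)
  qed
  then obtain P where P: "P \<in> C" and max: "\<And>Z. Z \<in> C \<Longrightarrow> P \<subseteq> Z \<Longrightarrow> Z = P" by blast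
  interpret P: ideal_of A P using P by (simp add: C_def)
  have disj: "P \<inter> M = {}" "I \<subseteq> P" using P by (auto simp: C_def)
  have meets: "\<exists>x\<in>P. \<exists>c\<in>A. x + c * a \<in> M" if a: "a \<in> A" "a \<notin> P" for a
  proof (rule ccontr)
    assume no: "\<not> ?thesis"
    define J where "J = {x + c * a | x c. x \<in> P \<and> c \<in> A}"
    have sub: "P \<subseteq> J" unfolding J_def using I.zero by force
    have "ideal_of A J"
    proof unfold_locales
      show "J \<subseteq> A" using P.sub a unfolding J_def by auto
      show "0 \<in> J" using sub by auto
    next
      fix x y assume "x \<in> J" "y \<in> J"
      then obtain u c v d where "x = u + c * a" "y = v + d * a" "u \<in> P" "v \<in> P" "c \<in> A" "d \<in> A"
        unfolding J_def by auto
      then have "x + y = (u + v) + (c + d) * a" "u + v \<in> P" "c + d \<in> A" by (auto simp: algebra_simps)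
      then show "x + y \<in> J" unfolding J_def by blast
    next
      fix b x assume b: "b \<in> A" "x \<in> J"
      then obtain u c where "x = u + c * a" "u \<in> P" "c \<in> A"
        unfolding J_def by auto
      then have "b * x = b * u + (b * c) * a" "b * u \<in> P" "b * c \<in> A"
        using b P.mult_in by (auto simp: algebra_simps)
      then show "b * x \<in> J" unfolding J_def by blast
    qed
    then have "J \<in> C" using sub disj no by (auto simp: C_def J_def)
    then have "J = P" using max sub by auto
    moreover have "a \<in> J" unfolding J_def
      using P.zero_in I.one by (metis (mono_tags, lifting) add_0 mem_Collect_eq mult_1)
    ultimately show False using a by auto
  qed
  have "prime_of A P"
  proof unfold_locales
    show "1 \<notin> P" using disj assms(3) by auto
    fix a b assume ab: "a \<in> A" "b \<in> A" "a * b \<in> P"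
    show "a \<in> P \<or> b \<in> P"
    proof (rule ccontr)
      assume "\<not> ?thesis"
      then obtain x c y d where h: "x \<in> P" "c \<in> A" "x + c * a \<in> M" "y \<in> P" "d \<in> A" "y + d * b \<in> M"
        using meets ab by metis
      have "(x + c * a) * (y + d * b) = x * (y + d * b) + (c * a) * y + (c * d) * (a * b)"
        by (simp add: algebra_simps)
      also have "\<dots> \<in> P"
        using h ab assms(4) P.mult_in'[OF h(1), of "y + d * b"] P.mult_in[of "c * a" y]
          P.mult_in[of "c * d" "a * b"] by (auto simp del: distrib_left distrib_right)
      finally show False using assms(5)[OF h(3,6)] disj by auto
    qed
  qed
  then show ?thesis using disj by blast
qed

definition prime_element :: "'a::field set \<Rightarrow> 'a \<Rightarrow> bool" where
  "prime_element R p \<longleftrightarrow> p \<in> R \<and> p \<noteq> 0 \<and> inverse p \<notin> R \<and>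
     (\<forall>a\<in>R. \<forall>b\<in>R. a * b / p \<in> R \<longrightarrow> a / p \<in> R \<or> b / p \<in> R)"

text \<open>For \<open>p = 0\<close> this is the whole field, since \<open>x / 0 = 0\<close>.\<close>

definition multiples :: "'a::field set \<Rightarrow> 'a \<Rightarrow> 'a set" where
  "multiples R p = {x. x / p \<in> R}"

lemma (in subrng) ideal_multiples:
  assumes "p \<in> A" "p \<noteq> 0"
  shows "ideal_of A (multiples A p)"
proof unfold_locales
  show "multiples A p \<subseteq> A"
  proof
    fix x assume "x \<in> multiples A p"
    then have "p * (x / p) \<in> A" using assms unfolding multiples_def by blast
    then show "x \<in> A" using assms by simp
  qed
  show "a * x \<in> multiples A p" if "a \<in> A" "x \<in> multiples A p" for a x
    using that mult unfolding multiples_def by (metis mem_Collect_eq times_divide_eq_right)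
qed (auto simp: multiples_def add_divide_distrib)

lemma (in subrng) multiples_eqI:
  assumes "p / q \<in> A" "q / p \<in> A" "p \<noteq> 0" "q \<noteq> 0"
  shows "multiples A p = multiples A q"
proof -
  have "x / q \<in> A" if "x / p \<in> A" "p / q \<in> A" "p \<noteq> 0" for x p q
    using mult[OF that(1,2)] that(3) by simp
  then show ?thesis using assms unfolding multiples_def by blast
qed

lemma prime_element_ideal:
  assumes "subrng R" "prime_element R p"
  shows "prime_of R (multiples R p)"
proof -
  interpret ideal_of R "multiples R p"
    using assms subrng.ideal_multiples by (auto simp: prime_element_def)
  show ?thesis
    by unfold_locales (use assms in \<open>auto simp: multiples_def prime_element_def inverse_eq_divide\<close>)
qed

lemma prime_elementI:
  assumes "prime_of R P" "P = multiples R p" "p \<noteq> 0"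
  shows "prime_element R p"
proof -
  interpret prime_of R P by fact
  have "p \<in> P" using assms by (auto simp: multiples_def)
  then show ?thesis
    unfolding prime_element_def
    using assms sub one_notin prime unfolding multiples_def
    by (auto simp: inverse_eq_divide)
qed

text \<open>The index counts prime factors with multiplicity. Dividing by a prime lowers it by one
  (\<open>factors_divide\<close>), which makes it the induction measure wherever the power of a
  prime has to be bounded.\<close>

inductive factors :: "'a::field set \<Rightarrow> nat \<Rightarrow> 'a \<Rightarrow> bool" for R where
  unit: "a \<in> R \<Longrightarrow> inverse a \<in> R \<Longrightarrow> a \<noteq> 0 \<Longrightarrow> factors R 0 a"
| prime: "prime_element R p \<Longrightarrow> factors R k a \<Longrightarrow> factors R (Suc k) (p * a)"

text \<open>Existence can serve as the definition because the factors are prime and not merely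
  irreducible: uniqueness up to units is then automatic.\<close>

locale ufd = subrng R for R :: "'a::field set" +
  assumes factors_exist: "a \<in> R \<Longrightarrow> a \<noteq> 0 \<Longrightarrow> \<exists>k. factors R k a"

context subrng
begin

lemma factors_in: "factors A k a \<Longrightarrow> a \<in> A \<and> a \<noteq> 0"
  by (induction rule: factors.induct) (auto simp: prime_element_def)

lemma factors_unit_mult:
  "factors A k a \<Longrightarrow> e \<in> A \<Longrightarrow> inverse e \<in> A \<Longrightarrow> e \<noteq> 0 \<Longrightarrow> factors A k (e * a)"
proof (induction rule: factors.induct)
  case (unit a)
  then show ?case by (intro factors.unit) auto
next
  case (prime p k a)
  then have "factors A (Suc k) (p * (e * a))" by (intro factors.prime)
  then show ?case by (simp add: mult.left_commute)
qed

lemma factors_divide: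
  "factors A k a \<Longrightarrow> prime_element A \<pi> \<Longrightarrow> a / \<pi> \<in> A \<Longrightarrow> \<exists>l. k = Suc l \<and> factors A l (a / \<pi>)"
proof (induction rule: factors.induct)
  case (unit a)
  then have "inverse a * (a / \<pi>) \<in> A" by blast
  then show ?case using unit by (auto simp: prime_element_def inverse_eq_divide)
next
  case (prime p k a)
  have a: "a \<in> A" "a \<noteq> 0" using factors_in prime by auto
  have p: "p \<in> A" "p \<noteq> 0" using prime by (auto simp: prime_element_def)
  have pi: "\<pi> \<in> A" "\<pi> \<noteq> 0" "inverse \<pi> \<notin> A" using prime by (auto simp: prime_element_def)
  consider "p / \<pi> \<in> A" | "a / \<pi> \<in> A" using prime a p unfolding prime_element_def by blast
  then show ?case
  proof cases
    case 1
    \<comment> \<open>Two primes one of which divides the other are associates: \<open>p\<close>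
      divides \<open>\<pi>\<close> or \<open>p / \<pi>\<close>, and the latter would make
      \<open>\<pi>\<close> a unit. The unit \<open>p / \<pi>\<close> is absorbed into the remaining
      factors.\<close>
    have "\<pi> * (p / \<pi>) / p \<in> A" using p pi by simp
    then have "\<pi> / p \<in> A \<or> p / \<pi> / p \<in> A"
      using prime(1) pi 1 unfolding prime_element_def by blast
    moreover have "p / \<pi> / p = inverse \<pi>" using p by (simp add: field_simps)
    ultimately have "inverse (p / \<pi>) \<in> A" using pi p by (simp add: field_simps)
    then have "factors A k (p / \<pi> * a)" using 1 p pi by (intro factors_unit_mult[OF prime(2)]) auto
    then show ?thesis by simp
  next
    case 2
    then obtain l where "k = Suc l" "factors A l (a / \<pi>)" using prime by auto
    then show ?thesis using factors.prime[OF prime(1), of l "a / \<pi>"] by auto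
  qed
qed

text \<open>Each prime factor of \<open>a * b\<close> divides \<open>a\<close> or \<open>b\<close>
  and is cancelled there. The set of products of primes is thus saturated, so the multiples of an
  element that is not such a product all lie outside it.\<close>

lemma factors_divisor:
  "factors A k c \<Longrightarrow> a \<in> A \<Longrightarrow> b \<in> A \<Longrightarrow> c = a * b \<Longrightarrow> \<exists>l. factors A l a"
proof (induction arbitrary: a b rule: factors.induct)
  case (unit c)
  have "inverse a = b * inverse c" using unit by (auto simp: field_simps)
  then have "inverse a \<in> A" using unit by (metis mult)
  then have "factors A 0 a" using unit by (intro factors.unit) auto
  then show ?case ..
next
  case (prime p k c)
  have p: "p \<in> A" "p \<noteq> 0" using prime by (auto simp: prime_element_def)
  have c: "c \<in> A" "c \<noteq> 0" using factors_in prime by auto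
  have "a * b / p \<in> A" using prime(6) p c by (metis nonzero_mult_div_cancel_left)
  then consider "a / p \<in> A" | "b / p \<in> A" using prime p unfolding prime_element_def by blast
  then show ?case
  proof cases
    case 1
    have "c = a / p * b" using prime(6) p by (simp add: field_simps)
    then obtain l where "factors A l (a / p)" using prime.IH[OF 1 prime(5)] by auto
    from factors.prime[OF prime(1) this] p show ?thesis by auto
  next
    case 2
    have "c = a * (b / p)" using prime(6) p by (simp add: field_simps)
    then show ?thesis using prime.IH[OF prime(4) 2] by auto
  qed
qed

text \<open>If \<open>a\<close> were not a product of primes, its multiples would miss the
  multiplicative set of such products, and so would some prime ideal containing \<open>a\<close>.
  But that ideal contains a prime element.\<close>

lemma kaplansky_criterion:
  assumes "\<And>Q. prime_of A Q \<Longrightarrow> Q \<noteq> {0} \<Longrightarrow> \<exists>p\<in>Q. prime_element A p"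
  shows "ufd A"
proof (unfold_locales, rule ccontr)
  fix a assume a: "a \<in> A" "a \<noteq> 0" and no: "\<not> (\<exists>k. factors A k a)"
  define M where "M = {c. \<exists>k. factors A k c}"
  define I where "I = multiples A a"
  have mult_M: "x * y \<in> M" if xy: "x \<in> M" "y \<in> M" for x y
  proof -
    obtain k l where "factors A k x" "factors A l y" using xy by (auto simp: M_def)
    from \<open>factors A k x\<close> have "\<exists>k. factors A k (x * y)"
    proof (induction rule: factors.induct)
      case (unit x)
      then show ?case using factors_unit_mult \<open>factors A l y\<close> by blast
    next
      case (prime p k x)
      then show ?case using factors.prime by (metis mult.assoc)
    qed
    then show ?thesis by (simp add: M_def)
  qed
  have "ideal_of A I" using ideal_multiples a by (simp add: I_def)
  moreover have "I \<inter> M = {}"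
    using no a factors_divisor[of _ _ a "_ / a"] by (auto simp: I_def M_def multiples_def)
  moreover have "1 \<in> M" using factors.unit[of 1 A] by (auto simp: M_def)
  moreover have "M \<subseteq> A" using factors_in by (auto simp: M_def)
  ultimately obtain P where P: "prime_of A P" "I \<subseteq> P" "P \<inter> M = {}"
    using prime_avoiding_exists[of A I M] mult_M by blast
  have "a \<in> P" using P(2) a by (auto simp: I_def multiples_def)
  then obtain p where p: "p \<in> P" "prime_element A p" using assms[OF P(1)] a by auto
  have "factors A 1 (p * 1)" using factors.prime[OF p(2) factors.unit[of 1]] by auto
  then show False using P(3) p(1) by (auto simp: M_def)
qed

end

lemma (in ufd) prime_ideal_contains_prime:
  assumes "prime_of R Q" "a \<in> Q" "a \<noteq> 0"
  shows "\<exists>p\<in>Q. prime_element R p"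
proof -
  interpret Q: prime_of R Q by fact
  obtain k where "factors R k a" using factors_exist assms Q.sub by blast
  then show ?thesis using assms(2)
  proof (induction rule: factors.induct)
    case (unit a)
    then show ?case using Q.mult_in[of "inverse a" a] Q.one_notin by auto
  next
    case (prime p k a)
    then show ?case using Q.prime[of p a] factors_in by (auto simp: prime_element_def)
  qed
qed

lemma (in ufd) multiplicity_bound:
  assumes "prime_element R \<pi>" "a \<in> R" "a \<noteq> 0"
  shows "\<exists>k. a / \<pi> ^ k \<in> R \<and> a / \<pi> ^ Suc k \<notin> R"
proof -
  obtain n where "factors R n a" using factors_exist assms by blast
  then show ?thesis using assms(2,3)
  proof (induction n arbitrary: a rule: less_induct)
    case (less n)
    show ?case
    proof (cases "a / \<pi> \<in> R")
      case True
      then obtain l where l: "n = Suc l" "factors R l (a / \<pi>)"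
        using factors_divide[OF less(2) assms(1)] by auto
      then obtain k where "a / \<pi> / \<pi> ^ k \<in> R" "a / \<pi> / \<pi> ^ Suc k \<notin> R"
        using less.IH[of l "a / \<pi>"] True less.prems assms(1) by (auto simp: prime_element_def)
      then show ?thesis by (intro exI[of _ "Suc k"]) (auto simp: mult.commute)
    next
      case False
      then show ?thesis using less by (intro exI[of _ 0]) auto
    qed
  qed
qed

section \<open>Polynomial rings over factorial rings\<close>

lemma poly_overI: "(\<And>i. coeff f i \<in> B) \<Longrightarrow> f \<in> poly_over B"
  by (simp add: poly_over_def)

lemma poly_overD: "f \<in> poly_over B \<Longrightarrow> coeff f i \<in> B"
  by (simp add: poly_over_def)

lemma poly_over_mono: "B \<subseteq> C \<Longrightarrow> poly_over B \<subseteq> poly_over C"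
  by (auto simp: poly_over_def)

context subrng
begin

lemma poly_over_zero [simp]: "0 \<in> poly_over A" and poly_over_one [simp]: "1 \<in> poly_over A"
  by (auto simp: poly_over_def coeff_1)

lemma poly_over_add: "f \<in> poly_over A \<Longrightarrow> g \<in> poly_over A \<Longrightarrow> f + g \<in> poly_over A"
  and poly_over_uminus: "f \<in> poly_over A \<Longrightarrow> - f \<in> poly_over A"
  and poly_over_diff: "f \<in> poly_over A \<Longrightarrow> g \<in> poly_over A \<Longrightarrow> f - g \<in> poly_over A"
  and poly_over_smult: "c \<in> A \<Longrightarrow> f \<in> poly_over A \<Longrightarrow> smult c f \<in> poly_over A"
  and poly_over_monom: "c \<in> A \<Longrightarrow> monom c k \<in> poly_over A"
  and poly_over_const: "c \<in> A \<Longrightarrow> [:c:] \<in> poly_over A"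
  by (auto simp: poly_over_def coeff_pCons split: nat.split)

lemma poly_over_mult: "f \<in> poly_over A \<Longrightarrow> g \<in> poly_over A \<Longrightarrow> f * g \<in> poly_over A"
  by (auto simp: poly_over_def coeff_mult)

lemma poly_over_sum: "(\<And>i. i \<in> I \<Longrightarrow> f i \<in> poly_over A) \<Longrightarrow> sum f I \<in> poly_over A"
  by (induction I rule: infinite_finite_induct) (auto intro: poly_over_add)

lemma poly_over_prod: "(\<And>i. i \<in> I \<Longrightarrow> f i \<in> poly_over A) \<Longrightarrow> prod f I \<in> poly_over A"
  by (induction I rule: infinite_finite_induct) (auto intro: poly_over_mult)

lemma poly_in: "f \<in> poly_over A \<Longrightarrow> x \<in> A \<Longrightarrow> poly f x \<in> A"
  by (auto simp: poly_altdef poly_over_def)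

text \<open>Instead of dividing by the leading coefficient \<open>l\<close> of \<open>f\<close>,
  each step multiplies \<open>g\<close> by it, so \<open>c\<close> is a power of \<open>l\<close>.
  The applications remove this factor again by \<open>primitive_divides\<close>.\<close>

lemma pseudo_division:
  assumes "f \<in> poly_over A" "g \<in> poly_over A" "f \<noteq> 0"
  shows "\<exists>c\<in>A. \<exists>q\<in>poly_over A. \<exists>r\<in>poly_over A.
           c \<noteq> 0 \<and> smult c g = f * q + r \<and> (r = 0 \<or> degree r < degree f)"
  using assms(2)
proof (induction "degree g" arbitrary: g rule: less_induct)
  case less
  show ?case
  proof (cases "g = 0 \<or> degree g < degree f")
    case True
    then show ?thesis using less.prems by (intro bexI[of _ 1] bexI[of _ 0] bexI[of _ g]) auto
  next
    case False
    define l h where "l = lead_coeff f" and "h = monom (lead_coeff g) (degree g - degree f)"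
    define g' where "g' = smult l g - h * f"
    have l: "l \<in> A" "l \<noteq> 0" using assms by (auto simp: l_def poly_over_def)
    have h: "h \<in> poly_over A" using less.prems by (auto simp: h_def poly_over_def intro: poly_over_monom)
    have g': "g' \<in> poly_over A" unfolding g'_def
      using l h less.prems assms by (intro poly_over_diff poly_over_smult poly_over_mult)
    have *: "g' = 0 \<or> degree g' < degree g"
    proof -
      have "degree h = degree g - degree f" using False by (simp add: h_def degree_monom_eq)
      then have "degree (h * f) \<le> degree g" using False degree_mult_le[of h f] by simp
      then have "degree g' \<le> degree g" unfolding g'_def
        by (meson degree_diff_le degree_smult_le order.trans)
      moreover have "coeff g' (degree g) = 0"
        using False by (simp add: g'_def h_def l_def coeff_monom_mult)
      ultimately show ?thesis
        by (metis le_neq_implies_less leading_coeff_0_iff)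
    qed
    have g: "smult l g = g' + h * f" by (simp add: g'_def)
    show ?thesis
    proof (cases "g' = 0")
      case True
      then show ?thesis using g l h by (intro bexI[of _ l] bexI[of _ h] bexI[of _ 0]) (auto simp: mult.commute)
    next
      case False
      then obtain c q r where c: "c \<in> A" "q \<in> poly_over A" "r \<in> poly_over A" "c \<noteq> 0"
        "smult c g' = f * q + r" "r = 0 \<or> degree r < degree f"
        using less.hyps[of g'] g' * by blast
      have "smult (c * l) g = f * (q + smult c h) + r"
      proof -
        have "smult (c * l) g = smult c (smult l g)" by simp
        also have "\<dots> = smult c g' + f * smult c h" unfolding g by (simp add: smult_add_right mult.commute)
        also have "\<dots> = f * (q + smult c h) + r" unfolding c(5) by (simp add: algebra_simps)
        finally show ?thesis .
      qed
      moreover have "q + smult c h \<in> poly_over A" using c h by (intro poly_over_add poly_over_smult)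
      ultimately show ?thesis using c l by (intro bexI[of _ "c * l"] bexI[of _ "q + smult c h"] bexI[of _ r]) auto
    qed
  qed
qed

end

text \<open>Compare the lowest coefficients outside the prime ideal.\<close>

lemma (in prime_of) poly_over_prime:
  assumes "f \<in> poly_over A" "g \<in> poly_over A" "f * g \<in> poly_over P"
  shows "f \<in> poly_over P \<or> g \<in> poly_over P"
proof (rule ccontr)
  assume no: "\<not> ?thesis"
  define a where "a = (LEAST i. coeff f i \<notin> P)"
  define b where "b = (LEAST i. coeff g i \<notin> P)"
  have a: "coeff f a \<notin> P" "\<And>i. i < a \<Longrightarrow> coeff f i \<in> P"
    unfolding a_def using no LeastI_ex[of "\<lambda>i. coeff f i \<notin> P"] not_less_Least[of _ "\<lambda>i. coeff f i \<notin> P"]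
    by (blast intro: poly_overI)+
  have b: "coeff g b \<notin> P" "\<And>i. i < b \<Longrightarrow> coeff g i \<in> P"
    unfolding b_def using no LeastI_ex[of "\<lambda>i. coeff g i \<notin> P"] not_less_Least[of _ "\<lambda>i. coeff g i \<notin> P"]
    by (blast intro: poly_overI)+
  have fg: "coeff f i \<in> A" "coeff g i \<in> A" for i using assms by (auto simp: poly_over_def)
  have "coeff (f * g) (a + b) = (\<Sum>i\<in>{..a+b}. coeff f i * coeff g (a + b - i))"
    by (simp add: coeff_mult)
  also have "\<dots> = coeff f a * coeff g b + (\<Sum>i\<in>{..a+b} - {a}. coeff f i * coeff g (a + b - i))"
    by (subst sum.remove[of _ a]) auto
  finally have "coeff f a * coeff g b
      = coeff (f * g) (a + b) - (\<Sum>i\<in>{..a+b} - {a}. coeff f i * coeff g (a + b - i))"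
    by simp
  also have "\<dots> \<in> P"
  proof (intro diff_in sum_in)
    show "coeff (f * g) (a + b) \<in> P" using assms by (auto simp: poly_over_def)
    fix i assume i: "i \<in> {..a+b} - {a}"
    show "coeff f i * coeff g (a + b - i) \<in> P"
    proof (cases "i < a")
      case True
      then show ?thesis using a fg by (intro mult_in') auto
    next
      case False
      then have "a + b - i < b" using i by auto
      then show ?thesis using b fg by (intro mult_in) auto
    qed
  qed
  finally show False using prime a b fg by blast
qed

definition primitive :: "'a::field set \<Rightarrow> 'a poly \<Rightarrow> bool" where
  "primitive R f \<longleftrightarrow> (\<forall>\<pi>. prime_element R \<pi> \<longrightarrow> f \<notin> poly_over (multiples R \<pi>))"

lemma poly_over_multiples_iff:
  "\<pi> \<noteq> 0 \<Longrightarrow> f \<in> poly_over (multiples R \<pi>) \<longleftrightarrow> smult (inverse \<pi>) f \<in> poly_over R"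
  by (simp add: poly_over_def multiples_def divide_inverse mult.commute)

context ufd
begin

text \<open>Gauss's lemma: a prime factor of \<open>c\<close> divides all coefficients of
  \<open>f * q\<close> but not all those of the primitive \<open>f\<close>, hence it divides
  \<open>q\<close> and can be cancelled. This goes on until \<open>c\<close> is a unit.\<close>

lemma primitive_divides:
  assumes "primitive R f" "f \<in> poly_over R" "g \<in> poly_over R" "c \<in> R" "c \<noteq> 0"
    "q \<in> poly_over R" "smult c g = f * q"
  shows "\<exists>q'\<in>poly_over R. g = f * q'"
proof -
  obtain k where "factors R k c" using factors_exist assms by blast
  then show ?thesis using assms(6,7)
  proof (induction arbitrary: q rule: factors.induct)
    case (unit c)
    have "g = smult (inverse c) (smult c g)" using unit(3) by simp
    also have "\<dots> = f * smult (inverse c) q" unfolding unit by simp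
    finally have "g = f * smult (inverse c) q" .
    then show ?case using unit poly_over_smult by blast
  next
    case (prime p k c)
    interpret Q: prime_of R "multiples R p" using prime_element_ideal prime subrng_axioms by blast
    have p: "p \<noteq> 0" "p \<in> R" using prime by (auto simp: prime_element_def)
    have c: "c \<in> R" using prime factors_in by auto
    have "smult (inverse p) (f * q) = smult c g"
      using p by (simp flip: prime(5) add: mult.assoc[symmetric])
    then have "f * q \<in> poly_over (multiples R p)"
      using c p assms(3) poly_over_smult by (simp add: poly_over_multiples_iff)
    then have "q \<in> poly_over (multiples R p)"
      using Q.poly_over_prime assms(1,2) prime by (auto simp: primitive_def)
    then have "smult (inverse p) q \<in> poly_over R" using p by (simp add: poly_over_multiples_iff)
    moreover have "smult c g = f * smult (inverse p) q"
      using \<open>smult (inverse p) (f * q) = smult c g\<close> by simp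
    ultimately show ?case using prime.IH by blast
  qed
qed

text \<open>Primes dividing all coefficients are pulled out one at a time; each lowers the number of
  prime factors of the leading coefficient, so the process ends.\<close>

lemma primitive_part_exists:
  assumes "f \<in> poly_over R" "f \<noteq> 0"
  shows "\<exists>c\<in>R. \<exists>g\<in>poly_over R. c \<noteq> 0 \<and> f = smult c g \<and> primitive R g"
proof -
  have "lead_coeff f \<in> R" "lead_coeff f \<noteq> 0" using assms by (auto simp: poly_over_def)
  then obtain n where "factors R n (lead_coeff f)" using factors_exist by blast
  then show ?thesis using assms
  proof (induction n arbitrary: f rule: less_induct)
    case (less n)
    show ?case
    proof (cases "primitive R f")
      case True
      then show ?thesis using less.prems by (intro bexI[of _ 1] bexI[of _ f]) auto
    next
      case False
      then obtain \<pi> where \<pi>: "prime_element R \<pi>" "f \<in> poly_over (multiples R \<pi>)"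
        by (auto simp: primitive_def)
      then have [simp]: "\<pi> \<noteq> 0" and "\<pi> \<in> R" by (auto simp: prime_element_def)
      define f' where "f' = smult (inverse \<pi>) f"
      have f: "f = smult \<pi> f'" by (simp add: f'_def)
      have "lead_coeff f / \<pi> \<in> R" using \<pi> by (auto simp: poly_over_def multiples_def)
      then obtain l where "n = Suc l" "factors R l (lead_coeff f / \<pi>)"
        using factors_divide less.prems \<pi> by blast
      moreover have "lead_coeff f / \<pi> = lead_coeff f'" by (simp add: f)
      moreover have "f' \<in> poly_over R" using \<pi> by (simp add: poly_over_multiples_iff f'_def)
      moreover have "f' \<noteq> 0" using less.prems f by auto
      ultimately obtain c g where "c \<in> R" "g \<in> poly_over R" "c \<noteq> 0" "f' = smult c g" "primitive R g"
        using less.IH[of l f'] by auto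
      then show ?thesis using f \<open>\<pi> \<in> R\<close>
        by (intro bexI[of _ "\<pi> * c"] bexI[of _ g]) auto
    qed
  qed
qed

end

section \<open>Adjoining one element to a ring\<close>

definition adj :: "'a::field set \<Rightarrow> 'a \<Rightarrow> 'a set" where
  "adj A t = (\<lambda>f. poly f t) ` poly_over A"

lemma adjI: "f \<in> poly_over A \<Longrightarrow> poly f t \<in> adj A t"
  by (simp add: adj_def)

context subrng
begin

lemma subrng_adj: "subrng (adj A t)"
proof
  show "0 \<in> adj A t" "1 \<in> adj A t"
    using adjI[of 0 A t] adjI[of 1 A t] by auto
  fix x y assume "x \<in> adj A t" "y \<in> adj A t"
  then obtain f g where fg: "x = poly f t" "y = poly g t" "f \<in> poly_over A" "g \<in> poly_over A"
    by (auto simp: adj_def)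
  show "x + y \<in> adj A t" "x * y \<in> adj A t" "- x \<in> adj A t"
    using adjI[OF poly_over_add[OF fg(3,4)]] adjI[OF poly_over_mult[OF fg(3,4)]]
      adjI[OF poly_over_uminus[OF fg(3)]] fg by auto
qed

lemma subset_adj: "A \<subseteq> adj A t"
  using adjI[of "[:_:]" A t] poly_over_const by (force simp: adj_def)

lemma gen_in_adj: "t \<in> adj A t"
  using adjI[of "[:0, 1:]" A t] by (auto simp: poly_over_def coeff_pCons split: nat.split)

lemma adj_subset: "subrng C \<Longrightarrow> A \<subseteq> C \<Longrightarrow> t \<in> C \<Longrightarrow> adj A t \<subseteq> C"
  unfolding adj_def by (intro image_subsetI subrng.poly_in) (use poly_over_mono[of A C] in blast)+

lemma transcendental_inject:
  assumes "\<not> algebraic_over A t" "f \<in> poly_over A" "g \<in> poly_over A" "poly f t = poly g t"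
  shows "f = g"
proof -
  have "f - g \<in> poly_over A" "poly (f - g) t = 0" using assms poly_over_diff by auto
  then show ?thesis using assms(1) by (auto simp: algebraic_over_def)
qed

lemma unit_adj:
  assumes tr: "\<not> algebraic_over A t" and x: "x \<in> adj A t" "inverse x \<in> adj A t" "x \<noteq> 0"
  shows "x \<in> A \<and> inverse x \<in> A"
proof -
  obtain f g where fg: "x = poly f t" "inverse x = poly g t" "f \<in> poly_over A" "g \<in> poly_over A"
    using x by (auto simp: adj_def)
  have "poly (f * g) t = poly 1 t" unfolding poly_mult fg(1,2)[symmetric] using x by simp
  then have *: "f * g = 1" using transcendental_inject[OF tr] fg poly_over_mult by auto
  then have "f \<noteq> 0" "g \<noteq> 0" by auto
  then have "degree f + degree g = 0" using * by (metis degree_1 degree_mult_eq)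
  then obtain a b where "f = [:a:]" "g = [:b:]" by (metis add_is_0 degree_eq_zeroE)
  then show ?thesis using fg poly_overD[of f A 0] poly_overD[of g A 0] by auto
qed

end

text \<open>Evaluation at a transcendental element is injective, so the primality of the polynomials
  with coefficients in \<open>P\<close> carries over to their values. Iterated along the upper
  variables this gives the extended primes.\<close>

lemma (in prime_of) prime_adj:
  assumes tr: "\<not> algebraic_over A t"
  shows "prime_of (adj A t) (adj P t)"
proof -
  have PA: "poly_over P \<subseteq> poly_over A" using poly_over_mono sub by blast
  interpret B: subrng "adj A t" by (rule subrng_adj)
  show ?thesis
  proof unfold_locales
    show "adj P t \<subseteq> adj A t" using PA by (auto simp: adj_def)
    show "0 \<in> adj P t" using adjI[of 0 P t] by (auto simp: poly_over_def)
    show "1 \<notin> adj P t"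
    proof
      assume "1 \<in> adj P t"
      then obtain f where "f \<in> poly_over P" "poly f t = poly 1 t" by (auto simp: adj_def)
      then have "1 \<in> poly_over P" using transcendental_inject[OF tr, of f 1] PA by auto
      then show False using one_notin poly_overD[of 1 P 0] by auto
    qed
  next
    fix x y assume "x \<in> adj P t" "y \<in> adj P t"
    then obtain f g where fg: "x = poly f t" "y = poly g t" "f \<in> poly_over P" "g \<in> poly_over P"
      by (auto simp: adj_def)
    then have "f + g \<in> poly_over P" by (auto simp: poly_over_def)
    from adjI[OF this, of t] fg show "x + y \<in> adj P t" by auto
  next
    fix a x assume "a \<in> adj A t" "x \<in> adj P t"
    then obtain f g where fg: "a = poly f t" "x = poly g t" "f \<in> poly_over A" "g \<in> poly_over P"
      by (auto simp: adj_def)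
    then have "f * g \<in> poly_over P" by (auto simp: poly_over_def coeff_mult intro!: sum_in mult_in)
    from adjI[OF this, of t] fg show "a * x \<in> adj P t" by auto
  next
    fix a b assume "a \<in> adj A t" "b \<in> adj A t" "a * b \<in> adj P t"
    then obtain f g h where fg: "a = poly f t" "b = poly g t" "f \<in> poly_over A" "g \<in> poly_over A"
      "h \<in> poly_over P" "poly (f * g) t = poly h t"
      by (auto simp: adj_def)
    then have "f * g = h" using transcendental_inject[OF tr] poly_over_mult PA by blast
    then show "a \<in> adj P t \<or> b \<in> adj P t" using poly_over_prime fg adjI by metis
  qed
qed

text \<open>By Kaplansky's criterion it is enough to find one prime element in each nonzero prime
  ideal \<open>Q\<close>. If \<open>Q\<close> meets \<open>R\<close> in more than 0, a prime of
  \<open>R\<close> in \<open>Q\<close> remains prime. Otherwise constants can be cancelled modulo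
  \<open>Q\<close>, so a nonzero polynomial of least degree in \<open>Q\<close> may be taken
  primitive, and by pseudo-division and Gauss's lemma it generates \<open>Q\<close>.\<close>

theorem (in ufd) ufd_adj:
  assumes tr: "\<not> algebraic_over R t"
  shows "ufd (adj R t)"
proof -
  interpret B: subrng "adj R t" by (rule subrng_adj)
  show ?thesis
  proof (rule B.kaplansky_criterion)
    fix Q assume Q: "prime_of (adj R t) Q" "Q \<noteq> {0}"
    interpret Q: prime_of "adj R t" Q by fact
    show "\<exists>p\<in>Q. prime_element (adj R t) p"
    proof (cases "Q \<inter> R = {0}")
      case False
      then obtain a where a: "a \<in> Q \<inter> R" "a \<noteq> 0" by auto
      have "prime_of R (Q \<inter> R)"
        by unfold_locales (use Q.mult_in Q.prime Q.one_notin subset_adj[of t] in \<open>auto, blast\<close>)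
      then obtain p where p: "p \<in> Q" "prime_element R p"
        using prime_ideal_contains_prime a by blast
      then have p0: "p \<noteq> 0" "p \<in> R" by (auto simp: prime_element_def)
      interpret pR: prime_of R "multiples R p"
        using prime_element_ideal p subrng_axioms by blast
      have "adj (multiples R p) t = multiples (adj R t) p"
      proof (intro equalityI subsetI)
        fix x assume "x \<in> adj (multiples R p) t"
        then obtain f where "x = poly f t" "f \<in> poly_over (multiples R p)" by (auto simp: adj_def)
        then show "x \<in> multiples (adj R t) p"
          using adjI[of "smult (inverse p) f" R t] p0
          by (auto simp: poly_over_multiples_iff) (simp add: multiples_def divide_inverse mult.commute)
      next
        fix x assume "x \<in> multiples (adj R t) p"
        then obtain f where "x / p = poly f t" "f \<in> poly_over R" by (auto simp: adj_def multiples_def)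
        then have "x = poly (smult p f) t" "smult p f \<in> poly_over (multiples R p)"
          using p0 by (auto simp: poly_over_multiples_iff field_simps)
        then show "x \<in> adj (multiples R p) t" using adjI by blast
      qed
      then have "prime_element (adj R t) p"
        using pR.prime_adj[OF tr] prime_elementI p0 by blast
      then show ?thesis using p by blast
    next
      case True
      define S where "S f \<longleftrightarrow> f \<in> poly_over R \<and> f \<noteq> 0 \<and> poly f t \<in> Q" for f
      obtain x where "x \<in> Q" "x \<noteq> 0" using Q by auto
      then obtain g where "x = poly g t" "g \<in> poly_over R" using Q.sub by (auto simp: adj_def)
      then have "S g" using \<open>x \<in> Q\<close> \<open>x \<noteq> 0\<close> by (auto simp: S_def)
      then have "\<exists>f. S f" by blast
      then obtain f0 where f0: "S f0" "\<And>g. S g \<Longrightarrow> degree f0 \<le> degree g"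
        by (metis ex_has_least_nat)
      then obtain c f where f: "c \<in> R" "f \<in> poly_over R" "c \<noteq> 0" "f0 = smult c f" "primitive R f"
        using primitive_part_exists[of f0] unfolding S_def by blast
      have "c * poly f t \<in> Q" using f0 f by (auto simp: S_def)
      then have "poly f t \<in> Q"
        using Q.prime[of c "poly f t"] True f subset_adj[of t] adjI[of f R t] by auto
      then have Sf: "S f" "\<And>g. S g \<Longrightarrow> degree f \<le> degree g" using f f0 by (auto simp: S_def)
      have "Q = multiples (adj R t) (poly f t)"
      proof (intro equalityI subsetI)
        fix x assume "x \<in> Q"
        then obtain g where g: "g \<in> poly_over R" "x = poly g t" using Q.sub by (auto simp: adj_def)
        obtain c q r where cqr: "c \<in> R" "q \<in> poly_over R" "r \<in> poly_over R" "c \<noteq> 0"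
          "smult c g = f * q + r" "r = 0 \<or> degree r < degree f"
          using pseudo_division[of f g] g f Sf by (auto simp: S_def)
        have "poly r t = c * poly g t - poly q t * poly f t"
          using arg_cong[OF cqr(5), of "\<lambda>p. poly p t"] by (simp add: algebra_simps)
        also have "\<dots> \<in> Q" using \<open>x \<in> Q\<close> g cqr Sf subset_adj adjI[of q R t]
          by (intro Q.diff_in Q.mult_in) (auto simp: S_def)
        finally have "r = 0" using Sf(2)[of r] cqr(3,6) unfolding S_def by fastforce
        then obtain q' where "q' \<in> poly_over R" "g = f * q'"
          using primitive_divides[OF f(5,2) g(1) cqr(1,4,2)] cqr by auto
        then have "x / poly f t = poly q' t"
          using g Sf tr by (auto simp: S_def algebraic_over_def)
        then show "x \<in> multiples (adj R t) (poly f t)"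
          using \<open>q' \<in> poly_over R\<close> adjI by (auto simp: multiples_def)
      next
        fix x assume "x \<in> multiples (adj R t) (poly f t)"
        then have "x / poly f t * poly f t \<in> Q"
          using \<open>poly f t \<in> Q\<close> by (intro Q.mult_in) (auto simp: multiples_def)
        then show "x \<in> Q" using Sf tr by (auto simp: S_def algebraic_over_def)
      qed
      then have "prime_element (adj R t) (poly f t)"
        using prime_elementI[OF Q(1)] Sf tr by (auto simp: S_def algebraic_over_def)
      then show ?thesis using \<open>poly f t \<in> Q\<close> by blast
    qed
  qed
qed

lemma (in subrng) ufd_field:
  assumes "\<And>x. x \<in> A \<Longrightarrow> inverse x \<in> A"
  shows "ufd A"
  by unfold_locales (use assms factors.unit in blast)

section \<open>Integral closure\<close>

definition lspan :: "'a::field set \<Rightarrow> 'a set \<Rightarrow> 'a set" where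
  "lspan A E = {\<Sum>e\<in>E. c e * e | c. c ` E \<subseteq> A}"

definition integral :: "'a::field set \<Rightarrow> 'a \<Rightarrow> bool" where
  "integral A x \<longleftrightarrow> (\<exists>f\<in>poly_over A. lead_coeff f = 1 \<and> poly f x = 0)"

text \<open>Multiplication by \<open>x\<close> maps the finitely generated module
  \<open>lspan A E\<close> into itself. The condition \<open>1 \<in> E\<close> guarantees that the
  vector of generators, used as an eigenvector, is nonzero.\<close>

definition stable :: "'a::field set \<Rightarrow> 'a set \<Rightarrow> 'a \<Rightarrow> bool" where
  "stable A E x \<longleftrightarrow> finite E \<and> 1 \<in> E \<and> (\<forall>e\<in>E. x * e \<in> lspan A E)"

lemma degree_pos_of_root: "lead_coeff f = 1 \<Longrightarrow> poly f x = 0 \<Longrightarrow> degree f \<noteq> 0" for x :: "'a::field"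
  by (cases f) (auto split: if_splits)

lemma monic_root_power:
  fixes x :: "'a::field"
  assumes "lead_coeff f = 1" "poly f x = 0"
  shows "x ^ degree f = - (\<Sum>i<degree f. coeff f i * x ^ i)"
proof -
  have "0 = (\<Sum>i\<le>degree f. coeff f i * x ^ i)" using assms by (simp add: poly_altdef)
  also have "\<dots> = x ^ degree f + (\<Sum>i<degree f. coeff f i * x ^ i)"
    using assms by (simp flip: lessThan_Suc_atMost)
  finally show ?thesis by (simp add: eq_neg_iff_add_eq_0)
qed

context subrng
begin

lemma lspan_zero: "0 \<in> lspan A E"
  unfolding lspan_def by (rule CollectI, rule exI[of _ "\<lambda>_. 0"]) auto

lemma lspan_add: "x \<in> lspan A E \<Longrightarrow> y \<in> lspan A E \<Longrightarrow> x + y \<in> lspan A E"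
  unfolding lspan_def
proof clarify
  fix c d assume "c ` E \<subseteq> A" "d ` E \<subseteq> A"
  then show "\<exists>f. (\<Sum>e\<in>E. c e * e) + (\<Sum>e\<in>E. d e * e) = (\<Sum>e\<in>E. f e * e) \<and> f ` E \<subseteq> A"
    by (intro exI[of _ "\<lambda>e. c e + d e"]) (auto simp: sum.distrib algebra_simps)
qed

lemma lspan_mult: "a \<in> A \<Longrightarrow> x \<in> lspan A E \<Longrightarrow> a * x \<in> lspan A E"
  unfolding lspan_def
proof clarify
  fix c assume "a \<in> A" "c ` E \<subseteq> A"
  then show "\<exists>f. a * (\<Sum>e\<in>E. c e * e) = (\<Sum>e\<in>E. f e * e) \<and> f ` E \<subseteq> A"
    by (intro exI[of _ "\<lambda>e. a * c e"]) (auto simp: sum_distrib_left mult.assoc)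
qed

lemma lspan_uminus: "x \<in> lspan A E \<Longrightarrow> - x \<in> lspan A E"
  using lspan_mult[of "-1" x E] by auto

lemma lspan_sum: "(\<And>i. i \<in> I \<Longrightarrow> f i \<in> lspan A E) \<Longrightarrow> sum f I \<in> lspan A E"
  by (induction I rule: infinite_finite_induct) (auto intro: lspan_add lspan_zero)

lemma lspan_gen:
  assumes "finite E" "e \<in> E"
  shows "e \<in> lspan A E"
proof -
  have "(\<Sum>e'\<in>E. (if e' = e then 1 else 0) * e') = (\<Sum>e'\<in>E. if e' = e then e else 0)"
    by (intro sum.cong) auto
  then have "e = (\<Sum>e'\<in>E. (if e' = e then 1 else 0) * e')" using assms by simp
  then show ?thesis unfolding lspan_def
    by (intro CollectI exI[of _ "\<lambda>e'. if e' = e then 1 else 0"]) auto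
qed

lemma lspan_times:
  assumes "x \<in> lspan A E" "\<And>e. e \<in> E \<Longrightarrow> z * e \<in> lspan A E'"
  shows "z * x \<in> lspan A E'"
proof -
  obtain c where c: "x = (\<Sum>e\<in>E. c e * e)" "c ` E \<subseteq> A" using assms by (auto simp: lspan_def)
  have "z * x = (\<Sum>e\<in>E. c e * (z * e))" unfolding c by (simp add: sum_distrib_left mult.left_commute)
  also have "\<dots> \<in> lspan A E'"
    using c assms by (intro lspan_sum) (rule lspan_mult, auto)
  finally show ?thesis .
qed

text \<open>The vector of the elements of \<open>E\<close> is an eigenvector, with eigenvalue \<open>x\<close>, of a matrix over
  \<open>A\<close>; the characteristic polynomial of that matrix is monic.\<close>

lemma stable_imp_integral:
  assumes "stable A E x"
  shows "integral A x"
proof -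
  have E: "finite E" "1 \<in> E" "\<And>e. e \<in> E \<Longrightarrow> x * e \<in> lspan A E" using assms by (auto simp: stable_def)
  define N where "N = card E"
  obtain h where h: "bij_betw h {0..<N} E" using E ex_bij_betw_nat_finite N_def by blast
  have "\<forall>e\<in>E. \<exists>c. x * e = (\<Sum>e'\<in>E. c e' * e') \<and> c ` E \<subseteq> A"
    using E by (auto simp: lspan_def)
  then obtain c where c: "\<And>e. e \<in> E \<Longrightarrow> x * e = (\<Sum>e'\<in>E. c e e' * e')" "\<And>e. e \<in> E \<Longrightarrow> c e ` E \<subseteq> A"
    by metis
  have hE: "h i \<in> E" if "i < N" for i using h that by (auto simp: bij_betw_def)
  define M where "M = mat N N (\<lambda>(i, j). c (h i) (h j))"
  define v where "v = vec N h"
  have M: "M \<in> carrier_mat N N" by (simp add: M_def)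
  have "M *\<^sub>v v = x \<cdot>\<^sub>v v"
  proof (rule eq_vecI)
    fix i assume i: "i < dim_vec (x \<cdot>\<^sub>v v)"
    then have i: "i < N" by (simp add: v_def)
    have "(M *\<^sub>v v) $ i = (\<Sum>j\<in>{0..<N}. c (h i) (h j) * h j)"
      using i by (simp add: M_def v_def scalar_prod_def)
    also have "\<dots> = (\<Sum>e\<in>E. c (h i) e * e)"
      using sum.reindex_bij_betw[OF h, of "\<lambda>e. c (h i) e * e"] by simp
    also have "\<dots> = x * h i" using c(1) hE i by simp
    finally show "(M *\<^sub>v v) $ i = (x \<cdot>\<^sub>v v) $ i" using i by (simp add: v_def)
  qed (auto simp: M_def v_def)
  moreover have "v \<noteq> 0\<^sub>v N"
  proof
    assume v0: "v = 0\<^sub>v N"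
    obtain i where "i < N" "h i = 1" using h E by (auto simp: bij_betw_def image_iff)
    then have "v $ i = 1" by (simp add: v_def)
    then show False using v0 \<open>i < N\<close> by simp
  qed
  ultimately have "eigenvalue M x"
    using M unfolding eigenvalue_def eigenvector_def by (intro exI[of _ v]) (auto simp: v_def)
  then have root: "poly (char_poly M) x = 0" using eigenvalue_root_char_poly[OF M] by simp
  have "char_poly M \<in> poly_over A"
  proof -
    have entry: "char_poly_matrix M $$ (i, k) \<in> poly_over A" if "i < N" "k < N" for i k
    proof -
      have "c (h i) (h k) \<in> A" using c(2) hE that by blast
      then show ?thesis using that
        by (auto simp: char_poly_matrix_def M_def poly_over_def coeff_pCons split: nat.split)
    qed
    have sgn: "signof p \<in> poly_over A" for p :: "nat \<Rightarrow> nat"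
      using poly_over_uminus[OF poly_over_one] by (cases rule: sign_cases[of p]) auto
    have cm: "char_poly_matrix M \<in> carrier_mat N N" using M by simp
    show ?thesis unfolding char_poly_def det_def'[OF cm]
      by (intro poly_over_sum poly_over_mult poly_over_prod sgn entry) (auto simp: permutes_in_image)
  qed
  then show ?thesis using root degree_monic_char_poly[OF M] by (auto simp: integral_def)
qed

lemma integral_imp_stable:
  assumes "integral A x"
  shows "\<exists>E. stable A E x"
proof -
  obtain f where f: "f \<in> poly_over A" "lead_coeff f = 1" "poly f x = 0"
    using assms by (auto simp: integral_def)
  define d where "d = degree f"
  have d: "d \<noteq> 0" using f degree_pos_of_root by (simp add: d_def)
  define E where "E = (\<lambda>i. x ^ i) ` {..<d}"
  have fin: "finite E" by (simp add: E_def)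
  have pw: "x ^ i \<in> lspan A E" if "i < d" for i using that fin by (intro lspan_gen) (auto simp: E_def)
  have "x ^ d = - (\<Sum>i<d. coeff f i * x ^ i)" unfolding d_def by (rule monic_root_power[OF f(2,3)])
  moreover have "\<dots> \<in> lspan A E"
    using f pw by (intro lspan_uminus lspan_sum lspan_mult) (auto simp: poly_over_def)
  ultimately have "x ^ d \<in> lspan A E" by simp
  then have "x ^ Suc i \<in> lspan A E" if "i < d" for i
    using that pw[of "Suc i"] by (cases "Suc i = d") auto
  then have "stable A E x"
    using fin d unfolding stable_def by (auto simp: E_def image_iff intro: bexI[of _ 0])
  then show ?thesis ..
qed

lemma stable_product:
  assumes "stable A E x" "finite E'" "1 \<in> E'"
  shows "stable A ((\<lambda>(e, e'). e * e') ` (E \<times> E')) x"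
    (is "stable A ?P x")
proof -
  have E: "finite E" "1 \<in> E" "\<And>e. e \<in> E \<Longrightarrow> x * e \<in> lspan A E" using assms by (auto simp: stable_def)
  have "x * (e * e') \<in> lspan A ?P" if "e \<in> E" "e' \<in> E'" for e e'
  proof -
    have "e' * (x * e) \<in> lspan A ?P"
      using that E assms by (intro lspan_times[OF E(3)] lspan_gen) (auto simp: image_iff mult.commute)
    then show ?thesis by (simp add: algebra_simps)
  qed
  then show ?thesis using E assms unfolding stable_def by (auto simp: image_iff intro!: bexI[of _ 1])
qed

text \<open>The products of the generators of two modules generate a module stable under whatever
  stabilizes either of them. One module common to several elements is what makes their sums and
  products integral.\<close>

lemma stable_common:
  assumes "finite B" "\<And>b. b \<in> B \<Longrightarrow> integral A b"
  shows "\<exists>E. finite E \<and> 1 \<in> E \<and> (\<forall>b\<in>B. stable A E b)"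
  using assms
proof (induction B rule: finite_induct)
  case empty
  then show ?case by (intro exI[of _ "{1}"]) auto
next
  case (insert b B)
  then obtain E E' where E: "finite E" "1 \<in> E" "\<And>b. b \<in> B \<Longrightarrow> stable A E b" "stable A E' b"
    using integral_imp_stable by (metis insertI1 insertI2)
  then have E': "finite E'" "1 \<in> E'" by (auto simp: stable_def)
  have "(\<lambda>(e, e'). e * e') ` (E \<times> E') = (\<lambda>(e, e'). e * e') ` (E' \<times> E)"
    by (force simp: image_iff mult.commute)
  then have "stable A ((\<lambda>(e, e'). e * e') ` (E \<times> E')) b'" if "b' \<in> insert b B" for b'
    using that stable_product[OF E(3) E'] stable_product[OF E(4,1,2)] by auto
  then show ?case by (metis insertI1 stable_def)
qed

lemma stable_mult: "stable A E x \<Longrightarrow> stable A E y \<Longrightarrow> stable A E (x * y)"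
  unfolding stable_def using lspan_times by (auto simp: mult.assoc)

lemma stable_add: "stable A E x \<Longrightarrow> stable A E y \<Longrightarrow> stable A E (x + y)"
  unfolding stable_def using lspan_add by (auto simp: distrib_right)

lemma integral_base: "x \<in> A \<Longrightarrow> integral A x"
  unfolding integral_def by (intro bexI[of _ "[:-x, 1:]"]) (auto simp: poly_over_def coeff_pCons split: nat.split)

text \<open>After multiplication by \<open>s ^ i\<close> the coefficient of
  \<open>(s * z) ^ l\<close> is \<open>s ^ (i - l) * e l\<close>; since l < i, at least one factor
  \<open>s\<close> is left to clear the denominator of \<open>e l\<close>.\<close>

lemma integral_scale:
  assumes s: "s \<in> A" "\<And>l. l < i \<Longrightarrow> s * e l \<in> A" and i: "i \<noteq> 0" and z: "z ^ i = - (\<Sum>l<i. e l * z ^ l)"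
  shows "integral A (s * z)"
proof -
  define h where "h = (\<Sum>l<i. monom (s * e l * s ^ (i - 1 - l)) l)"
  define g where "g = monom 1 i + h"
  have "degree h < i" using i unfolding h_def
    by (intro degree_sum_less) (auto intro: le_less_trans[OF degree_monom_le])
  then have "lead_coeff g = 1"
    by (simp add: g_def degree_add_eq_left degree_monom_eq coeff_eq_0)
  moreover have "g \<in> poly_over A" unfolding g_def h_def using s
    by (intro poly_over_add poly_over_sum poly_over_monom) auto
  moreover have "poly h (s * z) = (\<Sum>l<i. s ^ i * (e l * z ^ l))"
    unfolding h_def poly_sum
  proof (intro sum.cong refl)
    fix l assume "l \<in> {..<i}"
    then have "s ^ i = s * s ^ (i - 1 - l) * s ^ l" by (simp flip: power_add power_Suc)
    then show "poly (monom (s * e l * s ^ (i - 1 - l)) l) (s * z) = s ^ i * (e l * z ^ l)"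
      by (simp add: poly_monom power_mult_distrib mult_ac)
  qed
  then have "poly g (s * z) = 0"
    using z by (simp add: g_def poly_monom power_mult_distrib sum_distrib_left)
  ultimately show ?thesis by (auto simp: integral_def)
qed

lemma integral_pair: "integral A x \<Longrightarrow> integral A y \<Longrightarrow> \<exists>E. stable A E x \<and> stable A E y"
  using stable_common[of "{x, y}"] by auto

lemma integral_add: "integral A x \<Longrightarrow> integral A y \<Longrightarrow> integral A (x + y)"
  using integral_pair stable_add stable_imp_integral by blast

lemma integral_mult: "integral A x \<Longrightarrow> integral A y \<Longrightarrow> integral A (x * y)"
  using integral_pair stable_mult stable_imp_integral by blast

text \<open>If \<open>E\<close> is stable under all coefficients of \<open>g\<close>, the products
  of elements of \<open>E\<close> with powers of \<open>z\<close> below the degree of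
  \<open>g\<close> span a module stable under \<open>z\<close>: the monic equation rewrites the one
  power that falls outside.\<close>

lemma integral_trans:
  assumes g: "\<And>i. integral A (coeff g i)" "lead_coeff g = 1" "poly g z = 0"
  shows "integral A z"
proof -
  define d where "d = degree g"
  have d: "d \<noteq> 0" using g degree_pos_of_root by (simp add: d_def)
  obtain E where E: "finite E" "1 \<in> E" "\<And>b. b \<in> coeff g ` {..d} \<Longrightarrow> stable A E b"
    using stable_common[of "coeff g ` {..d}"] g by blast
  define F where "F = (\<lambda>(e, i). e * z ^ i) ` (E \<times> {..<d})"
  have fin: "finite F" using E by (simp add: F_def)
  have gen: "e * z ^ i \<in> lspan A F" if "e \<in> E" "i < d" for e i
    using that fin by (intro lspan_gen) (auto simp: F_def)
  have "z * (e * z ^ i) \<in> lspan A F" if ei: "e \<in> E" "i < d" for e i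
  proof (cases "Suc i = d")
    case True
    have "z ^ d = - (\<Sum>i<d. coeff g i * z ^ i)" unfolding d_def by (rule monic_root_power[OF g(2,3)])
    have "z * (e * z ^ i) = e * z ^ d" unfolding True[symmetric] by simp
    also have "\<dots> = - (\<Sum>i<d. z ^ i * (coeff g i * e))"
      unfolding \<open>z ^ d = _\<close> by (simp add: sum_distrib_left mult_ac)
    finally have "z * (e * z ^ i) = - (\<Sum>i<d. z ^ i * (coeff g i * e))" .
    moreover have "\<dots> \<in> lspan A F"
    proof (intro lspan_uminus lspan_sum)
      fix k assume "k \<in> {..<d}"
      then have "coeff g k * e \<in> lspan A E" "\<And>e. e \<in> E \<Longrightarrow> z ^ k * e \<in> lspan A F"
        using E(3)[of "coeff g k"] ei gen[of _ k] by (auto simp: stable_def mult.commute)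
      then show "z ^ k * (coeff g k * e) \<in> lspan A F" by (rule lspan_times)
    qed
    ultimately show ?thesis by simp
  next
    case False
    then show ?thesis using gen[of e "Suc i"] ei by (simp add: algebra_simps)
  qed
  moreover have "1 \<in> F" unfolding F_def using E d by (intro image_eqI[of _ _ "(1, 0)"]) auto
  ultimately have "stable A F z" using fin by (auto simp: stable_def F_def)
  then show ?thesis by (rule stable_imp_integral)
qed

end

text \<open>Elimination without fractions: cross-multiplication with the pivot \<open>x l m\<close>
  kills the last coordinate of all other rows. The coefficient \<open>d l\<close> of the pivot row
  is chosen so that the \<open>d\<close>-combination of the old rows equals the
  \<open>c\<close>-combination of the new ones in every coordinate.\<close>

lemma (in subrng) linear_relation:
  fixes x :: "'i \<Rightarrow> nat \<Rightarrow> 'a"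
  assumes "finite I" "card I > m" "\<And>i k. i \<in> I \<Longrightarrow> k < m \<Longrightarrow> x i k \<in> A"
  shows "\<exists>c. (\<forall>i\<in>I. c i \<in> A) \<and> (\<exists>i\<in>I. c i \<noteq> 0) \<and> (\<forall>k<m. (\<Sum>i\<in>I. c i * x i k) = 0)"
  using assms
proof (induction m arbitrary: I x)
  case 0
  then obtain i where "i \<in> I" by fastforce
  then show ?case by (intro exI[of _ "\<lambda>_. 1"]) auto
next
  case (Suc m)
  show ?case
  proof (cases "\<exists>i\<in>I. x i m \<noteq> 0")
    case False
    moreover obtain c where c: "\<forall>i\<in>I. c i \<in> A" "\<exists>i\<in>I. c i \<noteq> 0" "\<forall>k<m. (\<Sum>i\<in>I. c i * x i k) = 0"
      using Suc.IH[of I x] Suc.prems by auto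
    ultimately show ?thesis by (intro exI[of _ c]) (auto simp: less_Suc_eq)
  next
    case True
    then obtain l where l: "l \<in> I" "x l m \<noteq> 0" by auto
    define x' where "x' i k = x l m * x i k - x i m * x l k" for i k
    have "\<exists>c. (\<forall>i\<in>I-{l}. c i \<in> A) \<and> (\<exists>i\<in>I-{l}. c i \<noteq> 0) \<and> (\<forall>k<m. (\<Sum>i\<in>I-{l}. c i * x' i k) = 0)"
      using Suc.prems l by (intro Suc.IH) (auto simp: x'_def intro!: diff mult)
    then obtain c where c: "\<forall>i\<in>I-{l}. c i \<in> A" "\<exists>i\<in>I-{l}. c i \<noteq> 0"
      "\<And>k. k < m \<Longrightarrow> (\<Sum>i\<in>I-{l}. c i * x' i k) = 0" by auto
    define d where "d i = (if i = l then - (\<Sum>i\<in>I-{l}. c i * x i m) else c i * x l m)" for i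
    have "(\<Sum>i\<in>I. d i * x i k) = 0" if "k < Suc m" for k
    proof -
      have "(\<Sum>i\<in>I. d i * x i k) = d l * x l k + (\<Sum>i\<in>I-{l}. d i * x i k)"
        using l Suc.prems by (subst sum.remove[of _ l]) auto
      also have "d l * x l k = - (\<Sum>i\<in>I-{l}. c i * (x i m * x l k))"
        by (simp add: d_def sum_distrib_right mult.assoc)
      also have "(\<Sum>i\<in>I-{l}. d i * x i k) = (\<Sum>i\<in>I-{l}. c i * (x l m * x i k))"
        by (intro sum.cong) (auto simp: d_def)
      also have "- (\<Sum>i\<in>I-{l}. c i * (x i m * x l k)) + \<dots> = (\<Sum>i\<in>I-{l}. c i * x' i k)"
        by (simp add: x'_def right_diff_distrib sum_subtractf)
      also have "\<dots> = 0"
      proof (cases "k = m")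
        case True
        then show ?thesis by (simp add: x'_def mult.commute)
      qed (use c(3) that in auto)
      finally show ?thesis .
    qed
    moreover have "\<forall>i\<in>I. d i \<in> A" using c Suc.prems l by (auto simp: d_def intro!: uminus sum mult)
    moreover have "\<exists>i\<in>I. d i \<noteq> 0" using c l by (auto simp: d_def)
    ultimately show ?thesis by (intro exI[of _ d]) auto
  qed
qed

text \<open>\<open>relation\<close> says that \<open>K\<close> has dimension at most
  \<open>N\<close> over the fraction field of \<open>R\<close>, with denominators cleared: the
  indices up to \<open>N\<close> number N + 1 elements.\<close>

locale finite_extension = ufd R for R :: "'a::field set" +
  fixes K :: "'a set" and N :: nat
  assumes R_sub: "R \<subseteq> K" and subrng_K: "subrng K"
    and inverse_in: "x \<in> K \<Longrightarrow> inverse x \<in> K"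
    and relation: "(\<And>i. i \<le> N \<Longrightarrow> z i \<in> K) \<Longrightarrow>
      \<exists>c. (\<forall>i\<le>N. c i \<in> R) \<and> (\<exists>i\<le>N. c i \<noteq> 0) \<and> (\<Sum>i\<le>N. c i * z i) = 0"
begin

interpretation K: subrng K by (rule subrng_K)

definition OK :: "'a set" where "OK = integral_closure R K"

lemma OK_iff: "x \<in> OK \<longleftrightarrow> x \<in> K \<and> integral R x"
  by (simp add: OK_def integral_closure_def integral_def)

lemma R_sub_OK: "R \<subseteq> OK"
  using R_sub integral_base by (auto simp: OK_iff)

lemma OK_sub: "OK \<subseteq> K"
  by (auto simp: OK_iff)

lemma subrng_OK: "subrng OK"
proof
  show "- x \<in> OK" if "x \<in> OK" for x
    using that integral_mult[OF integral_base[of "-1"]] by (auto simp: OK_iff)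
qed (use R_sub_OK integral_add integral_mult in \<open>auto simp: OK_iff\<close>)

lemma integrally_closed:
  "z \<in> K \<Longrightarrow> g \<in> poly_over OK \<Longrightarrow> lead_coeff g = 1 \<Longrightarrow> poly g z = 0 \<Longrightarrow> z \<in> OK"
  using integral_trans[of g z] by (auto simp: OK_iff poly_over_def)

lemma integral_over_OK: "z \<in> K \<Longrightarrow> integral OK z \<Longrightarrow> z \<in> OK"
  using integrally_closed by (auto simp: integral_def)

lemma divide_in: "x \<in> K \<Longrightarrow> y \<in> K \<Longrightarrow> x / y \<in> K"
  using inverse_in by (auto simp: divide_inverse)

text \<open>A relation between the powers of \<open>x\<close> up to \<open>N\<close> is a polynomial
  equation for \<open>x\<close>; multiplying \<open>x\<close> by the leading coefficient makes it
  integral.\<close>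

lemma denominator_exists:
  assumes "x \<in> K"
  shows "\<exists>s\<in>R. s \<noteq> 0 \<and> s * x \<in> OK"
proof -
  obtain c where c: "\<forall>i\<le>N. c i \<in> R" "\<exists>i\<le>N. c i \<noteq> 0" "(\<Sum>i\<le>N. c i * x ^ i) = 0"
    using relation[of "\<lambda>i. x ^ i"] assms by auto
  define f where "f = (\<Sum>i\<le>N. monom (c i) i)"
  have "f \<in> poly_over R" using c unfolding f_def by (intro poly_over_sum poly_over_monom) auto
  have cf: "coeff f i = (if i \<le> N then c i else 0)" for i
    by (simp add: f_def coeff_sum)
  have "f \<noteq> 0" using c(2) cf by (metis coeff_0)
  have "poly f x = 0" using c by (simp add: f_def poly_sum poly_monom)
  define a where "a = lead_coeff f"
  have a: "a \<in> R" "a \<noteq> 0" using \<open>f \<in> _\<close> \<open>f \<noteq> 0\<close> by (auto simp: a_def poly_over_def)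
  define g where "g = smult (inverse a) f"
  have g: "lead_coeff g = 1" "poly g x = 0" "degree g = degree f"
    using a \<open>poly f x = 0\<close> by (simp_all add: g_def a_def)
  have "integral R (a * x)"
  proof (rule integral_scale[OF a(1)])
    show "degree g \<noteq> 0" "x ^ degree g = - (\<Sum>l<degree g. coeff g l * x ^ l)"
      using degree_pos_of_root monic_root_power g by blast+
    show "a * coeff g l \<in> R" for l using a \<open>f \<in> _\<close> by (simp add: g_def poly_over_def flip: mult.assoc)
  qed
  then have "a * x \<in> OK" using assms a R_sub by (auto simp: OK_iff)
  then show ?thesis using a by blast
qed

text \<open>This uses that \<open>R\<close> is factorial. A primitive annihilating polynomial of
  least degree divides a monic one over \<open>R\<close> itself, by Gauss's lemma, so its leading
  coefficient is a unit and can be normalised to 1.\<close>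

lemma minimal_polynomial_exists:
  assumes "z \<in> OK"
  shows "\<exists>g\<in>poly_over R. lead_coeff g = 1 \<and> poly g z = 0 \<and>
    (\<forall>h\<in>poly_over R. h \<noteq> 0 \<longrightarrow> poly h z = 0 \<longrightarrow> degree g \<le> degree h)"
proof -
  obtain F where F: "F \<in> poly_over R" "lead_coeff F = 1" "poly F z = 0"
    using assms by (auto simp: OK_iff integral_def)
  define S where "S f \<longleftrightarrow> f \<in> poly_over R \<and> f \<noteq> 0 \<and> poly f z = 0" for f
  have "S F" using F by (auto simp: S_def)
  then obtain f0 where f0: "S f0" "\<And>g. S g \<Longrightarrow> degree f0 \<le> degree g"
    by (metis ex_has_least_nat)
  then obtain c f where f: "c \<in> R" "f \<in> poly_over R" "c \<noteq> 0" "f0 = smult c f" "primitive R f"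
    using primitive_part_exists[of f0] unfolding S_def by blast
  then have Sf: "S f" "\<And>g. S g \<Longrightarrow> degree f \<le> degree g" using f0 by (auto simp: S_def)
  obtain c q r where cqr: "c \<in> R" "q \<in> poly_over R" "r \<in> poly_over R" "c \<noteq> 0"
    "smult c F = f * q + r" "r = 0 \<or> degree r < degree f"
    using pseudo_division[of f F] F Sf by (auto simp: S_def)
  have "poly r z = 0" using arg_cong[OF cqr(5), of "\<lambda>p. poly p z"] F Sf by (auto simp: S_def)
  then have "r = 0" using Sf(2)[of r] cqr(3,6) unfolding S_def by fastforce
  then obtain q' where q': "q' \<in> poly_over R" "F = f * q'"
    using primitive_divides[OF f(5,2) F(1) cqr(1,4,2)] cqr by auto
  then have l: "lead_coeff f * lead_coeff q' = 1" using F by (metis lead_coeff_mult)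
  have "f \<noteq> 0" using Sf by (simp add: S_def)
  have "lead_coeff q' \<in> R" "lead_coeff q' \<noteq> 0" using q' l by (auto simp: poly_over_def)
  then show ?thesis
    using Sf l f by (intro bexI[of _ "smult (lead_coeff q') f"])
      (auto simp: S_def mult.commute intro!: poly_over_smult)
qed

text \<open>Up to sign the constant term of the minimal polynomial is \<open>z\<close> times an
  element of \<open>OK\<close>, and by minimality it is not 0. It plays the role of a norm and
  transfers questions about \<open>z\<close> to the factorial ring \<open>R\<close>.\<close>

lemma divides_base:
  assumes "z \<in> OK" "z \<noteq> 0"
  shows "\<exists>w\<in>OK. z * w \<in> R \<and> z * w \<noteq> 0"
proof -
  interpret OK: subrng OK by (rule subrng_OK)
  obtain g where g: "g \<in> poly_over R" "lead_coeff g = 1" "poly g z = 0"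
    "\<And>h. h \<in> poly_over R \<Longrightarrow> h \<noteq> 0 \<Longrightarrow> poly h z = 0 \<Longrightarrow> degree g \<le> degree h"
    using minimal_polynomial_exists[OF assms(1)] by blast
  obtain c h where ch: "g = pCons c h" by (metis pCons_cases)
  have h: "h \<in> poly_over R" "c \<in> R"
  proof -
    show "c \<in> R" using poly_overD[OF g(1), of 0] ch by simp
    show "h \<in> poly_over R" using poly_overD[OF g(1), of "Suc _"] ch by (auto simp: poly_over_def)
  qed
  have eq: "z * poly h z = - c" using g(3) ch by (simp add: eq_neg_iff_add_eq_0 add.commute)
  have "c \<noteq> 0"
  proof
    assume "c = 0"
    then have "poly h z = 0" using eq assms by simp
    moreover have "h \<noteq> 0" using g(2) ch \<open>c = 0\<close> by auto
    ultimately show False using g(4)[OF h(1)] ch by simp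
  qed
  moreover have "poly h z \<in> OK" using h R_sub_OK assms poly_over_mono by (intro OK.poly_in) auto
  ultimately show ?thesis using eq h by (intro bexI[of _ "poly h z"]) auto
qed

end

section \<open>Localization and going down\<close>

definition max_ideal :: "'a::field set \<Rightarrow> 'a set \<Rightarrow> 'a set" where
  "max_ideal A P = {a / s | a s. a \<in> P \<and> s \<in> A - P}"

context prime_of
begin

abbreviation loc :: "'a set" where
  "loc \<equiv> localization A P"

lemma localizationI: "a \<in> A \<Longrightarrow> s \<in> A \<Longrightarrow> s \<notin> P \<Longrightarrow> a / s \<in> loc"
  by (auto simp: localization_def)

lemma max_idealI: "a \<in> P \<Longrightarrow> s \<in> A \<Longrightarrow> s \<notin> P \<Longrightarrow> a / s \<in> max_ideal A P"
  by (auto simp: max_ideal_def)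

lemma subset_localization: "A \<subseteq> loc"
  using localizationI[of _ 1] one_notin by force

lemma subset_max_ideal: "P \<subseteq> max_ideal A P"
  using max_idealI[of _ 1] one_notin by force

lemma inverse_in_localization: "s \<in> A \<Longrightarrow> s \<notin> P \<Longrightarrow> inverse s \<in> loc"
  using localizationI[of 1 s] by (simp add: inverse_eq_divide)

lemma subrng_localization: "subrng loc"
proof
  show "0 \<in> loc" "1 \<in> loc" using subset_localization by auto
  fix x y assume "x \<in> loc" "y \<in> loc"
  then obtain a s b r where e: "x = a / s" "y = b / r" "a \<in> A" "b \<in> A" "s \<in> A - P" "r \<in> A - P"
    by (auto simp: localization_def)
  then have "s \<noteq> 0" "r \<noteq> 0" by auto
  then have "x + y = (a * r + b * s) / (s * r)" "x * y = (a * b) / (s * r)" "- x = (- a) / s"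
    using e by (auto simp: field_simps)
  then show "x + y \<in> loc" "x * y \<in> loc" "- x \<in> loc"
    using diff_mult[OF e(5,6)] e localizationI[of "a * r + b * s" "s * r"]
      localizationI[of "a * b" "s * r"] localizationI[of "- a" s] by auto
qed

lemma ideal_max_ideal: "ideal_of loc (max_ideal A P)"
proof -
  interpret B: subrng loc by (rule subrng_localization)
  show ?thesis
  proof unfold_locales
    show "max_ideal A P \<subseteq> loc" using sub by (auto simp: max_ideal_def localization_def)
    show "0 \<in> max_ideal A P" using subset_max_ideal by auto
    show "x + y \<in> max_ideal A P" if xy: "x \<in> max_ideal A P" "y \<in> max_ideal A P" for x y
    proof -
      obtain a s b r where e: "x = a / s" "y = b / r" "a \<in> P" "b \<in> P" "s \<in> A - P" "r \<in> A - P"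
        using xy by (auto simp: max_ideal_def)
      then have "s \<noteq> 0" "r \<noteq> 0" by auto
      then have "x + y = (r * a + s * b) / (s * r)" using e by (auto simp: field_simps)
      moreover have "r * a + s * b \<in> P" using e by (intro add_in mult_in) auto
      ultimately show ?thesis using max_idealI[of "r * a + s * b" "s * r"] diff_mult[OF e(5,6)] by simp
    qed
    show "y * x \<in> max_ideal A P" if yx: "y \<in> loc" "x \<in> max_ideal A P" for x y
    proof -
      obtain a s b r where e: "x = a / s" "y = b / r" "a \<in> P" "b \<in> A" "s \<in> A - P" "r \<in> A - P"
        using yx by (auto simp: max_ideal_def localization_def)
      then have "y * x = (b * a) / (s * r)" using e by (simp add: mult.commute)
      moreover have "b * a \<in> P" using e by (intro mult_in) auto
      ultimately show ?thesis using max_idealI[of "b * a" "s * r"] diff_mult[OF e(5,6)] by simp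
    qed
  qed
qed

lemma localization_unit:
  assumes "x \<in> loc" "x \<notin> max_ideal A P"
  shows "inverse x \<in> loc"
proof -
  obtain a s where e: "x = a / s" "a \<in> A" "s \<in> A" "s \<notin> P" using assms by (auto simp: localization_def)
  then have "a \<notin> P" using assms max_idealI by blast
  then show ?thesis using localizationI[of s a] e by simp
qed

lemma max_ideal_Int: "x \<in> A \<Longrightarrow> x \<in> max_ideal A P \<Longrightarrow> x \<in> P"
proof -
  assume "x \<in> A" "x \<in> max_ideal A P"
  then obtain a s where e: "x = a / s" "a \<in> P" "s \<in> A - P" by (auto simp: max_ideal_def)
  then have "s * x = a" by auto
  then show "x \<in> P" using prime[of s x] e \<open>x \<in> A\<close> by auto
qed

lemma max_ideal_nonunit: "x \<in> max_ideal A P \<Longrightarrow> inverse x \<in> loc \<Longrightarrow> x = 0"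
proof (rule ccontr)
  interpret M: ideal_of loc "max_ideal A P" by (rule ideal_max_ideal)
  assume "x \<in> max_ideal A P" "inverse x \<in> loc" "x \<noteq> 0"
  then have "1 \<in> max_ideal A P" using M.mult_in[of "inverse x" x] by simp
  then show False using max_ideal_Int[of 1] one_notin by auto
qed

end

text \<open>\<open>L\<close> names the field on which the valuation is considered: \<open>K\<close>
  for \<O>, the whole type for \<A>. The last clause also excludes nonzero elements divisible by
  every power of \<open>g\<close>.\<close>

definition dvr :: "'a::field set \<Rightarrow> 'a set \<Rightarrow> 'a set \<Rightarrow> 'a \<Rightarrow> bool" where
  "dvr A P L g \<longleftrightarrow> g \<noteq> 0 \<and> max_ideal A P = (\<lambda>b. g * b) ` localization A P \<and>
     (\<forall>x\<in>L. x \<noteq> 0 \<longrightarrow> (\<exists>k e. e \<in> localization A P \<and> inverse e \<in> localization A P \<and> x = e * g powi k))"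

text \<open>A nonzero \<open>q \<in> Q\<close> is a unit of the local ring times some
  \<open>g powi k\<close>, and every \<open>y \<in> P\<close> is a multiple of \<open>g\<close>
  there. So a power of \<open>y\<close> is a multiple of \<open>q\<close> up to a denominator
  outside \<open>P\<close>, which puts \<open>y\<close> into \<open>Q\<close>.\<close>

lemma (in prime_of) dvr_minimal:
  assumes "dvr A P L g" "A \<subseteq> L" "prime_of A Q" "Q \<subseteq> P" "Q \<noteq> {0}"
  shows "Q = P"
proof -
  interpret Q: prime_of A Q by fact
  interpret B: subrng "localization A P" by (rule subrng_localization)
  interpret M: ideal_of "localization A P" "max_ideal A P" by (rule ideal_max_ideal)
  have g: "g \<noteq> 0" "g \<in> localization A P"
    using assms(1) M.sub B.one unfolding dvr_def by (auto simp: image_subset_iff dest: bspec[of _ _ 1])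
  obtain q where q: "q \<in> Q" "q \<noteq> 0" using assms by auto
  then obtain k e where ke: "e \<in> localization A P" "inverse e \<in> localization A P" "q = e * g powi k"
    using assms Q.sub unfolding dvr_def by blast
  have "y \<in> Q" if yP: "y \<in> P" for y
  proof -
    obtain b where b: "b \<in> localization A P" "y = g * b"
      using yP assms(1) subset_max_ideal by (auto simp: dvr_def)
    define n where "n = nat k"
    have "g ^ n / g powi k = g ^ nat (int n - k)"
      using g by (simp add: n_def flip: power_int_diff power_int_of_nat)
    moreover have "y ^ n / q = b ^ n * inverse e * (g ^ n / g powi k)"
      using ke b by (simp add: power_mult_distrib divide_inverse mult_ac)
    ultimately have "y ^ n / q = b ^ n * inverse e * g ^ nat (int n - k)" by simp
    also have "\<dots> \<in> localization A P" using ke b g by (intro B.mult B.power)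
    finally obtain a s where as: "y ^ n / q = a / s" "a \<in> A" "s \<in> A - P" by (auto simp: localization_def)
    then have "s \<noteq> 0" by auto
    then have "s * y ^ n = a * q" using as q by (simp add: field_simps)
    then have "s * y ^ n \<in> Q" using Q.mult_in as q by simp
    moreover have "s \<notin> Q" using as assms by auto
    ultimately show "y \<in> Q" using Q.prime[of s "y ^ n"] Q.prime_power[of y n] as yP sub by auto
  qed
  then show ?thesis using assms by auto
qed

section \<open>Ideals and height-one primes in the language of the statement\<close>

lemma ring_on_simps [simp]:
  "carrier (ring_on A) = A" "monoid.mult (ring_on A) = (*)" "monoid.one (ring_on A) = 1"
  "ring.zero (ring_on A) = 0" "ring.add (ring_on A) = (+)"
  by (simp_all add: ring_of_type_algebra_def)

lemma (in subrng) cring_ring_on: "cring (ring_on A)"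
proof (intro cringI abelian_groupI comm_monoidI)
  fix x assume "x \<in> carrier (ring_on A)"
  then show "\<exists>y\<in>carrier (ring_on A). y \<oplus>\<^bsub>ring_on A\<^esub> x = \<zero>\<^bsub>ring_on A\<^esub>"
    by (intro bexI[of _ "- x"]) auto
qed (auto simp: algebra_simps)

lemma (in subrng) a_inv_ring_on: "x \<in> A \<Longrightarrow> \<ominus>\<^bsub>ring_on A\<^esub> x = - x"
proof -
  assume x: "x \<in> A"
  interpret cring "ring_on A" by (rule cring_ring_on)
  show ?thesis using minus_equality[of "- x" x] x by auto
qed

lemma (in subrng) ideal_ring_on_iff: "ideal P (ring_on A) \<longleftrightarrow> ideal_of A P"
proof
  interpret R: cring "ring_on A" by (rule cring_ring_on)
  assume "ideal P (ring_on A)"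
  then interpret P: ideal P "ring_on A" .
  show "ideal_of A P"
    by unfold_locales (use P.a_subset P.zero_closed P.a_closed P.I_l_closed in auto)
next
  interpret R: cring "ring_on A" by (rule cring_ring_on)
  assume "ideal_of A P"
  then interpret P: ideal_of A P .
  have inv: "m_inv (add_monoid (ring_on A)) x = - x" if "x \<in> A" for x
    using a_inv_ring_on[OF that] by (simp add: a_inv_def)
  show "ideal P (ring_on A)"
  proof (rule idealI)
    show "ring (ring_on A)" by (rule R.ring_axioms)
    show "subgroup P (add_monoid (ring_on A))"
      by unfold_locales (use P.sub P.uminus_in inv in \<open>auto simp: subset_iff\<close>)
  qed (use P.mult_in P.mult_in' in auto)
qed

lemma (in subrng) primeideal_ring_on_iff: "primeideal P (ring_on A) \<longleftrightarrow> prime_of A P"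
proof
  interpret R: cring "ring_on A" by (rule cring_ring_on)
  assume "primeideal P (ring_on A)"
  then interpret P: primeideal P "ring_on A" .
  interpret I: ideal_of A P using ideal_ring_on_iff P.ideal_axioms by simp
  show "prime_of A P"
  proof unfold_locales
    show "1 \<notin> P"
    proof
      assume "1 \<in> P"
      then have "A = P" using I.mult_in[of _ 1] I.sub by auto
      then show False using P.I_notcarr by simp
    qed
  qed (use P.I_prime in auto)
next
  interpret R: cring "ring_on A" by (rule cring_ring_on)
  assume "prime_of A P"
  then interpret P: prime_of A P .
  show "primeideal P (ring_on A)"
    using ideal_ring_on_iff P.ideal_of_axioms P.one_notin P.prime R.cring_axioms
    by (intro primeidealI) auto
qed

lemma (in subrng) height_one_prime_iff:
  "height_one_prime A P \<longleftrightarrow> prime_of A P \<and> P \<noteq> {0} \<and>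
     (\<forall>Q. prime_of A Q \<longrightarrow> Q \<subseteq> P \<longrightarrow> Q = {0} \<or> Q = P)"
  by (auto simp: height_one_prime_def primeideal_ring_on_iff)

text \<open>The source of height one for both the extended and the moving primes, which are
  constructed together with a uniformizer.\<close>

lemma (in prime_of) dvr_height_one:
  assumes "dvr A P L g" "A \<subseteq> L"
  shows "height_one_prime A P"
proof -
  interpret B: subrng "localization A P" by (rule subrng_localization)
  have "g \<in> max_ideal A P" "g \<noteq> 0" using assms B.one unfolding dvr_def by force+
  then have "P \<noteq> {0}" by (auto simp: max_ideal_def)
  then show ?thesis
    using dvr_minimal[OF assms] prime_of_axioms by (auto simp: height_one_prime_iff)
qed

context finite_extension
begin

interpretation K: subrng K by (rule subrng_K)
interpretation OK: subrng OK by (rule subrng_OK)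

text \<open>Divide a relation by the highest power of \<open>\<pi>\<close> common to its
  coefficients, that is, by the least multiplicity \<open>k\<close> among the nonzero ones. The
  result stays nontrivial modulo \<open>\<pi>\<close>.\<close>

lemma reduced_relation:
  assumes \<pi>: "prime_element R \<pi>" and x: "\<And>i. i \<le> N \<Longrightarrow> x i \<in> K"
  shows "\<exists>c. (\<forall>i\<le>N. c i \<in> R) \<and> (\<exists>i\<le>N. c i \<notin> multiples R \<pi>) \<and> (\<Sum>i\<le>N. c i * x i) = 0"
proof -
  have [simp]: "\<pi> \<noteq> 0" and "\<pi> \<in> R" using \<pi> by (auto simp: prime_element_def)
  obtain c where c: "\<forall>i\<le>N. c i \<in> R" "\<exists>i\<le>N. c i \<noteq> 0" "(\<Sum>i\<le>N. c i * x i) = 0"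
    using relation[of x] x by auto
  define S where "S i k \<longleftrightarrow> i \<le> N \<and> c i \<noteq> 0 \<and> c i / \<pi> ^ k \<in> R \<and> c i / \<pi> ^ Suc k \<notin> R" for i k
  have ex: "\<exists>k. S i k" if "i \<le> N" "c i \<noteq> 0" for i
    using multiplicity_bound[OF \<pi>, of "c i"] c that by (auto simp: S_def)
  then have "\<exists>k i. S i k" using c by blast
  then obtain k where k: "\<exists>i. S i k" "\<And>l. \<exists>i. S i l \<Longrightarrow> k \<le> l"
    using exists_least_iff[of "\<lambda>k. \<exists>i. S i k"] by (meson not_le_imp_less)
  define d where "d i = c i / \<pi> ^ k" for i
  have "d i \<in> R" if i: "i \<le> N" for i
  proof (cases "c i = 0")
    case False
    then obtain l where l: "S i l" using ex i by auto
    then have "k \<le> l" using k by auto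
    then have "\<pi> ^ l = \<pi> ^ k * \<pi> ^ (l - k)" by (simp flip: power_add)
    then have "d i = c i / \<pi> ^ l * \<pi> ^ (l - k)" by (simp add: d_def)
    moreover have "c i / \<pi> ^ l \<in> R" using l by (simp add: S_def)
    ultimately show ?thesis using \<open>\<pi> \<in> R\<close> by (metis mult power)
  qed (simp add: d_def)
  moreover obtain i where "S i k" using k by auto
  then have "i \<le> N" "d i \<notin> multiples R \<pi>"
    by (auto simp: S_def multiples_def d_def mult.commute)
  moreover have "(\<Sum>i\<le>N. d i * x i) = (\<Sum>i\<le>N. c i * x i) / \<pi> ^ k"
    by (simp add: d_def sum_divide_distrib)
  then have "(\<Sum>i\<le>N. d i * x i) = 0" using c by simp
  ultimately show ?thesis by blast
qed

text \<open>The set \<open>M\<close> combines the two requirements on \<open>Q\<close>: a prime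
  ideal missing all products \<open>x * s\<close> lies inside \<open>P\<close> (take x = 1) and
  contains no element of \<open>R\<close> outside \<open>multiples R \<pi>\<close> (take s = 1). It
  remains to see that the multiples of \<open>\<pi>\<close> miss \<open>M\<close>.\<close>

theorem going_down:
  assumes P: "prime_of OK P" and \<pi>: "prime_element R \<pi>" "\<pi> \<in> P"
  shows "\<exists>Q. prime_of OK Q \<and> Q \<subseteq> P \<and> Q \<inter> R = multiples R \<pi>"
proof -
  interpret P: prime_of OK P by fact
  interpret pR: prime_of R "multiples R \<pi>" using \<pi> prime_element_ideal subrng_axioms by blast
  have \<pi>': "\<pi> \<noteq> 0" "\<pi> \<in> R" using \<pi> by (auto simp: prime_element_def)
  define M where "M = {x * s | x s. x \<in> R \<and> x \<notin> multiples R \<pi> \<and> s \<in> OK \<and> s \<notin> P}"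
  define I where "I = multiples OK \<pi>"
  have I: "ideal_of OK I" unfolding I_def using \<pi>' R_sub_OK by (intro OK.ideal_multiples) auto
  \<comment> \<open>If \<open>x * s = \<pi> * z\<close>, the minimal polynomials of \<open>s\<close>
    and \<open>z\<close> differ only by scaling the variable. The factor \<open>\<pi>\<close> then
    forces all lower coefficients for \<open>s\<close> to be divisible by \<open>\<pi>\<close>, and
    a power of \<open>s\<close> falls into \<open>P\<close>.\<close>
  have disj: "x * s \<noteq> \<pi> * z" if x: "x \<in> R" "x \<notin> multiples R \<pi>" and s: "s \<in> OK" "s \<notin> P" and z: "z \<in> OK" for x s z
  proof
    assume eq: "x * s = \<pi> * z"
    have "x \<noteq> 0" using x by auto
    obtain f where f: "f \<in> poly_over R" "lead_coeff f = 1" "poly f z = 0"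
      "\<And>h. h \<in> poly_over R \<Longrightarrow> h \<noteq> 0 \<Longrightarrow> poly h z = 0 \<Longrightarrow> degree f \<le> degree h"
      using minimal_polynomial_exists[OF z] by blast
    obtain g where g: "g \<in> poly_over R" "lead_coeff g = 1" "poly g s = 0"
      "\<And>h. h \<in> poly_over R \<Longrightarrow> h \<noteq> 0 \<Longrightarrow> poly h s = 0 \<Longrightarrow> degree g \<le> degree h"
      using minimal_polynomial_exists[OF s(1)] by blast
    text \<open>The substitution \<open>Z \<mapsto> bZ/a\<close>, cleared of denominators, interchanges the two minimal polynomials.\<close>
    define sc where "sc a b f = (\<Sum>i\<le>degree f. monom (coeff f i * a ^ (degree f - i) * b ^ i) i)"
      for a b and f :: "'a poly"
    have sc_coeff: "coeff (sc a b f) i = coeff f i * a ^ (degree f - i) * b ^ i" for a b i and f :: "'a poly"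
      by (simp add: sc_def coeff_sum coeff_eq_0)
    have sc_over: "sc a b f \<in> poly_over R" if "a \<in> R" "b \<in> R" "f \<in> poly_over R" for a b f
      using that by (auto simp: poly_over_def sc_coeff)
    have sc_deg: "degree (sc a b f) = degree f" if "b \<noteq> 0" for a b and f :: "'a poly"
    proof (rule antisym)
      show "degree (sc a b f) \<le> degree f" by (intro degree_le) (auto simp: sc_coeff coeff_eq_0)
      show "degree f \<le> degree (sc a b f)"
        by (cases "f = 0") (auto simp: sc_coeff that intro!: le_degree)
    qed
    have sc_poly: "poly (sc a b f) v = a ^ degree f * poly f w" if "b * v = a * w"
      for a b v w and f :: "'a poly"
    proof -
      have "poly (sc a b f) v = (\<Sum>i\<le>degree f. coeff f i * a ^ (degree f - i) * (b * v) ^ i)"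
        by (simp add: sc_def poly_sum poly_monom power_mult_distrib mult.assoc)
      also have "\<dots> = (\<Sum>i\<le>degree f. a ^ degree f * (coeff f i * w ^ i))"
      proof (intro sum.cong refl)
        fix i assume "i \<in> {..degree f}"
        then have "a ^ degree f = a ^ (degree f - i) * a ^ i" by (simp flip: power_add)
        then show "coeff f i * a ^ (degree f - i) * (b * v) ^ i = a ^ degree f * (coeff f i * w ^ i)"
          unfolding that by (simp add: power_mult_distrib)
      qed
      finally show ?thesis by (simp add: poly_altdef sum_distrib_left)
    qed
    have "f \<noteq> 0" "g \<noteq> 0" using f g by auto
    have "sc \<pi> x f \<noteq> 0" "sc x \<pi> g \<noteq> 0"
      using sc_coeff[of _ _ f "degree f"] sc_coeff[of _ _ g "degree g"] f(2) g(2) \<pi>' \<open>x \<noteq> 0\<close>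
      by (metis coeff_0 diff_self_eq_0 mult_1 power_0 power_not_zero)+
    then have "degree g \<le> degree f" "degree f \<le> degree g"
      using f(4)[of "sc x \<pi> g"] g(4)[of "sc \<pi> x f"] sc_over[OF \<pi>'(2) x(1) f(1)] sc_over[OF x(1) \<pi>'(2) g(1)]
        sc_deg[of x \<pi> f] sc_deg[of \<pi> x g] sc_poly[OF eq, of f] sc_poly[OF eq[symmetric], of g]
        f(3) g(3) \<pi>' \<open>x \<noteq> 0\<close> by auto
    then have deg: "degree g = degree f" by simp
    \<comment> \<open>Both terms have leading coefficient \<open>x ^ degree f\<close> and vanish at
      \<open>s\<close>, so minimality of \<open>g\<close> gives h = 0. Comparing coefficients shows
      that \<open>\<pi>\<close> divides \<open>x ^ degree f * coeff g i\<close> for each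
      \<open>i\<close> below the degree.\<close>
    define h where "h = sc \<pi> x f - smult (x ^ degree f) g"
    have "h \<in> poly_over R" using f g \<pi>' x unfolding h_def
      by (intro poly_over_diff sc_over poly_over_smult) auto
    moreover have "poly h s = 0" using sc_poly[of x s \<pi> z f] eq f g by (simp add: h_def)
    moreover have "h = 0 \<or> degree h < degree f"
    proof -
      have "degree h \<le> degree f" unfolding h_def
        using sc_deg[OF \<open>x \<noteq> 0\<close>, of \<pi> f] deg degree_smult_le[of "x ^ degree f" g] by (intro degree_diff_le) auto
      moreover have "coeff h (degree f) = 0" using f(2) g(2) deg by (simp add: h_def sc_coeff)
      ultimately show ?thesis by (metis le_neq_implies_less leading_coeff_0_iff)
    qed
    ultimately have "h = 0" using g(4)[of h] deg by fastforce
    have g_in: "coeff g i \<in> multiples R \<pi>" if i: "i < degree f" for i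
    proof -
      have "coeff h i = 0" using \<open>h = 0\<close> by simp
      then have "x ^ degree f * coeff g i = coeff f i * \<pi> ^ (degree f - i) * x ^ i"
        by (simp add: h_def sc_coeff)
      also have "\<pi> ^ (degree f - i) = \<pi> * \<pi> ^ (degree f - i - 1)"
        using i by (simp add: Suc_diff_Suc flip: power_Suc)
      finally have "x ^ degree f * coeff g i / \<pi> = coeff f i * \<pi> ^ (degree f - i - 1) * x ^ i"
        using \<pi>' by simp
      also have "\<dots> \<in> R" using f(1) x \<pi>' by (auto simp: poly_over_def)
      finally have "x ^ degree f * coeff g i \<in> multiples R \<pi>" by (simp add: multiples_def)
      then show ?thesis using pR.prime[of "x ^ degree f" "coeff g i"] pR.prime_power[of x] x g
        by (auto simp: poly_over_def)
    qed
    have "s ^ degree f = - (\<Sum>i<degree f. coeff g i * s ^ i)" using monic_root_power[OF g(2,3)] deg by simp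
    also have "\<dots> \<in> P"
    proof (intro P.uminus_in P.sum_in P.mult_in')
      fix i assume "i \<in> {..<degree f}"
      then have "coeff g i / \<pi> \<in> OK" using g_in R_sub_OK by (auto simp: multiples_def)
      then have "coeff g i / \<pi> * \<pi> \<in> P" using \<pi> P.mult_in by blast
      then show "coeff g i \<in> P" using \<pi>' by simp
    qed (use s in auto)
    finally show False using P.prime_power s by blast
  qed
  have "I \<inter> M = {}"
  proof (rule ccontr)
    assume "I \<inter> M \<noteq> {}"
    then obtain x s where "x * s / \<pi> \<in> OK" "x \<in> R" "x \<notin> multiples R \<pi>" "s \<in> OK" "s \<notin> P"
      unfolding I_def M_def multiples_def by auto
    then show False using disj[of x s "x * s / \<pi>"] \<pi>' by simp
  qed
  moreover have "1 \<in> M"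
    unfolding M_def using P.one_notin pR.one_notin by (intro CollectI exI[of _ 1]) auto
  moreover have "M \<subseteq> OK" using R_sub_OK by (auto simp: M_def)
  moreover have "u * v \<in> M" if uv: "u \<in> M" "v \<in> M" for u v
  proof -
    obtain x s x' s' where e: "u = x * s" "v = x' * s'" "x \<in> R - multiples R \<pi>" "s \<in> OK - P"
      "x' \<in> R - multiples R \<pi>" "s' \<in> OK - P"
      using uv by (auto simp: M_def)
    then have "u * v = (x * x') * (s * s')" by (simp add: algebra_simps)
    then show ?thesis using pR.diff_mult[OF e(3,5)] P.diff_mult[OF e(4,6)] unfolding M_def by blast
  qed
  ultimately obtain Q where Q: "prime_of OK Q" "I \<subseteq> Q" "Q \<inter> M = {}"
    using prime_avoiding_exists[OF I, of M] by blast
  interpret Q: prime_of OK Q by fact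
  have "Q \<subseteq> P"
  proof
    fix s assume "s \<in> Q"
    show "s \<in> P"
    proof (rule ccontr)
      assume "s \<notin> P"
      then have "1 * s \<in> M" using Q.sub \<open>s \<in> Q\<close> pR.one_notin unfolding M_def by blast
      then show False using Q(3) \<open>s \<in> Q\<close> by auto
    qed
  qed
  moreover have "Q \<inter> R \<subseteq> multiples R \<pi>"
  proof
    fix x assume "x \<in> Q \<inter> R"
    show "x \<in> multiples R \<pi>"
    proof (rule ccontr)
      assume "x \<notin> multiples R \<pi>"
      then have "x * 1 \<in> M" using \<open>x \<in> Q \<inter> R\<close> P.one_notin unfolding M_def by blast
      then show False using Q(3) \<open>x \<in> Q \<inter> R\<close> by auto
    qed
  qed
  moreover have "multiples R \<pi> \<subseteq> Q \<inter> R"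
  proof
    fix x assume x: "x \<in> multiples R \<pi>"
    then have "x \<in> I" using R_sub_OK by (auto simp: I_def multiples_def)
    then show "x \<in> Q \<inter> R" using x pR.sub Q \<pi>' by auto
  qed
  ultimately show ?thesis using Q by blast
qed

text \<open>Going down provides a nonzero prime inside \<open>P\<close> lying over
  \<open>\<pi>\<close>, and height one leaves no choice but \<open>P\<close> itself.\<close>

lemma height_one_Int_base:
  assumes "height_one_prime OK P" "prime_element R \<pi>" "\<pi> \<in> P"
  shows "P \<inter> R = multiples R \<pi>"
proof -
  have P: "prime_of OK P" "\<And>Q. prime_of OK Q \<Longrightarrow> Q \<subseteq> P \<Longrightarrow> Q = {0} \<or> Q = P"
    using assms by (auto simp: OK.height_one_prime_iff)
  obtain Q where Q: "prime_of OK Q" "Q \<subseteq> P" "Q \<inter> R = multiples R \<pi>"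
    using going_down[OF P(1) assms(2,3)] by blast
  have "\<pi> \<in> multiples R \<pi>" "\<pi> \<noteq> 0" using assms by (auto simp: multiples_def prime_element_def)
  then have "Q \<noteq> {0}" using Q(3) by auto
  then show ?thesis using P(2)[OF Q(1,2)] Q(3) by auto
qed

text \<open>The contraction to \<open>R\<close> is not 0, since each nonzero element of
  \<open>P\<close> divides a nonzero element of \<open>R\<close>; so it contains a prime
  element.\<close>

lemma height_one_over_prime:
  assumes "height_one_prime OK P"
  shows "\<exists>\<pi>. prime_element R \<pi> \<and> P \<inter> R = multiples R \<pi>"
proof -
  interpret P: prime_of OK P using assms by (auto simp: OK.height_one_prime_iff)
  obtain z where z: "z \<in> P" "z \<noteq> 0" using assms P.zero_in by (auto simp: OK.height_one_prime_iff)
  then obtain w where w: "w \<in> OK" "z * w \<in> R" "z * w \<noteq> 0" using divides_base P.sub by blast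
  have "prime_of R (P \<inter> R)"
    by unfold_locales (use P.mult_in P.prime P.one_notin R_sub_OK in \<open>auto, blast\<close>)
  moreover have "z * w \<in> P \<inter> R" using P.mult_in' w z by auto
  ultimately obtain \<pi> where "\<pi> \<in> P" "prime_element R \<pi>"
    using prime_ideal_contains_prime w by blast
  then show ?thesis using height_one_Int_base[OF assms] by blast
qed

end

section \<open>Height-one primes of the integral closure\<close>

lemma (in prime_of) common_denominator:
  assumes "finite I" "\<And>i. i \<in> I \<Longrightarrow> x i \<in> localization A P"
  shows "\<exists>s\<in>A - P. \<forall>i\<in>I. s * x i \<in> A"
  using assms
proof (induction I rule: finite_induct)
  case empty
  then show ?case using one_notin by auto
next
  case (insert i I)
  then obtain s where s: "s \<in> A - P" "\<forall>l\<in>I. s * x l \<in> A" by auto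
  obtain a d where ad: "x i = a / d" "a \<in> A" "d \<in> A - P"
    using insert.prems[of i] by (auto simp: localization_def)
  then have "d \<noteq> 0" by auto
  have "(s * d) * x i \<in> A"
    using ad s \<open>d \<noteq> 0\<close> by auto
  moreover have "(s * d) * x l \<in> A" if "l \<in> I" for l
  proof -
    have "d * (s * x l) \<in> A" using s ad that by blast
    then show ?thesis by (simp add: mult_ac)
  qed
  ultimately show ?case using diff_mult[OF s(1) ad(3)] by blast
qed

context finite_extension
begin

interpretation K: subrng K by (rule subrng_K)
interpretation OK: subrng OK by (rule subrng_OK)

text \<open>With \<open>M\<close> the maximal ideal of the local ring \<open>B\<close>, one finds \<open>b \<in> B - \<pi> B\<close> with \<open>b M \<subseteq> \<pi> B\<close> and
  puts \<open>z = b / \<pi>\<close>. If \<open>z M \<subseteq> M\<close> then \<open>z\<close> would be integral; so \<open>z M = B\<close> and \<open>M = z\<inverse> B\<close>.\<close>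

theorem dvr_exists:
  assumes P: "prime_of OK P" and \<pi>: "prime_element R \<pi>" and over: "P \<inter> R = multiples R \<pi>"
  shows "\<exists>g\<in>K. dvr OK P K g"
proof -
  interpret P: prime_of OK P by fact
  interpret pR: prime_of R "multiples R \<pi>" using \<pi> prime_element_ideal subrng_axioms by blast
  define B M where "B = localization OK P" and "M = max_ideal OK P"
  interpret B: subrng B unfolding B_def by (rule P.subrng_localization)
  interpret M: ideal_of B M unfolding B_def M_def by (rule P.ideal_max_ideal)
  have BK: "B \<subseteq> K"
    using OK_sub divide_in unfolding B_def localization_def by blast
  have OB: "OK \<subseteq> B" unfolding B_def by (rule P.subset_localization)
  have PM: "P \<subseteq> M" unfolding M_def by (rule P.subset_max_ideal)
  have unit: "inverse x \<in> B" if "x \<in> B" "x \<notin> M" for x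
    using P.localization_unit that unfolding B_def M_def by blast
  have nonunit: "x = 0" if "x \<in> M" "inverse x \<in> B" for x
    using P.max_ideal_nonunit that unfolding B_def M_def by blast
  \<comment> \<open>The hypothesis on \<open>P \<inter> R\<close> enters here: a coefficient from
    \<open>R\<close> is either a unit of \<open>B\<close> or divisible by \<open>\<pi>\<close>, with
    nothing in between.\<close>
  have RM: "c \<in> M \<longleftrightarrow> c \<in> multiples R \<pi>" if "c \<in> R" for c
    using P.max_ideal_Int[of c] PM over R_sub_OK that unfolding M_def by blast
  have \<pi>': "\<pi> \<noteq> 0" "\<pi> \<in> R" "\<pi> \<in> M" "\<pi> \<in> B"
    using \<pi> RM[of \<pi>] M.sub by (auto simp: prime_element_def multiples_def)
  have RB: "R \<subseteq> B" using R_sub_OK OB by blast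
  have rel: "\<exists>c. (\<forall>i\<le>N. c i \<in> R) \<and> (\<exists>i\<le>N. c i \<notin> M) \<and> (\<Sum>i\<le>N. c i * x i) = 0"
    if "\<And>i. x i \<in> B" for x
    using reduced_relation[OF \<pi>, of x] that BK RM by blast
  have unit_add: "c + x \<in> B" "inverse (c + x) \<in> B" "c + x \<noteq> 0" if c: "c \<in> B" "c \<notin> M" and x: "x \<in> M" for c x
  proof -
    show "c + x \<in> B" using c x M.sub by blast
    have "c + x \<notin> M" using M.diff_in[of "c + x" x] c x by auto
    then show "inverse (c + x) \<in> B" "c + x \<noteq> 0" using unit \<open>c + x \<in> B\<close> by auto
  qed
  \<comment> \<open>In effect, \<open>M\<close> is nilpotent modulo \<open>\<pi> B\<close>. Take a
    reduced relation between the \<open>x i\<close> and its least index with a unit coefficient: the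
    later terms only change this unit by an element of \<open>M\<close>, and the earlier
    coefficients are divisible by \<open>\<pi>\<close>.\<close>
  have chain: "\<exists>i\<le>N. x i / \<pi> \<in> B"
    if x: "\<And>i. x i \<in> B" and div: "\<And>i l. i < l \<Longrightarrow> \<exists>m\<in>M. x l = m * x i" for x :: "nat \<Rightarrow> 'a"
  proof -
    obtain c where c: "\<And>i. i \<le> N \<Longrightarrow> c i \<in> R" "\<exists>i\<le>N. c i \<notin> M" "(\<Sum>i\<le>N. c i * x i) = 0"
      using rel[of x, OF x] by auto
    define i where "i = (LEAST i. i \<le> N \<and> c i \<notin> M)"
    have i: "i \<le> N" "c i \<notin> M" using c(2) LeastI_ex[of "\<lambda>i. i \<le> N \<and> c i \<notin> M"] by (auto simp: i_def)
    have less: "c l / \<pi> \<in> B" if "l < i" for l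
    proof -
      have "c l \<in> M" using not_less_Least[of l "\<lambda>i. i \<le> N \<and> c i \<notin> M"] that i by (auto simp: i_def)
      then show ?thesis using RM c(1)[of l] that i RB by (auto simp: multiples_def)
    qed
    have "\<forall>l. \<exists>m. i < l \<longrightarrow> m \<in> M \<and> x l = m * x i" using div by blast
    then obtain m where m: "\<And>l. i < l \<Longrightarrow> m l \<in> M" "\<And>l. i < l \<Longrightarrow> x l = m l * x i" by metis
    have split: "{..N} = {..<i} \<union> ({i} \<union> {i<..N})" using i by auto
    have "(\<Sum>l\<le>N. c l * x l) = (\<Sum>l<i. c l * x l) + (c i * x i + (\<Sum>l\<in>{i<..N}. c l * x l))"
      unfolding split by (subst sum.union_disjoint; (subst sum.union_disjoint)?) auto
    also have "(\<Sum>l\<in>{i<..N}. c l * x l) = (\<Sum>l\<in>{i<..N}. c l * m l) * x i"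
      unfolding sum_distrib_right using m by (intro sum.cong) auto
    finally have eq: "x i * (c i + (\<Sum>l\<in>{i<..N}. c l * m l)) = - (\<Sum>l<i. c l * x l)"
      using c(3) by (simp add: eq_neg_iff_add_eq_0 algebra_simps)
    define e where "e = c i + (\<Sum>l\<in>{i<..N}. c l * m l)"
    have "(\<Sum>l\<in>{i<..N}. c l * m l) \<in> M" using c(1) m RB by (intro M.sum_in M.mult_in) auto
    then have e: "inverse e \<in> B" "e \<noteq> 0"
      using unit_add[of "c i"] i c(1)[of i] RB unfolding e_def by auto
    have "x i / \<pi> = inverse e * (- (\<Sum>l<i. (c l / \<pi>) * x l))"
      using eq e \<pi>' by (simp add: e_def[symmetric] sum_divide_distrib[symmetric] field_simps)
    also have "\<dots> \<in> B" using e less x by (intro B.mult B.uminus B.sum) auto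
    finally show ?thesis using i by blast
  qed
  have "\<exists>b\<in>B. b / \<pi> \<notin> B \<and> (\<forall>x\<in>M. x * b / \<pi> \<in> B)"
  proof (rule ccontr)
    assume no: "\<not> ?thesis"
    \<comment> \<open>Without such a \<open>b\<close>, one could start from 1 and multiply by
      elements of \<open>M\<close> forever without entering \<open>\<pi> B\<close>, contrary to
      \<open>chain\<close>.\<close>
    define step where "step b = (SOME x. x \<in> M \<and> x * b / \<pi> \<notin> B)" for b
    have step: "step b \<in> M" "step b * b / \<pi> \<notin> B" if "b \<in> B" "b / \<pi> \<notin> B" for b
      using no that someI_ex[of "\<lambda>x. x \<in> M \<and> x * b / \<pi> \<notin> B"] by (auto simp: step_def)
    define b where "b = rec_nat 1 (\<lambda>_ b. step b * b)"
    have b_Suc: "b (Suc i) = step (b i) * b i" and b0: "b 0 = 1" for i by (simp_all add: b_def)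
    have b: "b i \<in> B \<and> b i / \<pi> \<notin> B" for i
    proof (induction i)
      case 0
      have "inverse \<pi> \<notin> B" using nonunit \<pi>' by blast
      then show ?case by (simp add: b0 inverse_eq_divide)
    next
      case (Suc i)
      then show ?case using step M.sub by (auto simp: b_Suc)
    qed
    have "\<exists>m\<in>M. b l = m * b i" if "i < l" for i l
      using that
    proof (induction l)
      case (Suc l)
      show ?case
      proof (cases "i = l")
        case True
        then show ?thesis using step b b_Suc by blast
      next
        case False
        then obtain m where "m \<in> M" "b l = m * b i" using Suc by auto
        then show ?thesis using step[of "b l"] b[of l] M.sub b_Suc M.mult_in
          by (metis mult.assoc subsetD)
      qed
    qed simp
    then show False using chain[of b] b by blast
  qed
  then obtain b where b: "b \<in> B" "b / \<pi> \<notin> B" "\<And>x. x \<in> M \<Longrightarrow> x * b / \<pi> \<in> B" by blast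
  define z where "z = b / \<pi>"
  have z: "z \<notin> B" "z \<in> K" "\<And>x. x \<in> M \<Longrightarrow> z * x \<in> B"
    using b \<pi>' BK R_sub divide_in[of b \<pi>] by (auto simp: z_def mult.commute)
  have "\<exists>x\<in>M. z * x \<notin> M"
  proof (rule ccontr)
    assume "\<not> ?thesis"
    then have zM: "z * x \<in> M" if "x \<in> M" for x using that by blast
    have zp: "\<pi> * z ^ i \<in> M" for i
    proof (induction i)
      case (Suc i)
      then show ?case using zM[OF Suc] by (simp add: mult.left_commute)
    qed (use \<pi>' in simp)
    then obtain c where c: "\<And>i. i \<le> N \<Longrightarrow> c i \<in> R" "\<exists>i\<le>N. c i \<notin> M" "(\<Sum>i\<le>N. c i * (\<pi> * z ^ i)) = 0"
      using rel[of "\<lambda>i. \<pi> * z ^ i"] M.sub by blast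
    \<comment> \<open>The highest unit coefficient is to become the leading one. Each later
      \<open>c l\<close> is divisible by \<open>\<pi>\<close>, so after cancelling one
      \<open>\<pi>\<close> from the relation the later terms still lie in \<open>M\<close>, because
      all \<open>\<pi> * z ^ l\<close> do. Their sum \<open>r\<close> is moved into the constant
      term, which leaves a monic equation for \<open>z\<close> over \<open>B\<close>.\<close>
    define i where "i = (GREATEST i. i \<le> N \<and> c i \<notin> M)"
    have i: "i \<le> N" "c i \<notin> M" using c(2) GreatestI_ex_nat[of "\<lambda>i. i \<le> N \<and> c i \<notin> M" N] by (auto simp: i_def)
    have gt: "c l \<in> M" if "i < l" "l \<le> N" for l
      using Greatest_le_nat[of "\<lambda>i. i \<le> N \<and> c i \<notin> M" l N] that by (auto simp: i_def)
    have split: "{..N} = {..i} \<union> {i<..N}" using i by auto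
    have "(\<Sum>l\<le>N. c l * (\<pi> * z ^ l)) = (\<Sum>l\<le>i. c l * (\<pi> * z ^ l)) + (\<Sum>l\<in>{i<..N}. c l * (\<pi> * z ^ l))"
      unfolding split by (subst sum.union_disjoint) auto
    also have "(\<Sum>l\<le>i. c l * (\<pi> * z ^ l)) = \<pi> * (\<Sum>l\<le>i. c l * z ^ l)"
      by (simp add: sum_distrib_left mult.left_commute)
    also have "(\<Sum>l\<in>{i<..N}. c l * (\<pi> * z ^ l)) = \<pi> * (\<Sum>l\<in>{i<..N}. (c l / \<pi>) * (\<pi> * z ^ l))"
      using \<pi>' by (simp add: sum_distrib_left mult.left_commute)
    finally have eq: "(\<Sum>l\<le>i. c l * z ^ l) + (\<Sum>l\<in>{i<..N}. (c l / \<pi>) * (\<pi> * z ^ l)) = 0"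
      using c(3) \<pi>' by (simp flip: distrib_left)
    define r where "r = (\<Sum>l\<in>{i<..N}. (c l / \<pi>) * (\<pi> * z ^ l))"
    have r: "r \<in> M" unfolding r_def
    proof (rule M.sum_in)
      fix l assume "l \<in> {i<..N}"
      then have "c l / \<pi> \<in> B" using gt[of l] RM c(1)[of l] RB by (auto simp: multiples_def)
      then show "c l / \<pi> * (\<pi> * z ^ l) \<in> M" using zp by (rule M.mult_in)
    qed
    have ci: "c i \<in> B" "inverse (c i) \<in> B" "c i \<noteq> 0" using i c(1) RB unit by auto
    have "i \<noteq> 0"
    proof
      assume "i = 0"
      then have "c i = - r" using eq by (simp add: r_def eq_neg_iff_add_eq_0)
      then show False using r M.uminus_in i by simp
    qed
    define e where "e l = inverse (c i) * (c l + (if l = 0 then r else 0))" for l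
    have e: "e l \<in> B" if "l < i" for l
      using ci c(1)[of l] that i r RB M.sub unfolding e_def by (intro B.mult B.add) auto
    have "(\<Sum>l<i. e l * z ^ l) = inverse (c i) * ((\<Sum>l<i. c l * z ^ l) + r)"
    proof -
      have "(\<Sum>l<i. (if l = 0 then r else 0) * z ^ l) = (\<Sum>l<i. if l = 0 then r else 0)"
        by (intro sum.cong) auto
      also have "\<dots> = r" using \<open>i \<noteq> 0\<close> by simp
      finally show ?thesis
        by (simp add: e_def distrib_right sum.distrib mult.assoc flip: sum_distrib_left distrib_left)
    qed
    moreover have "c i * z ^ i = - ((\<Sum>l<i. c l * z ^ l) + r)"
      using eq unfolding r_def[symmetric] lessThan_Suc_atMost[symmetric] sum.lessThan_Suc
      by (subst eq_neg_iff_add_eq_0) (simp only: add_ac)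
    then have "inverse (c i) * (c i * z ^ i) = inverse (c i) * (- ((\<Sum>l<i. c l * z ^ l) + r))" by simp
    then have "z ^ i = - (inverse (c i) * ((\<Sum>l<i. c l * z ^ l) + r))"
      by (simp only: mult.assoc[symmetric] mult_minus_right left_inverse[OF ci(3)] mult_1_left)
    ultimately have zi: "z ^ i = - (\<Sum>l<i. e l * z ^ l)" by simp
    \<comment> \<open>A common denominator outside \<open>P\<close> makes \<open>s * z\<close>
      integral over \<open>OK\<close>, hence an element of it; as \<open>s\<close> is invertible in
      \<open>B\<close>, this brings \<open>z\<close> into \<open>B\<close>.\<close>
    obtain s where s: "s \<in> OK" "s \<notin> P" "\<And>l. l < i \<Longrightarrow> s * e l \<in> OK"
      using P.common_denominator[of "{..<i}" e] e by (auto simp: B_def)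
    have "s * z \<in> OK"
      using integral_over_OK OK.integral_scale[OF s(1,3) \<open>i \<noteq> 0\<close> zi] s(1) z(2) OK_sub by blast
    moreover have "s \<noteq> 0" using s by auto
    ultimately have "z \<in> B" using P.localizationI[of "s * z" s] s by (simp add: B_def)
    then show False using z by simp
  qed
  then obtain x where x: "x \<in> M" "z * x \<notin> M" by blast
  have z0: "z \<noteq> 0" using z by auto
  define g where "g = inverse z"
  have u: "z * x \<in> B" "inverse (z * x) \<in> B" using z(3)[OF x(1)] unit[of "z * x"] x by blast+
  have "g = inverse (z * x) * x"
    using x M.zero_in z0 by (auto simp: g_def field_simps)
  then have "g \<in> M" using M.mult_in[OF u(2) x(1)] by simp
  moreover have "g \<noteq> 0" using z0 by (simp add: g_def)
  ultimately have g: "g \<in> M" "g \<noteq> 0" by auto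
  have M_eq: "M = (\<lambda>b. g * b) ` B"
  proof (intro equalityI subsetI)
    fix y assume "y \<in> M"
    then have "z * y \<in> B" "y = g * (z * y)" using z z0 by (auto simp: g_def)
    then show "y \<in> (\<lambda>b. g * b) ` B" by blast
  qed (use M.mult_in' g in auto)
  have g_B: "g \<in> B" using g M.sub by auto
  have div_g: "y / g \<in> B" if "y \<in> M" for y
    using that g unfolding M_eq by auto
  have bounded: "\<exists>k e. e \<in> B \<and> inverse e \<in> B \<and> y = e * g ^ k"
    if y: "y \<in> B" and b: "y / g ^ n \<notin> B" for y n
  proof -
    define k where "k = (LEAST k. y / g ^ Suc k \<notin> B)"
    have "y / g ^ Suc n \<notin> B"
    proof
      assume "y / g ^ Suc n \<in> B"
      then have "g * (y / g ^ Suc n) \<in> B" using g_B by blast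
      then show False using b g by simp
    qed
    then have k: "y / g ^ Suc k \<notin> B" unfolding k_def by (rule LeastI)
    have "y / g ^ k \<in> B"
    proof (cases k)
      case (Suc l)
      then show ?thesis using not_less_Least[of l "\<lambda>k. y / g ^ Suc k \<notin> B"] by (auto simp: k_def)
    qed (use y in simp)
    moreover have "y / g ^ k \<notin> M" using k div_g[of "y / g ^ k"] by (auto simp: mult.commute)
    ultimately show ?thesis using unit[of "y / g ^ k"] g
      by (intro exI[of _ k] exI[of _ "y / g ^ k"]) auto
  qed
  \<comment> \<open>By \<open>chain\<close>, \<open>\<pi>\<close> divides some power
    \<open>g ^ i\<close>. If \<open>g ^ Suc i\<close> divided \<open>\<pi>\<close> in turn,
    \<open>g\<close> would be a unit.\<close>
  have "\<exists>n. \<pi> / g ^ n \<notin> B"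
  proof (rule ccontr)
    assume all: "\<not> ?thesis"
    have "\<exists>i\<le>N. g ^ i / \<pi> \<in> B"
    proof (rule chain)
      fix i l :: nat assume "i < l"
      then obtain d where "l = i + Suc d" using less_imp_Suc_add by auto
      then have "g ^ l = g ^ Suc d * g ^ i" by (simp add: power_add)
      then show "\<exists>m\<in>M. g ^ l = m * g ^ i" using M.mult_in'[OF g(1), of "g ^ d"] g_B by auto
    qed (use g_B in auto)
    then obtain i where i: "g ^ i / \<pi> \<in> B" by auto
    have "\<pi> / g ^ Suc i \<in> B" using all by blast
    from B.mult[OF i this] have "inverse g \<in> B" using \<pi>' g by (simp add: field_simps)
    then show False using nonunit g by auto
  qed
  then obtain k0 e0 where pi_eq: "e0 \<in> B" "inverse e0 \<in> B" "\<pi> = e0 * g ^ k0"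
    using bounded[of \<pi>] \<pi>' by blast
  have integral_case: "\<exists>k e. e \<in> B \<and> inverse e \<in> B \<and> y = e * g ^ k" if y: "y \<in> OK" "y \<noteq> 0" for y
  proof -
    obtain w where w: "w \<in> OK" "y * w \<in> R" "y * w \<noteq> 0" using divides_base y by blast
    obtain r where r: "y * w / \<pi> ^ r \<in> R" "y * w / \<pi> ^ Suc r \<notin> R"
      using multiplicity_bound[OF \<pi> w(2,3)] by blast
    define v where "v = y * w / \<pi> ^ r"
    have v: "v \<in> B" "v \<notin> M" using r RB RM[of v] by (auto simp: v_def multiples_def mult.commute)
    then have v': "inverse v \<in> B" "v \<noteq> 0" using unit by auto
    \<comment> \<open>The bound: \<open>y * w\<close> is the unit \<open>v\<close> times
      \<open>\<pi> ^ r\<close>, and \<open>\<pi>\<close> is a unit times \<open>g ^ k0\<close>. So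
      \<open>y * w\<close>, and with it \<open>y\<close>, admits at most \<open>k0 * r\<close>
      factors \<open>g\<close>.\<close>
    have "y / g ^ (k0 * r + 1) \<notin> B"
    proof
      assume "y / g ^ (k0 * r + 1) \<in> B"
      then have "(y / g ^ (k0 * r + 1)) * w * (inverse v * inverse e0 ^ r) \<in> B"
        using w OB v' pi_eq by (intro B.mult B.power) auto
      moreover have "e0 \<noteq> 0" using pi_eq \<pi>' by auto
      then have "(y / g ^ (k0 * r + 1)) * w * (inverse v * inverse e0 ^ r) = inverse g"
        using w g unfolding v_def pi_eq(3) by (simp add: power_mult_distrib power_mult field_simps)
      ultimately show False using nonunit g by auto
    qed
    then show ?thesis using bounded y OB by blast
  qed
  have "\<exists>k e. e \<in> B \<and> inverse e \<in> B \<and> y = e * g powi k" if y: "y \<in> K" "y \<noteq> 0" for y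
  proof -
    obtain s where s: "s \<in> R" "s \<noteq> 0" "s * y \<in> OK" using denominator_exists y by blast
    obtain k e where ke: "e \<in> B" "inverse e \<in> B" "s * y = e * g ^ k" using integral_case[of "s * y"] s y by auto
    obtain l f where lf: "f \<in> B" "inverse f \<in> B" "s = f * g ^ l" using integral_case[of s] s R_sub_OK by auto
    have "f \<noteq> 0" using lf s by auto
    have "y = (e * inverse f) * g powi (int k - int l)"
      using ke(3) s(2) \<open>f \<noteq> 0\<close> g unfolding lf(3) by (simp add: power_int_diff field_simps)
    moreover have "e * inverse f \<in> B" "inverse (e * inverse f) \<in> B" using ke lf by auto
    ultimately show ?thesis by blast
  qed
  then have "dvr OK P K g" using g M_eq by (simp add: dvr_def B_def M_def)
  then show ?thesis using g_B BK by blast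
qed

lemma height_one_dvr:
  assumes "height_one_prime OK P"
  shows "\<exists>g\<in>K. dvr OK P K g"
  using dvr_exists height_one_over_prime[OF assms] assms OK.height_one_prime_iff by blast

text \<open>There are at most \<open>N\<close> such primes. Given N + 1 of them, which are pairwise
  incomparable, choose \<open>x i\<close> outside the i-th and inside all others. In a reduced
  relation between the \<open>x i\<close>, each \<open>c i * x i\<close> lies in the i-th prime,
  hence so does \<open>c i\<close>, and every coefficient is divisible by
  \<open>\<pi>\<close>.\<close>

lemma finite_height_one_over:
  assumes \<pi>: "prime_element R \<pi>"
  shows "finite {P. height_one_prime OK P \<and> \<pi> \<in> P}" (is "finite ?H")
proof -
  have "card G \<le> N" if G: "G \<subseteq> ?H" "finite G" for G
  proof (rule ccontr)
    assume "\<not> card G \<le> N"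
    then obtain G' where G': "G' \<subseteq> G" "card G' = Suc N"
      by (metis not_less_eq_eq obtain_subset_with_card_n)
    then have "finite G'" using G finite_subset by blast
    then obtain h where "bij_betw h {0..<Suc N} G'" using ex_bij_betw_nat_finite G' by metis
    then have h: "inj_on h {..N}" "\<And>i. i \<le> N \<Longrightarrow> h i \<in> ?H"
      using G G' by (auto simp: bij_betw_def atLeast0LessThan lessThan_Suc_atMost)
    have hp: "prime_of OK (h i)" "h i \<inter> R = multiples R \<pi>" if "i \<le> N" for i
      using h(2)[OF that] height_one_Int_base \<pi> by (auto simp: OK.height_one_prime_iff)
    have "\<exists>y. y \<in> h l \<and> y \<notin> h i" if "i \<le> N" "l \<le> N" "i \<noteq> l" for i l
    proof -
      have "h i \<noteq> h l" using h(1) that by (auto simp: inj_on_def)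
      moreover have "h l \<noteq> {0}" "height_one_prime OK (h i)" "prime_of OK (h l)"
        using h(2) that by (auto simp: OK.height_one_prime_iff)
      ultimately have "\<not> h l \<subseteq> h i" by (auto simp: OK.height_one_prime_iff)
      then show ?thesis by blast
    qed
    then obtain y where y: "\<And>i l. i \<le> N \<Longrightarrow> l \<le> N \<Longrightarrow> i \<noteq> l \<Longrightarrow> y i l \<in> h l \<and> y i l \<notin> h i" by metis
    define x where "x i = (\<Prod>l\<in>{..N}-{i}. y i l)" for i
    have yO: "y i l \<in> OK" if "i \<le> N" "l \<le> N" "i \<noteq> l" for i l
      using y[OF that] hp(1)[OF that(2)] by (meson ideal_of.sub prime_of_def subsetD)
    have xO: "x i \<in> OK" if "i \<le> N" for i unfolding x_def using yO that by (intro OK.prod) auto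
    have x_notin: "x i \<notin> h i" if i: "i \<le> N" for i
    proof
      interpret P: prime_of OK "h i" using hp i by blast
      assume "x i \<in> h i"
      then have "\<exists>l\<in>{..N}-{i}. y i l \<in> h i" unfolding x_def using yO i by (intro P.prime_prod) auto
      then show False using y i by auto
    qed
    have x_in: "x i \<in> h l" if il: "i \<le> N" "l \<le> N" "i \<noteq> l" for i l
    proof -
      interpret P: prime_of OK "h l" using hp il by blast
      have "x i = y i l * (\<Prod>l\<in>{..N}-{i}-{l}. y i l)"
        unfolding x_def using il by (subst prod.remove[of _ l]) auto
      then show ?thesis using y[OF il] yO il by (auto intro!: P.mult_in' OK.prod)
    qed
    obtain c where c: "\<And>i. i \<le> N \<Longrightarrow> c i \<in> R" "\<exists>i\<le>N. c i \<notin> multiples R \<pi>" "(\<Sum>i\<le>N. c i * x i) = 0"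
      using reduced_relation[OF \<pi>, of x] xO OK_sub by blast
    then obtain i where i: "i \<le> N" "c i \<notin> multiples R \<pi>" by blast
    interpret P: prime_of OK "h i" using hp i by blast
    have "(\<Sum>i\<le>N. c i * x i) = c i * x i + (\<Sum>l\<in>{..N}-{i}. c l * x l)"
      using i by (subst sum.remove[of _ i]) auto
    then have "c i * x i = - (\<Sum>l\<in>{..N}-{i}. c l * x l)" using c(3) by (simp add: eq_neg_iff_add_eq_0)
    also have "\<dots> \<in> h i"
      using c(1) R_sub_OK x_in i by (intro P.uminus_in P.sum_in P.mult_in) auto
    finally have "c i \<in> h i"
      using P.prime[of "c i" "x i"] x_notin xO i c(1) R_sub_OK by blast
    then show False using hp(2) i c(1) by blast
  qed
  then show ?thesis using finite_if_finite_subsets_card_bdd by blast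
qed

text \<open>A prime containing \<open>z\<close> contains the nonzero multiple
  \<open>z * w \<in> R\<close>, hence one of its finitely many prime factors.\<close>

theorem finite_height_one_containing:
  assumes "z \<in> OK" "z \<noteq> 0"
  shows "finite {P. height_one_prime OK P \<and> z \<in> P}"
proof -
  obtain w where w: "w \<in> OK" "z * w \<in> R" "z * w \<noteq> 0" using divides_base assms by blast
  then obtain k where "factors R k (z * w)" using factors_exist by blast
  then have "finite {P. height_one_prime OK P \<and> z * w \<in> P}"
  proof (induction rule: factors.induct)
    case (unit a)
    have "{P. height_one_prime OK P \<and> a \<in> P} = {}"
    proof safe
      fix P assume P: "height_one_prime OK P" "a \<in> P"
      interpret P: prime_of OK P using P by (auto simp: OK.height_one_prime_iff)
      show "P \<in> {}" using P.mult_in[of "inverse a" a] unit R_sub_OK P P.one_notin by auto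
    qed
    then show ?case by (metis finite.emptyI)
  next
    case (prime p k a)
    have "{P. height_one_prime OK P \<and> p * a \<in> P}
        \<subseteq> {P. height_one_prime OK P \<and> p \<in> P} \<union> {P. height_one_prime OK P \<and> a \<in> P}"
    proof safe
      fix P assume P: "height_one_prime OK P" "p * a \<in> P" "a \<notin> P"
      interpret P: prime_of OK P using P by (auto simp: OK.height_one_prime_iff)
      show "p \<in> P" using P.prime[of p a] P prime factors_in R_sub_OK by (auto simp: prime_element_def)
    qed
    then show ?case using finite_height_one_over[OF prime(1)] prime(3) finite_subset by blast
  qed
  moreover have "{P. height_one_prime OK P \<and> z \<in> P} \<subseteq> {P. height_one_prime OK P \<and> z * w \<in> P}"
  proof safe
    fix P assume P: "height_one_prime OK P" "z \<in> P"
    then interpret P: prime_of OK P by (auto simp: OK.height_one_prime_iff)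
    show "z * w \<in> P" using P.mult_in' P w by blast
  qed
  ultimately show ?thesis by (rule rev_finite_subset)
qed

end

section \<open>Valuations\<close>

lemma (in subrng) powi_in: "x \<in> A \<Longrightarrow> inverse x \<in> A \<Longrightarrow> x powi k \<in> A"
  by (auto simp: power_int_def)

lemma (in subrng) Units_ring_on: "x \<in> Units (ring_on A) \<longleftrightarrow> x \<in> A \<and> inverse x \<in> A \<and> x \<noteq> 0"
proof
  assume "x \<in> Units (ring_on A)"
  then obtain y where y: "x \<in> A" "y \<in> A" "x * y = 1" by (auto simp: Units_def)
  then have "inverse x = y" by (simp add: inverse_unique)
  then show "x \<in> A \<and> inverse x \<in> A \<and> x \<noteq> 0" using y by auto
qed (auto simp: Units_def intro!: bexI[of _ "inverse x"])

context prime_of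
begin

lemma uniformizer_iff:
  "uniformizer A P g \<longleftrightarrow> max_ideal A P = (\<lambda>b. g * b) ` loc"
  by (auto simp: uniformizer_def max_ideal_def cgenideal_def image_def mult.commute)

lemma dvr_exponent_unique:
  assumes d: "g \<noteq> 0" "max_ideal A P = (\<lambda>b. g * b) ` loc"
    and e: "e \<in> loc" "inverse e \<in> loc" "e \<noteq> 0"
    and f: "f \<in> loc" "inverse f \<in> loc" "f \<noteq> 0"
    and eq: "e * g powi k = f * g powi l"
  shows "k = l"
proof -
  interpret B: subrng loc by (rule subrng_localization)
  have g: "g \<in> max_ideal A P" using d(2) B.one by force
  then have gB: "g \<in> loc" using ideal_of.sub[OF ideal_max_ideal] by blast
  have no: False
    if "k < l" "e \<in> loc" "inverse e \<in> loc" "e \<noteq> 0"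
      "f \<in> loc" "inverse f \<in> loc" "f \<noteq> 0" "e * g powi k = f * g powi l" for k l e f
  proof -
    define n where "n = nat (l - k - 1)"
    have "g powi l = g powi k * g powi (1 + int n)"
      using that(1) d(1) by (simp add: n_def flip: power_int_add)
    then have "g powi l = g powi k * (g * g ^ n)" using d(1) by (simp add: power_int_add)
    then have "e = f * (g * g ^ n)" using that(8) d(1) by (simp add: mult.left_commute)
    then have "inverse g = g ^ n * f * inverse e" using that d(1) by (simp add: field_simps)
    also have "\<dots> \<in> loc" using that gB by (intro B.mult B.power)
    finally show False using max_ideal_nonunit[OF g] d(1) by blast
  qed
  show ?thesis
    using no[of k l e f] no[of l k f e] e f eq by (metis linorder_neqE)
qed

text \<open>The definite description in \<open>val\<close> ranges over all uniformizers at once, so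
  uniqueness of the exponent must allow for replacing \<open>g\<close> by
  \<open>\<pi> = g * c\<close> with a unit \<open>c\<close>.\<close>

lemma val_eqI:
  assumes d: "dvr A P L g"
    and e: "e \<in> loc" "inverse e \<in> loc" "e \<noteq> 0" and x: "x = e * g powi k"
  shows "val A P x = k"
  unfolding val_def
proof (rule the_equality)
  interpret B: subrng loc by (rule subrng_localization)
  have g: "g \<noteq> 0" "max_ideal A P = (\<lambda>b. g * b) ` loc" using d by (auto simp: dvr_def)
  show "\<exists>\<pi> e. uniformizer A P \<pi> \<and> e \<in> Units (ring_on loc) \<and> x = e * \<pi> powi k"
    using g e x by (auto simp: uniformizer_iff B.Units_ring_on)
  fix l assume "\<exists>\<pi> f. uniformizer A P \<pi> \<and> f \<in> Units (ring_on loc) \<and> x = f * \<pi> powi l"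
  then obtain \<pi> f where f: "max_ideal A P = (\<lambda>b. \<pi> * b) ` loc"
    "f \<in> loc" "inverse f \<in> loc" "f \<noteq> 0" "x = f * \<pi> powi l"
    by (auto simp: uniformizer_iff B.Units_ring_on)
  have "g \<in> max_ideal A P" "\<pi> \<in> max_ideal A P" using g(2) f(1) B.one by force+
  then obtain b c where bc: "b \<in> loc" "c \<in> loc" "g = \<pi> * b" "\<pi> = g * c"
    by (metis g(2) f(1) imageE)
  have "g * (c * b) = g * c * b" by simp
  also have "\<dots> = g * 1" using bc(3,4) by simp
  finally have cb: "c * b = 1" using g(1) by simp
  then have inv: "inverse c = b" by (rule inverse_unique)
  have "c \<noteq> 0" using cb by auto
  have "x = (f * c powi l) * g powi l" unfolding f(5) bc(4) power_int_mult_distrib by (simp add: mult_ac)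
  moreover have "f * c powi l \<in> loc" using f(2) bc(1,2) inv B.mult B.powi_in by simp
  moreover have "inverse (f * c powi l) = inverse f * inverse c powi l" by (simp add: power_int_inverse)
  then have "inverse (f * c powi l) \<in> loc"
    using f(3,4) bc(1,2) inv inverse_inverse_eq[of c] B.mult B.powi_in[of "inverse c"] by simp
  ultimately show "l = k"
    using dvr_exponent_unique[OF g, of "f * c powi l" e l k] e x f(4) \<open>c \<noteq> 0\<close> by auto
qed

context
  fixes L g
  assumes d: "dvr A P L g"
begin

lemma val_decomposition:
  assumes "x \<in> L" "x \<noteq> 0"
  obtains e where "e \<in> loc" "inverse e \<in> loc" "e \<noteq> 0" "x = e * g powi (val A P x)"
proof -
  obtain k e where "e \<in> loc" "inverse e \<in> loc" "x = e * g powi k"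
    using d assms by (auto simp: dvr_def)
  moreover from this have "e \<noteq> 0" using assms by auto
  ultimately show ?thesis using val_eqI[OF d] that by metis
qed

lemma val_mult:
  assumes "x \<in> L" "x \<noteq> 0" "y \<in> L" "y \<noteq> 0"
  shows "val A P (x * y) = val A P x + val A P y"
proof -
  interpret B: subrng loc by (rule subrng_localization)
  obtain e where e: "e \<in> loc" "inverse e \<in> loc" "e \<noteq> 0" "x = e * g powi (val A P x)"
    using val_decomposition assms(1,2) .
  obtain f where f: "f \<in> loc" "inverse f \<in> loc" "f \<noteq> 0" "y = f * g powi (val A P y)"
    using val_decomposition assms(3,4) .
  have "g \<noteq> 0" using d by (auto simp: dvr_def)
  have "e * f \<in> loc" "inverse (e * f) \<in> loc" "e * f \<noteq> 0" using e f by auto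
  moreover have "x * y = e * f * g powi (val A P x + val A P y)"
    using \<open>g \<noteq> 0\<close> by (subst e(4), subst f(4)) (simp add: power_int_add mult_ac)
  ultimately show ?thesis by (rule val_eqI[OF d])
qed

lemma val_unit: "e \<in> loc \<Longrightarrow> inverse e \<in> loc \<Longrightarrow> e \<noteq> 0 \<Longrightarrow> val A P e = 0"
  using val_eqI[OF d, of e e 0] by simp

lemma val_outside: "x \<in> A \<Longrightarrow> x \<notin> P \<Longrightarrow> val A P x = 0"
  using val_unit[of x] inverse_in_localization[of x] subset_localization by auto

lemma val_in:
  assumes "x \<in> P" "x \<in> L" "x \<noteq> 0"
  shows "val A P x \<noteq> 0"
proof
  assume "val A P x = 0"
  then obtain e where "e \<in> loc" "inverse e \<in> loc" "x = e"
    using val_decomposition[OF assms(2,3)] by (metis mult.right_neutral power_int_0_right)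
  then show False using max_ideal_nonunit subset_max_ideal assms by blast
qed

lemma val_nonneg_iff:
  assumes "x \<in> L" "x \<noteq> 0"
  shows "0 \<le> val A P x \<longleftrightarrow> x \<in> loc"
proof -
  interpret B: subrng loc by (rule subrng_localization)
  obtain e where e: "e \<in> loc" "inverse e \<in> loc" "e \<noteq> 0" "x = e * g powi (val A P x)"
    using val_decomposition[OF assms] .
  have g: "g \<noteq> 0" "g \<in> max_ideal A P" using d B.one unfolding dvr_def by force+
  then have gB: "g \<in> loc" using ideal_of.sub[OF ideal_max_ideal] by blast
  define n where "n = nat \<bar>val A P x\<bar>"
  show ?thesis
  proof
    assume "0 \<le> val A P x"
    then have "x = e * g ^ n" using e(4) by (simp add: n_def power_int_def)
    then show "x \<in> loc" using e gB by auto
  next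
    assume x: "x \<in> loc"
    show "0 \<le> val A P x"
    proof (rule ccontr)
      assume "\<not> 0 \<le> val A P x"
      then have "x = e * inverse g ^ n" "n > 0" using e(4) by (simp_all add: n_def power_int_def)
      then obtain m where "x = e * inverse g ^ Suc m" by (metis gr0_implies_Suc)
      then have "inverse g = inverse e * x * g ^ m" using e g by (simp add: field_simps)
      also have "\<dots> \<in> loc" using e x gB by (intro B.mult B.power)
      finally show False using max_ideal_nonunit[OF g(2)] g by blast
    qed
  qed
qed

end

end

text \<open>As a fraction \<open>x\<close> is \<open>s * x\<close> over \<open>s\<close>, both in
  \<open>OK\<close>; at a prime containing neither of them its value is 0.\<close>

lemma (in finite_extension) finite_val_nonzero:
  assumes "x \<in> K" "x \<noteq> 0"
  shows "finite {P. height_one_prime OK P \<and> val OK P x \<noteq> 0}"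
proof -
  interpret OK: subrng OK by (rule subrng_OK)
  obtain s where s: "s \<in> R" "s \<noteq> 0" "s * x \<in> OK" using denominator_exists assms by blast
  have "{P. height_one_prime OK P \<and> val OK P x \<noteq> 0}
      \<subseteq> {P. height_one_prime OK P \<and> s \<in> P} \<union> {P. height_one_prime OK P \<and> s * x \<in> P}"
  proof safe
    fix P assume P: "height_one_prime OK P" "val OK P x \<noteq> 0" "s * x \<notin> P"
    interpret P: prime_of OK P using P by (auto simp: OK.height_one_prime_iff)
    obtain g where g: "dvr OK P K g" using height_one_dvr P by blast
    show "s \<in> P"
    proof (rule ccontr)
      assume "s \<notin> P"
      then have "val OK P s = 0" "val OK P (s * x) = 0"
        using P.val_outside[OF g] s P R_sub_OK by blast+
      then show False using P.val_mult[OF g, of s x] s assms R_sub P by auto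
    qed
  qed
  then show ?thesis
    using finite_height_one_containing[of s] finite_height_one_containing[of "s * x"] s R_sub_OK assms
    by (auto intro: finite_subset)
qed

section \<open>Towers of transcendental elements\<close>

text \<open>Any set of coefficients is allowed, so that \<open>tow \<pp> j t n\<close> can denote
  the extended ideal. The offset \<open>j\<close> lets one definition serve the lower variables
  (offset 0) and the upper ones.\<close>

primrec tow :: "'a::field set \<Rightarrow> nat \<Rightarrow> (nat \<Rightarrow> 'a) \<Rightarrow> nat \<Rightarrow> 'a set" where
  "tow B j t 0 = B"
| "tow B j t (Suc i) = adj (tow B j t i) (t (Suc (j + i)))"

lemma adj_mono: "B \<subseteq> C \<Longrightarrow> adj B x \<subseteq> adj C x"
  unfolding adj_def by (intro image_mono poly_over_mono)

lemma tow_mono: "B \<subseteq> C \<Longrightarrow> tow B j t i \<subseteq> tow C j t i"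
  by (induction i) (auto dest: adj_mono)

lemma algebraic_over_mono: "B \<subseteq> C \<Longrightarrow> algebraic_over B x \<Longrightarrow> algebraic_over C x"
  using poly_over_mono unfolding algebraic_over_def by blast

context subrng
begin

lemma subrng_tow: "subrng (tow A j t i)"
  by (induction i) (auto intro: subrng.subrng_adj subrng_axioms)

lemma subset_tow: "A \<subseteq> tow A j t i"
proof (induction i)
  case (Suc i)
  then show ?case using subrng.subset_adj[OF subrng_tow[of j t i]] by auto
qed simp

lemma gen_in_tow: "k \<in> {j+1..j+i} \<Longrightarrow> t k \<in> tow A j t i"
proof (induction i)
  case (Suc i)
  show ?case
  proof (cases "k = Suc (j + i)")
    case True
    then show ?thesis using subrng.gen_in_adj[OF subrng_tow[of j t i]] by simp
  next
    case False
    then show ?thesis using Suc subrng.subset_adj[OF subrng_tow[of j t i]] by auto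
  qed
qed simp

lemma tow_subset: "subrng C \<Longrightarrow> A \<subseteq> C \<Longrightarrow> t ` {j+1..j+i} \<subseteq> C \<Longrightarrow> tow A j t i \<subseteq> C"
proof (induction i)
  case (Suc i)
  have "t (Suc (j + i)) \<in> C" "tow A j t i \<subseteq> C" using Suc by (auto simp: image_subset_iff)
  then show ?case using subrng.adj_subset[OF subrng_tow[of j t i]] Suc.prems by auto
qed simp

lemma unit_tow:
  assumes "\<And>k. k < i \<Longrightarrow> \<not> algebraic_over (tow A j t k) (t (Suc (j + k)))"
    and "x \<in> tow A j t i" "inverse x \<in> tow A j t i" "x \<noteq> 0"
  shows "x \<in> A"
  using assms
proof (induction i)
  case (Suc i)
  then show ?case using subrng.unit_adj[OF subrng_tow[of j t i], of "t (Suc (j + i))" x] by auto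
qed simp

end

lemma (in prime_of) prime_tow:
  assumes "\<And>k. k < i \<Longrightarrow> \<not> algebraic_over (tow A j t k) (t (Suc (j + k)))"
  shows "prime_of (tow A j t i) (tow P j t i)"
  using assms
proof (induction i)
  case (Suc i)
  then show ?case using prime_of.prime_adj[of "tow A j t i" "tow P j t i"] by auto
qed (simp add: prime_of_axioms)

lemma (in ufd) ufd_tow:
  assumes "\<And>k. k < i \<Longrightarrow> \<not> algebraic_over (tow R j t k) (t (Suc (j + k)))"
  shows "ufd (tow R j t i)"
  using assms
proof (induction i)
  case (Suc i)
  then show ?case using ufd.ufd_adj[of "tow R j t i"] by auto
qed (simp add: ufd_axioms)

lemma UNIV_subrng: "subrng (UNIV :: 'a::field set)"
  by unfold_locales auto

lemma a_inv_ring_on_UNIV [simp]: "\<ominus>\<^bsub>ring_on UNIV\<^esub> x = - (x::'a::field)"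
  using subrng.a_inv_ring_on[OF UNIV_subrng] by simp

lemma inv_ring_on_UNIV [simp]: "x \<noteq> 0 \<Longrightarrow> inv\<^bsub>ring_on UNIV\<^esub> x = inverse (x::'a::field)"
proof -
  assume x: "x \<noteq> 0"
  interpret cring "ring_on (UNIV :: 'a set)" using subrng.cring_ring_on[OF UNIV_subrng] .
  show ?thesis using comm_inv_char[of x "inverse x"] x by simp
qed

lemma ring_adjoin_induct [consumes 1, case_names base add uminus mult one]:
  assumes "x \<in> ring_adjoin B Z"
    and "\<And>x. x \<in> B \<union> Z \<Longrightarrow> Q x" "\<And>x y. Q x \<Longrightarrow> Q y \<Longrightarrow> Q (x + y)" "\<And>x. Q x \<Longrightarrow> Q (- x)"
    "\<And>x y. Q x \<Longrightarrow> Q y \<Longrightarrow> Q (x * y)" "Q 1"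
  shows "Q (x::'a::field)"
  using assms(1) unfolding ring_adjoin_def
  by (induction rule: generate_ring.induct)
    (use assms in auto)

lemma ring_ring_on_UNIV: "ring (ring_on (UNIV :: 'a::field set))"
  and field_ring_on_UNIV: "field (ring_on (UNIV :: 'a::field set))"
proof -
  have "ring_on (UNIV :: 'a set) = ring_of_type_algebra" by (simp add: ring_of_type_algebra_def)
  then show "ring (ring_on (UNIV :: 'a set))" "field (ring_on (UNIV :: 'a set))"
    using ring_from_type_algebra field_from_type_algebra by metis+
qed

lemma subrng_of_subring:
  assumes "subring H (ring_on (UNIV :: 'a::field set))"
  shows "subrng H"
  using subringE(2,3)[OF assms] subringE(5-7)[OF assms] by unfold_locales simp_all

lemma subrng_ring_adjoin: "subrng (ring_adjoin B Z)"
  unfolding ring_adjoin_def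
  by (rule subrng_of_subring, rule ring.generate_ring_is_subring)
    (simp_all add: ring_ring_on_UNIV)

lemma ring_adjoin_incl: "B \<union> Z \<subseteq> ring_adjoin B Z"
  unfolding ring_adjoin_def by (rule subsetI) (rule generate_ring.incl)

lemma (in subrng) ring_adjoin_tow: "ring_adjoin A (t ` {j+1..j+i}) = tow A j t i"
proof
  interpret T: subrng "tow A j t i" by (rule subrng_tow)
  show "tow A j t i \<subseteq> ring_adjoin A (t ` {j+1..j+i})"
    using ring_adjoin_incl[of A "t ` {j+1..j+i}"] by (intro tow_subset subrng_ring_adjoin) auto
  show "ring_adjoin A (t ` {j+1..j+i}) \<subseteq> tow A j t i"
  proof
    fix x assume "x \<in> ring_adjoin A (t ` {j+1..j+i})"
    then show "x \<in> tow A j t i"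
      by (induction rule: ring_adjoin_induct) (use subset_tow gen_in_tow in auto)
  qed
qed

definition field_set :: "'a::field set \<Rightarrow> bool" where
  "field_set K \<longleftrightarrow> subrng K \<and> (\<forall>x\<in>K. inverse x \<in> K)"

lemma field_adjoin_incl: "B \<union> Z \<subseteq> field_adjoin B Z"
  unfolding field_adjoin_def by (rule subsetI) (rule generate_field.incl)

lemma field_adjoin_subset:
  assumes "field_set C" "B \<union> Z \<subseteq> C"
  shows "field_adjoin B Z \<subseteq> C"
proof
  interpret subrng C using assms by (simp add: field_set_def)
  fix x assume "x \<in> field_adjoin B Z"
  then have "x \<in> generate_field (ring_on UNIV) (B \<union> Z)" by (simp add: field_adjoin_def)
  then show "x \<in> C"
    by (induction rule: generate_field.induct)
      (use assms in \<open>auto simp: field_set_def\<close>)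
qed

lemma field_set_subfield:
  assumes "subfield F (ring_on (UNIV :: 'a::field set))"
  shows "field_set F"
proof -
  interpret S: subfield F "ring_on UNIV" by fact
  have F: "subrng F" by (rule subrng_of_subring) (rule S.subring_axioms)
  moreover have "inverse x \<in> F" if "x \<in> F" for x
    using S.subfield_Units subrng.Units_ring_on[OF F, of x] subrng.zero[OF F] that
    by (cases "x = 0") auto
  ultimately show ?thesis by (simp add: field_set_def)
qed

lemma field_set_field_adjoin: "field_set (field_adjoin B Z)"
  unfolding field_adjoin_def
  by (rule field_set_subfield, rule field.generate_field_is_subfield)
    (simp_all add: field_ring_on_UNIV)

lemma (in subrng) prime_of_zero: "prime_of A {0}"
  by unfold_locales auto

text \<open>Since {0} is prime in a domain, the fraction field appears below as
  \<open>localization A {0}\<close>, and facts about localizations apply to it.\<close>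

lemma (in subrng) field_set_fractions: "field_set (localization A {0})"
proof -
  interpret Z: prime_of A "{0}" by (rule prime_of_zero)
  have "inverse x \<in> localization A {0}" if x: "x \<in> localization A {0}" for x
  proof -
    obtain a b where ab: "x = a / b" "a \<in> A" "b \<in> A" "b \<noteq> 0" using x by (auto simp: localization_def)
    show ?thesis
    proof (cases "a = 0")
      case True
      then show ?thesis using x ab by simp
    next
      case False
      then show ?thesis using Z.localizationI[of b a] ab by simp
    qed
  qed
  then show ?thesis using Z.subrng_localization by (simp add: field_set_def)
qed

section \<open>Expansion in monomials of the upper variables\<close>

abbreviation "supp \<equiv> Poly_Mapping.keys"
abbreviation "coef \<equiv> Poly_Mapping.lookup"

lemma monomial_at_add_single:
  fixes t :: "nat \<Rightarrow> 'a::field"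
  assumes "coef \<beta> s = 0"
  shows "monomial_at t (\<beta> + Poly_Mapping.single s k) = monomial_at t \<beta> * t s ^ k"
proof -
  let ?\<alpha> = "\<beta> + Poly_Mapping.single s k"
  have sup: "monomial_at t \<alpha> = (\<Prod>i\<in>A. t i ^ coef \<alpha> i)"
    if "finite A" "supp \<alpha> \<subseteq> A" for \<alpha> A
    unfolding monomial_at_def using that by (intro prod.mono_neutral_left) (auto simp: in_keys_iff)
  define A where "A = insert s (supp \<beta>)"
  have s: "s \<notin> supp \<beta>" using assms by (simp add: in_keys_iff)
  have "monomial_at t ?\<alpha> = (\<Prod>i\<in>A. t i ^ coef ?\<alpha> i)"
    using Poly_Mapping.keys_add[of \<beta> "Poly_Mapping.single s k"] by (intro sup) (auto simp: A_def split: if_splits)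
  also have "\<dots> = t s ^ k * (\<Prod>i\<in>supp \<beta>. t i ^ coef ?\<alpha> i)"
    using s assms by (simp add: A_def lookup_add)
  also have "(\<Prod>i\<in>supp \<beta>. t i ^ coef ?\<alpha> i) = monomial_at t \<beta>"
    unfolding monomial_at_def using s by (intro prod.cong) (auto simp: lookup_add lookup_single when_def)
  finally show ?thesis by (simp add: mult.commute)
qed

definition drop_var :: "nat \<Rightarrow> (nat \<Rightarrow>\<^sub>0 nat) \<Rightarrow> (nat \<Rightarrow>\<^sub>0 nat)" where
  "drop_var s \<alpha> = \<alpha> - Poly_Mapping.single s (coef \<alpha> s)"

lemma lookup_drop_var: "coef (drop_var s \<alpha>) i = (if i = s then 0 else coef \<alpha> i)"
  by (simp add: drop_var_def lookup_minus lookup_single when_def)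

lemma drop_var_add: "drop_var s \<alpha> + Poly_Mapping.single s (coef \<alpha> s) = \<alpha>"
  by (rule poly_mapping_eqI) (simp add: lookup_add lookup_drop_var lookup_single when_def)

lemma drop_var_add_single: "coef \<beta> s = 0 \<Longrightarrow> drop_var s (\<beta> + Poly_Mapping.single s k) = \<beta>"
  by (rule poly_mapping_eqI) (simp add: lookup_add lookup_drop_var lookup_single when_def)

lemma keys_drop_var: "supp (drop_var s \<alpha>) = supp \<alpha> - {s}"
  by (auto simp: in_keys_iff lookup_drop_var split: if_splits)

lemma monomial_at_drop_var:
  "monomial_at t \<alpha> = monomial_at t (drop_var s \<alpha>) * t s ^ coef \<alpha> s"
  by (metis drop_var_add lookup_drop_var monomial_at_add_single)

locale poly_tower = subrng K for K :: "'a::field set" +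
  fixes j :: nat and t :: "nat \<Rightarrow> 'a" and n :: nat
  assumes transcendental: "\<And>k. k < n \<Longrightarrow> \<not> algebraic_over (tow K j t k) (t (Suc (j + k)))"
begin

lemma transcendental_sub: "B \<subseteq> K \<Longrightarrow> k < n \<Longrightarrow> \<not> algebraic_over (tow B j t k) (t (Suc (j + k)))"
  using transcendental[of k] algebraic_over_mono[OF tow_mono[of B K j t k]] by blast

text \<open>\<open>B\<close> is any subset of \<open>K\<close> containing 0, and this generality
  pays: B = {0} gives uniqueness of the expansion, \<open>B = OK\<close> membership in
  \<open>AA\<close>, and \<open>B = \<pp>\<close> membership in the extended prime.\<close>

lemma sum_in_tow_iff:
  assumes "i \<le> n" "B \<subseteq> K" "0 \<in> B" "finite S"
    and "\<And>\<alpha>. \<alpha> \<in> S \<Longrightarrow> supp \<alpha> \<subseteq> {j+1..j+i} \<and> a \<alpha> \<in> K"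
  shows "(\<Sum>\<alpha>\<in>S. a \<alpha> * monomial_at t \<alpha>) \<in> tow B j t i \<longleftrightarrow> (\<forall>\<alpha>\<in>S. a \<alpha> \<in> B)"
  using assms(1,4,5)
proof (induction i arbitrary: S a)
  case 0
  then have "S \<subseteq> {0}" by force
  then consider "S = {}" | "S = {0}" by blast
  then show ?case using assms(3) by cases (auto simp: monomial_at_def)
next
  case (Suc i)
  define s where "s = Suc (j + i)"
  define ex where "ex \<alpha> = coef \<alpha> s" for \<alpha> :: "nat \<Rightarrow>\<^sub>0 nat"
  \<comment> \<open>Collect the terms by their exponent in the last variable \<open>t s\<close>:
    \<open>c k\<close> is the coefficient of \<open>t s ^ k\<close>, itself an expansion in the
    earlier variables.\<close>
  define T where "T k = {\<alpha> \<in> S. ex \<alpha> = k}" for k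
  define b where "b k \<beta> = a (\<beta> + Poly_Mapping.single s k)" for k \<beta>
  define c where "c k = (\<Sum>\<beta>\<in>drop_var s ` T k. b k \<beta> * monomial_at t \<beta>)" for k
  define f where "f = (\<Sum>k\<in>ex ` S. monom (c k) k)"
  have add: "drop_var s \<alpha> + Poly_Mapping.single s k = \<alpha>" if "\<alpha> \<in> T k" for \<alpha> k
    using drop_var_add[of s \<alpha>] that by (simp add: T_def ex_def)
  have inj: "inj_on (drop_var s) (T k)" for k by (rule inj_onI) (metis add)
  have c_alt: "c k * t s ^ k = (\<Sum>\<alpha>\<in>T k. a \<alpha> * monomial_at t \<alpha>)" for k
    unfolding c_def sum.reindex[OF inj] o_def sum_distrib_right
  proof (intro sum.cong refl)
    fix \<alpha> assume \<alpha>: "\<alpha> \<in> T k"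
    show "b k (drop_var s \<alpha>) * monomial_at t (drop_var s \<alpha>) * t s ^ k = a \<alpha> * monomial_at t \<alpha>"
      using add[OF \<alpha>] monomial_at_drop_var[of t \<alpha> s] \<alpha> by (simp add: b_def T_def ex_def)
  qed
  have Tprops: "finite (drop_var s ` T k)"
    "\<And>\<beta>. \<beta> \<in> drop_var s ` T k \<Longrightarrow> supp \<beta> \<subseteq> {j+1..j+i} \<and> b k \<beta> \<in> K" for k
  proof -
    show "finite (drop_var s ` T k)" using Suc.prems by (simp add: T_def)
    fix \<beta> assume "\<beta> \<in> drop_var s ` T k"
    then obtain \<alpha> where \<alpha>: "\<alpha> \<in> T k" "\<beta> = drop_var s \<alpha>" by auto
    then have "supp \<beta> \<subseteq> {j+1..j+Suc i} - {s}"
      using Suc.prems(3)[of \<alpha>] by (auto simp: keys_drop_var T_def)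
    moreover have "b k \<beta> = a \<alpha>" using add \<alpha> by (simp add: b_def)
    ultimately show "supp \<beta> \<subseteq> {j+1..j+i} \<and> b k \<beta> \<in> K"
      using Suc.prems(3)[of \<alpha>] \<alpha> by (auto simp: s_def T_def le_Suc_eq)
  qed
  have IH: "c k \<in> tow B' j t i \<longleftrightarrow> (\<forall>\<beta>\<in>drop_var s ` T k. b k \<beta> \<in> B')" if "B' = B \<or> B' = K" for B' k
  proof -
    have iff: "c k \<in> tow B j t i \<longleftrightarrow> (\<forall>\<beta>\<in>drop_var s ` T k. b k \<beta> \<in> B)"
      unfolding c_def using Suc.prems Tprops by (intro Suc.IH) auto
    have "c k \<in> tow K j t i"
    proof -
      interpret W: subrng "tow K j t i" by (rule subrng_tow)
      have "monomial_at t \<beta> \<in> tow K j t i" if "\<beta> \<in> drop_var s ` T k" for \<beta>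
        unfolding monomial_at_def using Tprops(2)[OF that] gen_in_tow[of _ j i t] by (intro W.prod W.power) auto
      then show ?thesis unfolding c_def
        using Tprops(2) subset_tow[of j t i] by (intro W.sum W.mult) auto
    qed
    then show ?thesis using that iff Tprops(2) by auto
  qed
  have coeff_f: "coeff f k = (if k \<in> ex ` S then c k else 0)" for k
    using Suc.prems by (simp add: f_def coeff_sum)
  interpret W: subrng "tow K j t i" by (rule subrng_tow)
  \<comment> \<open>Injectivity of evaluation at \<open>t s\<close> is applied over
    \<open>tow K j t i\<close>, so the polynomial \<open>f\<close> and the one over the smaller
    coefficient set are compared there.\<close>
  have fK: "f \<in> poly_over (tow K j t i)"
    using IH[of K] Tprops(2) by (auto simp: poly_over_def coeff_f)
  have "(\<Sum>\<alpha>\<in>S. a \<alpha> * monomial_at t \<alpha>) = (\<Sum>k\<in>ex ` S. \<Sum>\<alpha>\<in>T k. a \<alpha> * monomial_at t \<alpha>)"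
    unfolding T_def using Suc.prems by (intro sum.image_gen) auto
  also have "\<dots> = poly f (t s)" by (simp add: f_def poly_sum poly_monom c_alt)
  finally have "(\<Sum>\<alpha>\<in>S. a \<alpha> * monomial_at t \<alpha>) \<in> tow B j t (Suc i) \<longleftrightarrow> poly f (t s) \<in> adj (tow B j t i) (t s)"
    by (simp add: s_def)
  also have "\<dots> \<longleftrightarrow> f \<in> poly_over (tow B j t i)"
  proof
    assume "poly f (t s) \<in> adj (tow B j t i) (t s)"
    then obtain g where g: "g \<in> poly_over (tow B j t i)" "poly f (t s) = poly g (t s)" by (auto simp: adj_def)
    moreover have "g \<in> poly_over (tow K j t i)" using g poly_over_mono[OF tow_mono[OF assms(2)]] by blast
    ultimately show "f \<in> poly_over (tow B j t i)"
      using W.transcendental_inject[OF transcendental[of i] fK] Suc.prems by (simp add: s_def)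
  qed (rule adjI)
  also have "\<dots> \<longleftrightarrow> (\<forall>k\<in>ex ` S. c k \<in> tow B j t i)"
  proof -
    have "0 \<in> tow B j t l" for l
      by (induction l) (use assms(3) adjI[of 0] in \<open>force simp: poly_over_def\<close>)+
    then show ?thesis by (auto simp: poly_over_def coeff_f)
  qed
  also have "\<dots> \<longleftrightarrow> (\<forall>k\<in>ex ` S. \<forall>\<alpha>\<in>T k. a \<alpha> \<in> B)"
    using IH[of B] add by (auto simp: b_def)
  also have "\<dots> \<longleftrightarrow> (\<forall>\<alpha>\<in>S. a \<alpha> \<in> B)" by (auto simp: T_def)
  finally show ?case .
qed

lemma tow_sum_exists:
  assumes "x \<in> tow K j t i"
  shows "\<exists>S a. finite S \<and> (\<forall>\<alpha>\<in>S. supp \<alpha> \<subseteq> {j+1..j+i} \<and> a \<alpha> \<in> K) \<and>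
    x = (\<Sum>\<alpha>\<in>S. a \<alpha> * monomial_at t \<alpha>)"
  using assms
proof (induction i arbitrary: x)
  case 0
  then show ?case by (intro exI[of _ "{0}"] exI[of _ "\<lambda>_. x"]) (simp add: monomial_at_def)
next
  case (Suc i)
  define s where "s = Suc (j + i)"
  obtain f where f: "f \<in> poly_over (tow K j t i)" "x = poly f (t s)"
    using Suc.prems by (auto simp: adj_def s_def)
  have "\<forall>k. \<exists>S a. finite S \<and> (\<forall>\<alpha>\<in>S. supp \<alpha> \<subseteq> {j+1..j+i} \<and> a \<alpha> \<in> K) \<and>
    coeff f k = (\<Sum>\<alpha>\<in>S. a \<alpha> * monomial_at t \<alpha>)"
    by (intro allI Suc.IH poly_overD[OF f(1)])
  then obtain S a where S: "\<And>k. finite (S k)"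
    "\<And>k \<alpha>. \<alpha> \<in> S k \<Longrightarrow> supp \<alpha> \<subseteq> {j+1..j+i} \<and> a k \<alpha> \<in> K"
    "\<And>k. coeff f k = (\<Sum>\<alpha>\<in>S k. a k \<alpha> * monomial_at t \<alpha>)" by metis
  define ext where "ext k \<alpha> = \<alpha> + Poly_Mapping.single s k" for k and \<alpha> :: "nat \<Rightarrow>\<^sub>0 nat"
  define b where "b \<alpha> = a (coef \<alpha> s) (drop_var s \<alpha>)" for \<alpha>
  have s0: "coef \<alpha> s = 0" if "\<alpha> \<in> S k" for k \<alpha>
    using S(2)[OF that] by (force simp: s_def in_keys_iff)
  have ext: "coef (ext k \<alpha>) s = k" "drop_var s (ext k \<alpha>) = \<alpha>" if "\<alpha> \<in> S k" for k \<alpha>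
    using s0[OF that] by (simp_all add: ext_def lookup_add drop_var_add_single)
  have b_ext: "b (ext k \<alpha>) = a k \<alpha>" if "\<alpha> \<in> S k" for k \<alpha>
    using ext[OF that] by (simp add: b_def)
  define Z where "Z = (\<Union>k\<in>{..degree f}. ext k ` S k)"
  have "x = (\<Sum>k\<le>degree f. coeff f k * t s ^ k)" using f by (simp add: poly_altdef)
  also have "\<dots> = (\<Sum>k\<le>degree f. \<Sum>\<alpha>\<in>ext k ` S k. b \<alpha> * monomial_at t \<alpha>)"
  proof (intro sum.cong refl)
    fix k
    have "inj_on (ext k) (S k)" by (rule inj_onI) (metis ext(2))
    then have "(\<Sum>\<alpha>\<in>ext k ` S k. b \<alpha> * monomial_at t \<alpha>) = (\<Sum>\<alpha>\<in>S k. b (ext k \<alpha>) * monomial_at t (ext k \<alpha>))"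
      by (simp add: sum.reindex)
    also have "\<dots> = (\<Sum>\<alpha>\<in>S k. a k \<alpha> * monomial_at t \<alpha> * t s ^ k)"
    proof (intro sum.cong refl)
      fix \<alpha> assume "\<alpha> \<in> S k"
      then show "b (ext k \<alpha>) * monomial_at t (ext k \<alpha>) = a k \<alpha> * monomial_at t \<alpha> * t s ^ k"
        using monomial_at_add_single[OF s0[of \<alpha> k], of t k] by (simp add: b_ext) (simp add: ext_def)
    qed
    finally show "coeff f k * t s ^ k = (\<Sum>\<alpha>\<in>ext k ` S k. b \<alpha> * monomial_at t \<alpha>)"
      by (simp add: S(3) sum_distrib_right)
  qed
  also have "\<dots> = (\<Sum>\<alpha>\<in>Z. b \<alpha> * monomial_at t \<alpha>)"
    unfolding Z_def
  proof (rule sum.UNION_disjoint[symmetric])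
    show "\<forall>k\<in>{..degree f}. \<forall>l\<in>{..degree f}. k \<noteq> l \<longrightarrow> ext k ` S k \<inter> ext l ` S l = {}"
    proof (intro ballI impI equals0I)
      fix k l \<gamma> assume "k \<noteq> l" "\<gamma> \<in> ext k ` S k \<inter> ext l ` S l"
      then show False by (metis IntE imageE ext(1))
    qed
  qed (use S(1) in auto)
  finally have "x = (\<Sum>\<alpha>\<in>Z. b \<alpha> * monomial_at t \<alpha>)" .
  moreover have "supp \<alpha> \<subseteq> {j+1..j+Suc i} \<and> b \<alpha> \<in> K" if "\<alpha> \<in> Z" for \<alpha>
  proof -
    obtain k \<beta> where \<beta>: "\<beta> \<in> S k" "\<alpha> = ext k \<beta>" using \<open>\<alpha> \<in> Z\<close> by (auto simp: Z_def)
    have "supp \<alpha> \<subseteq> supp \<beta> \<union> {s}"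
      using Poly_Mapping.keys_add[of \<beta> "Poly_Mapping.single s k"] by (auto simp: \<beta> ext_def split: if_splits)
    then show ?thesis using S(2)[OF \<beta>(1)] b_ext[OF \<beta>(1)] \<beta>(2) by (force simp: s_def)
  qed
  moreover have "finite Z" using S(1) by (simp add: Z_def)
  ultimately show ?case by blast
qed

abbreviation coeffs :: "'a \<Rightarrow> (nat \<Rightarrow>\<^sub>0 nat) \<Rightarrow>\<^sub>0 'a" where
  "coeffs \<equiv> coeffs_in K {j+1..j+n} t"

text \<open>The definite description in \<open>coeffs_in\<close> is justified by applying
  \<open>sum_in_tow_iff\<close> with B = {0} to the difference of two expansions.\<close>

lemma coeffs_props:
  assumes "x \<in> tow K j t n"
  shows "(\<forall>\<alpha>\<in>supp (coeffs x). coef (coeffs x) \<alpha> \<in> K \<and> supp \<alpha> \<subseteq> {j+1..j+n}) \<and>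
    x = (\<Sum>\<alpha>\<in>supp (coeffs x). coef (coeffs x) \<alpha> * monomial_at t \<alpha>)"
proof -
  define Q where "Q c \<longleftrightarrow> (\<forall>\<alpha>\<in>supp c. coef c \<alpha> \<in> K \<and> supp \<alpha> \<subseteq> {j+1..j+n}) \<and>
    x = (\<Sum>\<alpha>\<in>supp c. coef c \<alpha> * monomial_at t \<alpha>)" for c
  obtain S a where S: "finite S" "\<forall>\<alpha>\<in>S. supp \<alpha> \<subseteq> {j+1..j+n} \<and> a \<alpha> \<in> K"
    "x = (\<Sum>\<alpha>\<in>S. a \<alpha> * monomial_at t \<alpha>)" using tow_sum_exists[OF assms] by blast
  define c where "c = (\<Sum>\<alpha>\<in>S. Poly_Mapping.single \<alpha> (a \<alpha>))"
  have lc: "coef c \<alpha> = (if \<alpha> \<in> S then a \<alpha> else 0)" for \<alpha>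
    using S(1) by (simp add: c_def lookup_sum lookup_single when_def)
  have "(\<Sum>\<alpha>\<in>supp c. coef c \<alpha> * monomial_at t \<alpha>) = (\<Sum>\<alpha>\<in>S. a \<alpha> * monomial_at t \<alpha>)"
    using S(1) by (intro sum.mono_neutral_cong_left) (auto simp: in_keys_iff lc split: if_splits)
  then have "Q c" using S by (auto simp: Q_def in_keys_iff lc split: if_splits)
  moreover have "c1 = c2" if "Q c1" "Q c2" for c1 c2
  proof -
    define U where "U = supp c1 \<union> supp c2"
    define d where "d \<alpha> = coef c1 \<alpha> - coef c2 \<alpha>" for \<alpha>
    have ext: "x = (\<Sum>\<alpha>\<in>U. coef c \<alpha> * monomial_at t \<alpha>)"
      if "Q c" "supp c \<subseteq> U" for c
    proof -
      have "x = (\<Sum>\<alpha>\<in>supp c. coef c \<alpha> * monomial_at t \<alpha>)" using that by (simp add: Q_def)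
      also have "\<dots> = (\<Sum>\<alpha>\<in>U. coef c \<alpha> * monomial_at t \<alpha>)"
        using that by (intro sum.mono_neutral_left) (auto simp: U_def in_keys_iff)
      finally show ?thesis .
    qed
    have "(\<Sum>\<alpha>\<in>U. d \<alpha> * monomial_at t \<alpha>) = x - x"
      by (subst (1) ext[OF that(1)], simp add: U_def, subst (1) ext[OF that(2)], simp add: U_def)
        (simp add: d_def left_diff_distrib sum_subtractf)
    then have "(\<Sum>\<alpha>\<in>U. d \<alpha> * monomial_at t \<alpha>) = 0" by simp
    moreover have z: "0 \<in> tow {0} j t l" for l
      by (induction l) (use adjI[of 0] in \<open>force simp: poly_over_def\<close>)+
    ultimately have "(\<Sum>\<alpha>\<in>U. d \<alpha> * monomial_at t \<alpha>) \<in> tow {0} j t n" by simp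
    moreover have "supp \<alpha> \<subseteq> {j+1..j+n} \<and> d \<alpha> \<in> K" if "\<alpha> \<in> U" for \<alpha>
    proof -
      have "coef c \<alpha> \<in> K" if "Q c" for c
        using that by (cases "\<alpha> \<in> supp c") (auto simp: Q_def in_keys_iff)
      then show ?thesis using \<open>Q c1\<close> \<open>Q c2\<close> \<open>\<alpha> \<in> U\<close> by (auto simp: U_def d_def Q_def)
    qed
    ultimately have "\<forall>\<alpha>\<in>U. d \<alpha> = 0"
      using sum_in_tow_iff[of n "{0}" U d] by (auto simp: U_def)
    then show ?thesis
      by (intro poly_mapping_eqI) (metis U_def UnCI d_def in_keys_iff right_minus_eq)
  qed
  ultimately have "Q (THE c. Q c)" by (metis theI)
  then show ?thesis unfolding coeffs_in_def Q_def by simp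
qed

lemma coeffs_in_K: "x \<in> tow K j t n \<Longrightarrow> coef (coeffs x) \<alpha> \<in> K"
  using coeffs_props[of x] by (cases "\<alpha> \<in> supp (coeffs x)") (auto simp: in_keys_iff)

lemma coeffs_nonempty: "x \<in> tow K j t n \<Longrightarrow> x \<noteq> 0 \<Longrightarrow> supp (coeffs x) \<noteq> {}"
  using coeffs_props[of x] by force

lemma scaled_in_tow_iff:
  assumes "x \<in> tow K j t n" "e \<in> K" "B \<subseteq> K" "0 \<in> B"
  shows "e * x \<in> tow B j t n \<longleftrightarrow> (\<forall>\<alpha>\<in>supp (coeffs x). e * coef (coeffs x) \<alpha> \<in> B)"
proof -
  have "e * x = (\<Sum>\<alpha>\<in>supp (coeffs x). (e * coef (coeffs x) \<alpha>) * monomial_at t \<alpha>)"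
    using coeffs_props[OF assms(1)] by (metis (no_types, lifting) mult.assoc sum.cong sum_distrib_left)
  then show ?thesis
    using sum_in_tow_iff[of n B "supp (coeffs x)" "\<lambda>\<alpha>. e * coef (coeffs x) \<alpha>"]
      coeffs_props[OF assms(1)] assms by auto
qed

lemma const_in_tow_iff:
  assumes "x \<in> K" "B \<subseteq> K" "0 \<in> B"
  shows "x \<in> tow B j t n \<longleftrightarrow> x \<in> B"
  using sum_in_tow_iff[of n B "{0}" "\<lambda>_. x"] assms by (simp add: monomial_at_def)

end

section \<open>Extended and moving primes\<close>

lemma (in ufd) prime_element_dvr:
  assumes p: "prime_element R p"
  shows "dvr R (multiples R p) (localization R {0}) p"
proof -
  interpret P: prime_of R "multiples R p" using prime_element_ideal p subrng_axioms by blast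
  have p0: "p \<noteq> 0" using p by (simp add: prime_element_def)
  have "max_ideal R (multiples R p) = (\<lambda>b. p * b) ` localization R (multiples R p)"
  proof (intro equalityI subsetI)
    fix x assume "x \<in> max_ideal R (multiples R p)"
    then obtain a s where as: "x = a / s" "a \<in> multiples R p" "s \<in> R - multiples R p" by (auto simp: max_ideal_def)
    then have "x = p * (a / p / s)" "a / p \<in> R" using p0 by (auto simp: multiples_def)
    then show "x \<in> (\<lambda>b. p * b) ` localization R (multiples R p)" using P.localizationI[of "a / p" s] as by blast
  next
    fix x assume "x \<in> (\<lambda>b. p * b) ` localization R (multiples R p)"
    then obtain a s where as: "x = p * a / s" "a \<in> R" "s \<in> R - multiples R p" by (auto simp: localization_def)
    then show "x \<in> max_ideal R (multiples R p)"
      using P.max_idealI[of "p * a" s] p0 by (auto simp: multiples_def)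
  qed
  moreover have "\<exists>k e. e \<in> localization R (multiples R p) \<and> inverse e \<in> localization R (multiples R p) \<and> x = e * p powi k"
    if x: "x \<in> localization R {0}" "x \<noteq> 0" for x
  proof -
    obtain a b where ab: "x = a / b" "a \<in> R" "b \<in> R" "b \<noteq> 0" "a \<noteq> 0" using x by (auto simp: localization_def)
    obtain k l where k: "a / p ^ k \<in> R" "a / p ^ Suc k \<notin> R" and l: "b / p ^ l \<in> R" "b / p ^ Suc l \<notin> R"
      using multiplicity_bound[OF p] ab by meson
    define a' b' where "a' = a / p ^ k" and "b' = b / p ^ l"
    have a': "a' \<in> R" "a' \<notin> multiples R p" and b': "b' \<in> R" "b' \<notin> multiples R p"
      using k l by (auto simp: a'_def b'_def multiples_def mult.commute)
    have "x = a' / b' * p powi (int k - int l)"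
      using ab p0 by (simp add: a'_def b'_def power_int_diff)
    moreover have "inverse (a' / b') = b' / a'" by simp
    ultimately show ?thesis using P.localizationI a' b' by metis
  qed
  ultimately show ?thesis using p0 by (simp add: dvr_def)
qed

text \<open>A prime from a factorization of \<open>q\<close> is a nonunit dividing \<open>q\<close>,
  so by irreducibility it is not a proper factor but an associate. This links the irreducibles of
  the statement to \<open>prime_element\<close>.\<close>

lemma (in ufd) prime_element_of_irreducible:
  assumes "ring_irreducible\<^bsub>ring_on R\<^esub> q" "q \<in> R"
  shows "prime_element R q"
proof -
  have q: "q \<noteq> 0" "q \<notin> Units (ring_on R)"
    "\<And>b. b \<in> R \<Longrightarrow> properfactor (ring_on R) b q \<Longrightarrow> b \<in> Units (ring_on R)"
    using assms by (auto simp: ring_irreducible_def irreducible_def)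
  obtain k where "factors R k q" using factors_exist assms q by blast
  then show ?thesis
  proof (cases rule: factors.cases)
    case unit
    then show ?thesis using q Units_ring_on by auto
  next
    case (prime \<pi> l a)
    have \<pi>: "\<pi> \<in> R" "\<pi> \<noteq> 0" "inverse \<pi> \<notin> R" using prime by (auto simp: prime_element_def)
    have a: "a \<in> R" "a \<noteq> 0" using factors_in prime by auto
    have "\<pi> \<notin> Units (ring_on R)" using \<pi> Units_ring_on by simp
    then have "\<not> properfactor (ring_on R) \<pi> q" using q \<pi> by blast
    moreover have "\<pi> divides\<^bsub>ring_on R\<^esub> q" using prime a by (auto simp: factor_def)
    ultimately obtain c where c: "c \<in> R" "\<pi> = q * c" by (auto simp: properfactor_def factor_def)
    have "q / \<pi> = a" using prime(2) \<pi>(2) by simp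
    moreover have "\<pi> / q = c" using c(2) q(1) by simp
    ultimately have "multiples R q = multiples R \<pi>"
      using a(1) c(1) q(1) \<pi>(2) by (intro multiples_eqI) simp_all
    then show ?thesis
      using prime_elementI[OF prime_element_ideal[OF subrng_axioms prime(3)], of q] q(1) by simp
  qed
qed

lemma (in subrng) cgenideal_ring_on: "q \<noteq> 0 \<Longrightarrow> PIdl\<^bsub>ring_on A\<^esub> q = multiples A q"
  by (auto simp: cgenideal_def multiples_def field_simps intro: exI[of _ "_ / q"])

lemma (in prime_of) val_prod_powi:
  assumes d: "dvr A P UNIV g" and "finite I" "\<And>i. i \<in> I \<Longrightarrow> f i \<noteq> 0"
  shows "val A P (\<Prod>i\<in>I. f i powi m i) = (\<Sum>i\<in>I. m i * val A P (f i))"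
proof -
  have one: "val A P 1 = 0" using val_outside[OF d, of 1] one_notin by auto
  have pow: "val A P (x ^ k) = int k * val A P x" if "x \<noteq> 0" for x k
    by (induction k) (use one val_mult[OF d] that in \<open>auto simp: algebra_simps\<close>)
  have inv: "val A P (inverse x) = - val A P x" if "x \<noteq> 0" for x
    using val_mult[OF d, of x "inverse x"] one that by simp
  have powi: "val A P (x powi k) = k * val A P x" if "x \<noteq> 0" for x k
    using that pow inv by (auto simp: power_int_def)
  show ?thesis using assms(2,3)
  proof (induction I rule: finite_induct)
    case (insert i I)
    then have "(\<Prod>i\<in>I. f i powi m i) \<noteq> 0" by auto
    then show ?case using insert val_mult[OF d, of "f i powi m i"] powi by simp
  qed (simp add: one)
qed

text \<open>Here \<open>n\<close> is the number of upper variables. \<open>fractions\<close> says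
  that the whole field is the fraction field of the polynomial ring over \<open>K\<close>.\<close>

locale tower_extension = finite_extension R K N + W: poly_tower K j t n
  for R K :: "'a::field set" and N j t n +
  assumes fractions: "localization (tow K j t n) {0} = UNIV"
begin

interpretation OK: subrng OK by (rule subrng_OK)

abbreviation "AA \<equiv> tow OK j t n"
abbreviation "TT \<equiv> tow K j t n"

interpretation A: subrng AA by (rule OK.subrng_tow)
interpretation T: subrng TT by (rule W.subrng_tow)

lemma ufd_TT: "ufd TT"
  using ufd.ufd_tow[OF W.ufd_field[OF inverse_in]] W.transcendental by blast

interpretation T: ufd TT by (rule ufd_TT)

lemma AA_sub_TT: "AA \<subseteq> TT"
  by (rule tow_mono[OF OK_sub])

lemma OK_sub_AA: "OK \<subseteq> AA"
  by (rule OK.subset_tow)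

lemma K_sub_TT: "K \<subseteq> TT"
  by (rule W.subset_tow)

lemma unit_TT: "x \<in> TT \<Longrightarrow> inverse x \<in> TT \<Longrightarrow> x \<noteq> 0 \<Longrightarrow> x \<in> K"
  using W.unit_tow[of n j t x] W.transcendental by blast

lemma fraction_cases:
  obtains a b where "x = a / b" "a \<in> TT" "b \<in> TT" "b \<noteq> 0"
proof -
  have "x \<in> localization TT {0}" by (simp add: fractions)
  then show ?thesis using that by (auto simp: localization_def)
qed

lemma K_fractions: "K \<subseteq> localization OK {0}"
proof
  fix x assume "x \<in> K"
  then obtain s where s: "s \<in> R" "s \<noteq> 0" "s * x \<in> OK" using denominator_exists by blast
  interpret Z: prime_of OK "{0}" by (rule OK.prime_of_zero)
  have "s * x / s \<in> localization OK {0}" using s R_sub_OK by (intro Z.localizationI) auto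
  then show "x \<in> localization OK {0}" using s by simp
qed

text \<open>One factor for two elements, so that it can expand a fraction \<open>x / y\<close>
  without changing it.\<close>

lemma clear_denominators:
  assumes "x \<in> TT" "y \<in> TT"
  shows "\<exists>s\<in>OK. s \<noteq> 0 \<and> s * x \<in> AA \<and> s * y \<in> AA"
proof -
  interpret Z: prime_of OK "{0}" by (rule OK.prime_of_zero)
  have "\<exists>s\<in>OK. s \<noteq> 0 \<and> s * x \<in> AA" if x: "x \<in> TT" for x
  proof -
    have "coef (W.coeffs x) \<alpha> \<in> localization OK {0}" for \<alpha>
      using W.coeffs_in_K[OF x] K_fractions by blast
    then obtain s where "s \<in> OK - {0}"
      "\<forall>\<alpha>\<in>supp (W.coeffs x). s * coef (W.coeffs x) \<alpha> \<in> OK"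
      using Z.common_denominator[OF finite_keys[of "W.coeffs x"], of "coef (W.coeffs x)"] by auto
    then show ?thesis using W.scaled_in_tow_iff[OF x, of s OK] OK_sub by auto
  qed
  then obtain s r where sr: "s \<in> OK" "s \<noteq> 0" "s * x \<in> AA" "r \<in> OK" "r \<noteq> 0" "r * y \<in> AA"
    using assms by metis
  then have "r * (s * x) \<in> AA" "s * (r * y) \<in> AA" using OK_sub_AA by blast+
  then show ?thesis using sr by (intro bexI[of _ "s * r"]) (auto simp: mult_ac)
qed

lemma prime_extension: "prime_of OK \<pp> \<Longrightarrow> prime_of AA (tow \<pp> j t n)"
  by (rule prime_of.prime_tow) (use W.transcendental_sub[OF OK_sub] in auto)

lemma extension_Int: "prime_of OK \<pp> \<Longrightarrow> tow \<pp> j t n \<inter> OK = \<pp>"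
proof -
  assume "prime_of OK \<pp>"
  then interpret P: prime_of OK \<pp> .
  show ?thesis using W.const_in_tow_iff[of _ \<pp>] P.sub OK_sub P.zero_in by blast
qed

lemma genideal_extension: "prime_of OK \<pp> \<Longrightarrow> Idl\<^bsub>ring_on AA\<^esub> \<pp> = tow \<pp> j t n"
proof -
  assume pp: "prime_of OK \<pp>"
  then interpret P: prime_of OK \<pp> .
  interpret Q: prime_of AA "tow \<pp> j t n" by (rule prime_extension[OF pp])
  show ?thesis
  proof
    show "Idl\<^bsub>ring_on AA\<^esub> \<pp> \<subseteq> tow \<pp> j t n"
      unfolding genideal_def using extension_Int[OF pp] A.ideal_ring_on_iff Q.ideal_of_axioms by blast
    show "tow \<pp> j t n \<subseteq> Idl\<^bsub>ring_on AA\<^esub> \<pp>"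
      unfolding genideal_def
    proof clarify
      fix x I assume x: "x \<in> tow \<pp> j t n" and "ideal I (ring_on AA)" and I: "\<pp> \<subseteq> I"
      then interpret I: ideal_of AA I using A.ideal_ring_on_iff by blast
      have "tow \<pp> j t i \<subseteq> I" if "i \<le> n" for i
        using that
      proof (induction i)
        case (Suc i)
        show ?case
        proof
          fix x assume "x \<in> tow \<pp> j t (Suc i)"
          then obtain f where f: "f \<in> poly_over (tow \<pp> j t i)" "x = poly f (t (Suc (j + i)))" by (auto simp: adj_def)
          have "t (Suc (j + i)) \<in> AA" using OK.gen_in_tow Suc.prems by auto
          moreover have "coeff f k \<in> I" for k using poly_overD[OF f(1)] Suc by auto
          ultimately show "x \<in> I" unfolding f(2) poly_altdef by (intro I.sum_in I.mult_in' A.power)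
        qed
      qed (simp add: I)
      then show "x \<in> I" using x by blast
    qed
  qed
qed

text \<open>The Gauss valuation: after scaling by a power of the uniformizer a polynomial has coefficients in
  the local ring, one of them a unit, hence lies outside the extended prime.\<close>

lemma extended_prime_dvr:
  assumes pp: "prime_of OK \<pp>" and d: "dvr OK \<pp> K g" "g \<in> K"
  shows "dvr AA (tow \<pp> j t n) UNIV g"
    and "x \<in> TT \<Longrightarrow> x \<noteq> 0 \<Longrightarrow> val AA (tow \<pp> j t n) x =
      Min ((\<lambda>\<alpha>. val OK \<pp> (coef (W.coeffs x) \<alpha>)) ` supp (W.coeffs x))"
    and "y \<in> K \<Longrightarrow> y \<noteq> 0 \<Longrightarrow> val AA (tow \<pp> j t n) y = val OK \<pp> y"
proof -
  let ?Q = "tow \<pp> j t n" and ?B = "localization AA (tow \<pp> j t n)"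
  interpret P: prime_of OK \<pp> by fact
  interpret Q: prime_of AA "?Q" by (rule prime_extension[OF pp])
  interpret BP: subrng "localization OK \<pp>" by (rule P.subrng_localization)
  interpret BQ: subrng "?B" by (rule Q.subrng_localization)
  interpret MQ: ideal_of "?B" "max_ideal AA ?Q" by (rule Q.ideal_max_ideal)
  have g: "g \<noteq> 0" "g \<in> max_ideal OK \<pp>" using d BP.one unfolding dvr_def by force+
  have int: "x \<in> ?Q \<longleftrightarrow> x \<in> \<pp>" if "x \<in> OK" for x using extension_Int[OF pp] that by blast
  have subset: "localization OK \<pp> \<subseteq> ?B" "max_ideal OK \<pp> \<subseteq> max_ideal AA ?Q"
    using OK_sub_AA int P.sub unfolding localization_def max_ideal_def by blast+
  define \<mu> where "\<mu> x = Min ((\<lambda>\<alpha>. val OK \<pp> (coef (W.coeffs x) \<alpha>)) ` supp (W.coeffs x))" for x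
  have decomp: "\<exists>e. e \<in> ?B \<and> inverse e \<in> ?B \<and> e \<noteq> 0 \<and>
      x = e * g powi (\<mu> x)" if x: "x \<in> TT" "x \<noteq> 0" for x
  proof -
    define c where "c = coef (W.coeffs x)"
    define S where "S = supp (W.coeffs x)"
    define k where "k = \<mu> x"
    have S: "finite S" "S \<noteq> {}" using W.coeffs_nonempty[OF x] by (auto simp: S_def)
    have c: "c \<alpha> \<in> K" "\<alpha> \<in> S \<Longrightarrow> c \<alpha> \<noteq> 0" for \<alpha>
      using W.coeffs_in_K[OF x(1)] by (auto simp: c_def S_def in_keys_iff)
    have k_def': "k = Min ((\<lambda>\<alpha>. val OK \<pp> (c \<alpha>)) ` S)" by (simp add: k_def \<mu>_def c_def S_def)
    have tk: "g powi m \<in> K" "g powi m \<noteq> 0" "val OK \<pp> (g powi m) = m" for m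
      using W.powi_in[OF d(2) inverse_in[OF d(2)]] g(1) P.val_eqI[OF d(1), of 1 "g powi m" m] BP.one by auto
    have v: "val OK \<pp> (g powi (- k) * c \<alpha>) = val OK \<pp> (c \<alpha>) - k" if "\<alpha> \<in> S" for \<alpha>
      using P.val_mult[OF d(1) tk(1,2) c(1), of \<alpha> "- k"] c(2)[OF that] tk(3)[of "- k"] by simp
    have "g powi (- k) * c \<alpha> \<in> localization OK \<pp>" if "\<alpha> \<in> S" for \<alpha>
    proof -
      have "k \<le> val OK \<pp> (c \<alpha>)" unfolding k_def' using S that by simp
      then have "0 \<le> val OK \<pp> (g powi (- k) * c \<alpha>)" using v[OF that] by simp
      moreover have "g powi (- k) * c \<alpha> \<in> K" "g powi (- k) * c \<alpha> \<noteq> 0"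
        using tk(1)[of "- k"] tk(2)[of "- k"] c that by auto
      ultimately show ?thesis using P.val_nonneg_iff[OF d(1)] by blast
    qed
    then obtain s where s: "s \<in> OK - \<pp>" "\<forall>\<alpha>\<in>S. s * (g powi (- k) * c \<alpha>) \<in> OK"
      using P.common_denominator[OF S(1), of "\<lambda>\<alpha>. g powi (- k) * c \<alpha>"] by auto
    then have "s \<noteq> 0" by auto
    \<comment> \<open>The power of \<open>g\<close> shifts the least coefficient value to 0, and
      \<open>s\<close>, of value 0, clears the remaining denominators. Hence \<open>e * x\<close>
      has coefficients in \<open>OK\<close>, not all in \<open>\<pp>\<close>.\<close>
    define e where "e = s * g powi (- k)"
    have eK: "e \<in> K" using s OK_sub tk(1) by (auto simp: e_def)
    have "e * x \<in> AA"
      using s W.scaled_in_tow_iff[OF x(1) eK OK_sub] by (auto simp: e_def c_def S_def mult.assoc)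
    moreover have "e * x \<notin> ?Q"
    proof
      assume "e * x \<in> ?Q"
      then have in_pp: "e * c \<alpha> \<in> \<pp>" if "\<alpha> \<in> S" for \<alpha>
        using W.scaled_in_tow_iff[OF x(1) eK, of \<pp>] P.sub OK_sub P.zero_in that by (auto simp: c_def S_def)
      have "k \<in> (\<lambda>\<alpha>. val OK \<pp> (c \<alpha>)) ` S" unfolding k_def' using S by (intro Min_in) auto
      then obtain \<alpha> where \<alpha>: "\<alpha> \<in> S" "val OK \<pp> (c \<alpha>) = k" by auto
      have ne: "g powi (- k) * c \<alpha> \<in> K" "g powi (- k) * c \<alpha> \<noteq> 0"
        using tk(1)[of "- k"] tk(2)[of "- k"] c \<alpha> by auto
      have "val OK \<pp> (s * (g powi (- k) * c \<alpha>)) = 0"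
        using P.val_mult[OF d(1) _ \<open>s \<noteq> 0\<close> ne] P.val_outside[OF d(1), of s] s v[OF \<alpha>(1)] \<alpha>(2) OK_sub by auto
      moreover have "s * (g powi (- k) * c \<alpha>) \<in> \<pp>" using in_pp[OF \<alpha>(1)] by (simp add: e_def mult.assoc)
      ultimately show False
        using P.val_in[OF d(1), of "s * (g powi (- k) * c \<alpha>)"] P.sub OK_sub ne(2) \<open>s \<noteq> 0\<close> by auto
    qed
    moreover have s': "s \<in> AA" "s \<notin> ?Q" using s OK_sub_AA int by auto
    ultimately have "e * x / s \<in> ?B" "s / (e * x) \<in> ?B"
      using Q.localizationI by auto
    moreover have "g powi (- k) * g powi k = 1" using g(1) by (simp flip: power_int_add)
    then have "x = e * x / s * g powi k" using \<open>s \<noteq> 0\<close> by (simp add: e_def mult_ac)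
    moreover have "e * x / s \<noteq> 0" using \<open>s \<noteq> 0\<close> x tk(2)[of "- k"] by (simp add: e_def)
    moreover have "inverse (e * x / s) = s / (e * x)" by simp
    ultimately show ?thesis unfolding k_def by metis
  qed
  have "max_ideal AA ?Q = (\<lambda>b. g * b) ` ?B"
  proof (intro equalityI subsetI)
    fix z assume "z \<in> max_ideal AA ?Q"
    then obtain x s where xs: "z = x / s" "x \<in> ?Q" "s \<in> AA - ?Q" by (auto simp: max_ideal_def)
    \<comment> \<open>All coefficients of an element of the extended prime lie in
      \<open>\<pp>\<close>, so their values, and with them the minimum, are at least 1; thus one
      factor \<open>g\<close> splits off.\<close>
    have "x / g \<in> ?B"
    proof (cases "x = 0")
      case False
      have xT: "x \<in> TT" using xs Q.sub AA_sub_TT by blast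
      obtain e where e: "e \<in> ?B" "x = e * g powi (\<mu> x)"
        using decomp[OF xT False] by blast
      have "\<mu> x \<in> (\<lambda>\<alpha>. val OK \<pp> (coef (W.coeffs x) \<alpha>)) ` supp (W.coeffs x)"
        unfolding \<mu>_def using W.coeffs_nonempty[OF xT False] by (intro Min_in) auto
      then obtain \<alpha> where \<alpha>: "\<alpha> \<in> supp (W.coeffs x)" "\<mu> x = val OK \<pp> (coef (W.coeffs x) \<alpha>)"
        by auto
      then have cP: "coef (W.coeffs x) \<alpha> \<in> \<pp>" "coef (W.coeffs x) \<alpha> \<noteq> 0"
        using W.scaled_in_tow_iff[OF xT W.one, of \<pp>] P.sub OK_sub P.zero_in xs(2) by (auto simp: in_keys_iff)
      let ?c = "coef (W.coeffs x) \<alpha>"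
      have "?c \<in> K" "?c \<in> localization OK \<pp>" using cP(1) P.sub OK_sub P.subset_localization by blast+
      then have "\<mu> x \<noteq> 0" "0 \<le> \<mu> x"
        unfolding \<alpha>(2) using P.val_in[OF d(1) cP(1) _ cP(2)] P.val_nonneg_iff[OF d(1) _ cP(2)] by blast+
      then obtain m where m: "\<mu> x = 1 + int m"
        using nonneg_int_cases[of "\<mu> x - 1"] by (metis add.commute diff_add_cancel int_one_le_iff_zero_less
            le_less diff_ge_0_iff_ge)
      then have "x / g = e * g ^ m" using e(2) g(1) by (simp add: power_int_add)
      moreover have "g \<in> ?B" using g(2) subset(2) MQ.sub by blast
      ultimately show ?thesis using e(1) by auto
    qed simp
    then have "x / g * inverse s \<in> ?B"
      using xs Q.inverse_in_localization by (intro BQ.mult) auto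
    moreover have "z = g * (x / g * inverse s)" using xs g(1) by (simp add: divide_inverse)
    ultimately show "z \<in> (\<lambda>b. g * b) ` ?B" by blast
  next
    fix z assume "z \<in> (\<lambda>b. g * b) ` ?B"
    then show "z \<in> max_ideal AA ?Q" using g(2) subset(2) MQ.mult_in' by blast
  qed
  moreover have "\<exists>k e. e \<in> ?B \<and> inverse e \<in> ?B \<and> z = e * g powi k"
    if "z \<noteq> 0" for z
  proof -
    obtain a b where ab: "z = a / b" "a \<in> TT" "b \<in> TT" "b \<noteq> 0" by (rule fraction_cases)
    then have "a \<noteq> 0" using that by auto
    obtain e k where e: "e \<in> ?B" "inverse e \<in> ?B"
      "a = e * g powi k" using decomp[OF ab(2) \<open>a \<noteq> 0\<close>] by blast
    obtain f l where f: "f \<in> ?B" "inverse f \<in> ?B" "f \<noteq> 0"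
      "b = f * g powi l" using decomp[OF ab(3,4)] by blast
    have "z = (e * inverse f) * g powi (k - l)"
      unfolding ab(1) e(3) f(4) using g(1) by (simp add: power_int_diff divide_inverse mult_ac)
    moreover have "e * inverse f \<in> ?B" "inverse (e * inverse f) \<in> ?B"
      using e f by auto
    ultimately show ?thesis by blast
  qed
  ultimately show dQ: "dvr AA ?Q UNIV g" using g(1) by (simp add: dvr_def)
  show "x \<in> TT \<Longrightarrow> x \<noteq> 0 \<Longrightarrow> val AA ?Q x =
      Min ((\<lambda>\<alpha>. val OK \<pp> (coef (W.coeffs x) \<alpha>)) ` supp (W.coeffs x))"
    using decomp[of x] Q.val_eqI[OF dQ] unfolding \<mu>_def by metis
  show "val AA ?Q y = val OK \<pp> y" if y: "y \<in> K" "y \<noteq> 0"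
  proof -
    obtain e where "e \<in> localization OK \<pp>" "inverse e \<in> localization OK \<pp>" "e \<noteq> 0" "y = e * g powi (val OK \<pp> y)"
      using P.val_decomposition[OF d(1) y] .
    then show ?thesis using Q.val_eqI[OF dQ, of e y] subset(1) by blast
  qed
qed

text \<open>Nonzero elements of \<open>OK\<close> are units of \<open>TT\<close> and lie outside
  \<open>P\<close>. Clearing denominators with them shows that \<open>AA\<close> at \<open>P\<close>
  and \<open>TT\<close> at \<open>p\<close> have the same local ring, in which \<open>p\<close> is a
  uniformizer.\<close>

lemma moving_prime:
  assumes p: "prime_element TT p"
  defines "P \<equiv> AA \<inter> multiples TT p"
  shows "prime_of AA P" "dvr AA P UNIV p" "P \<inter> OK = {0}"
    and "x \<in> TT \<Longrightarrow> x \<notin> multiples TT p \<Longrightarrow> val AA P x = 0"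
    and "x \<in> TT \<Longrightarrow> x \<noteq> 0 \<Longrightarrow> 0 \<le> val AA P x"
proof -
  interpret M: prime_of TT "multiples TT p" using prime_element_ideal p T.subrng_axioms by blast
  have p0: "p \<in> TT" "p \<noteq> 0" "inverse p \<notin> TT" using p by (auto simp: prime_element_def)
  show P: "prime_of AA P"
    unfolding P_def by unfold_locales (use AA_sub_TT M.mult_in M.one_notin M.prime in \<open>auto, blast\<close>)
  interpret P: prime_of AA P by (rule P)
  have unit: "inverse s \<in> TT" "s \<in> TT" if "s \<in> OK" for s
    using that OK_sub inverse_in K_sub_TT by blast+
  have scale: "s * x \<in> multiples TT p \<longleftrightarrow> x \<in> multiples TT p" if "s \<in> OK" "s \<noteq> 0" "x \<in> TT" for s x
  proof
    assume "s * x \<in> multiples TT p"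
    then have "inverse s * (s * x) \<in> multiples TT p" using unit that M.mult_in by blast
    then show "x \<in> multiples TT p" using that by (simp flip: mult.assoc)
  qed (use unit that M.mult_in in blast)
  have loc: "localization AA P = localization TT (multiples TT p)"
  proof (intro equalityI subsetI)
    fix x assume "x \<in> localization TT (multiples TT p)"
    then obtain a b where ab: "x = a / b" "a \<in> TT" "b \<in> TT" "b \<notin> multiples TT p" by (auto simp: localization_def)
    then obtain s where s: "s \<in> OK" "s \<noteq> 0" "s * a \<in> AA" "s * b \<in> AA" using clear_denominators by blast
    have "x = (s * a) / (s * b)" using s ab by simp
    moreover have "s * b \<notin> P" using scale s ab by (simp add: P_def)
    ultimately show "x \<in> localization AA P" using P.localizationI[OF s(3,4)] by metis
  qed (use AA_sub_TT in \<open>auto simp: localization_def P_def\<close>)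
  have max: "max_ideal AA P = max_ideal TT (multiples TT p)"
  proof (intro equalityI subsetI)
    fix x assume "x \<in> max_ideal TT (multiples TT p)"
    then obtain a b where ab: "x = a / b" "a \<in> multiples TT p" "b \<in> TT" "b \<notin> multiples TT p"
      by (auto simp: max_ideal_def)
    then have "a \<in> TT" using M.sub by blast
    then obtain s where s: "s \<in> OK" "s \<noteq> 0" "s * a \<in> AA" "s * b \<in> AA" using clear_denominators ab by blast
    have "x = (s * a) / (s * b)" using s ab by simp
    moreover have "s * b \<notin> P" "s * a \<in> P" using scale s ab \<open>a \<in> TT\<close> by (simp_all add: P_def)
    ultimately show "x \<in> max_ideal AA P" using P.max_idealI[OF _ s(4)] by metis
  qed (use AA_sub_TT in \<open>auto simp: max_ideal_def P_def\<close>)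
  show d: "dvr AA P UNIV p"
    using T.prime_element_dvr[OF p] unfolding dvr_def loc max fractions .
  show "P \<inter> OK = {0}"
  proof (intro equalityI subsetI)
    fix x assume x: "x \<in> P \<inter> OK"
    then have "x / p \<in> TT" by (auto simp: P_def multiples_def)
    then have "inverse x * (x / p) \<in> TT" using unit x by blast
    then show "x \<in> {0}" using p0 by (auto simp: inverse_eq_divide split: if_splits)
  qed (use P.zero_in in auto)
  show "val AA P x = 0" if "x \<in> TT" "x \<notin> multiples TT p"
  proof -
    have "x \<noteq> 0" using that by auto
    then show ?thesis
      using P.val_unit[OF d, of x] that M.subset_localization M.inverse_in_localization[of x] loc by auto
  qed
  show "0 \<le> val AA P x" if "x \<in> TT" "x \<noteq> 0"
    using P.val_nonneg_iff[OF d, of x] that M.subset_localization loc by auto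
qed

lemma moving_prime_val:
  assumes "prime_element TT p"
  shows "val AA (AA \<inter> multiples TT p) p = 1"
proof -
  have "p \<noteq> 0" using assms by (simp add: prime_element_def)
  interpret P: prime_of AA "AA \<inter> multiples TT p" by (rule moving_prime(1)[OF assms])
  interpret B: subrng "localization AA (AA \<inter> multiples TT p)" by (rule P.subrng_localization)
  show ?thesis using P.val_eqI[OF moving_prime(2)[OF assms], of 1 p 1] B.one by simp
qed

text \<open>In \<open>x = a / b\<close> the primes of the denominator are cancelled one at a time:
  if \<open>x\<close> has value at least 0 at \<open>p\<close>, then \<open>p * b * x\<close> has
  positive value there and is divisible by \<open>p\<close>.\<close>

lemma in_TT_if_val_nonneg:
  assumes "\<And>p. prime_element TT p \<Longrightarrow> 0 \<le> val AA (AA \<inter> multiples TT p) x" "x \<noteq> 0"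
  shows "x \<in> TT"
proof -
  obtain a b where ab: "x = a / b" "a \<in> TT" "b \<in> TT" "b \<noteq> 0" by (rule fraction_cases)
  obtain k where "factors TT k b" using T.factors_exist ab by blast
  moreover have "b * x \<in> TT" using ab by simp
  ultimately show ?thesis
  proof (induction rule: factors.induct)
    case (unit b)
    then have "inverse b * (b * x) \<in> TT" by blast
    then show ?case using unit(3) by (simp flip: mult.assoc)
  next
    case (prime p k b)
    let ?P = "AA \<inter> multiples TT p"
    have p0: "p \<noteq> 0" "p \<in> TT" using prime by (auto simp: prime_element_def)
    have b: "b \<in> TT" "b \<noteq> 0" using T.factors_in prime by auto
    interpret P: prime_of AA ?P by (rule moving_prime(1)[OF prime(1)])
    note d = moving_prime(2)[OF prime(1)]
    have "val AA ?P (p * b * x) = 1 + val AA ?P b + val AA ?P x"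
      using P.val_mult[OF d, of "p * b" x] P.val_mult[OF d, of p b] moving_prime_val[OF prime(1)] p0 b assms(2) by simp
    then have "val AA ?P (p * b * x) \<noteq> 0"
      using assms(1)[OF prime(1)] moving_prime(5)[OF prime(1) b] by simp
    then have "p * b * x \<in> multiples TT p" using moving_prime(4)[OF prime(1)] prime.prems by blast
    then show ?case using prime.IH p0 by (simp add: multiples_def)
  qed
qed

text \<open>If \<open>p\<close> divided the prime \<open>q\<close>, the two would be associates and
  define the same moving prime.\<close>

lemma moving_primes_disjoint:
  assumes p: "prime_element TT p" and q: "prime_element TT q" and ne: "AA \<inter> multiples TT p \<noteq> AA \<inter> multiples TT q"
  shows "val AA (AA \<inter> multiples TT p) q = 0"
proof -
  have p0: "p \<in> TT" "p \<noteq> 0" "inverse p \<notin> TT" and q0: "q \<in> TT" "q \<noteq> 0" using p q by (auto simp: prime_element_def)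
  have "q / p \<notin> TT"
  proof
    assume c: "q / p \<in> TT"
    have "p * (q / p) / q \<in> TT" using p0 q0 by simp
    then have "p / q \<in> TT \<or> q / p / q \<in> TT" using q c p0 unfolding prime_element_def by blast
    moreover have "q / p / q = inverse p" using q0 by (simp add: field_simps)
    ultimately have pq: "p / q \<in> TT" using p0 by auto
    have "multiples TT p = multiples TT q" using pq c p0(2) q0(2) by (rule T.multiples_eqI)
    then show False using ne by simp
  qed
  then show ?thesis using moving_prime(4)[OF p, of q] q0 by (simp add: multiples_def)
qed

end

section \<open>The divisor of the unit part\<close>

context tower_extension
begin

interpretation OK: subrng OK by (rule subrng_OK)
interpretation A: subrng AA by (rule OK.subrng_tow)
interpretation T: ufd TT by (rule ufd_TT)

abbreviation content :: "'a \<Rightarrow> 'a divisor" where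
  "content \<equiv> content_divisor OK K {j+1..j+n} t"

text \<open>The content becomes the value at the extended prime, so that applying this one valuation
  to \<open>u = w * prd\<close> produces the formula for the divisor of \<open>w\<close>.\<close>

lemma content_eq_val:
  assumes "height_one_prime OK \<pp>" "x \<in> TT" "x \<noteq> 0"
  shows "content x \<pp> = val AA (tow \<pp> j t n) x"
proof -
  obtain g where "g \<in> K" "dvr OK \<pp> K g" using height_one_dvr assms by blast
  then show ?thesis
    using extended_prime_dvr(2)[of \<pp> g x] assms by (simp add: content_divisor_def OK.height_one_prime_iff)
qed

lemma finite_content:
  assumes x: "x \<in> TT" "x \<noteq> 0"
  shows "finite (div_supp (content x))"
proof -
  let ?c = "coef (W.coeffs x)" and ?S = "supp (W.coeffs x)"
  have "div_supp (content x) \<subseteq> (\<Union>\<alpha>\<in>?S. {\<pp>. height_one_prime OK \<pp> \<and> val OK \<pp> (?c \<alpha>) \<noteq> 0})"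
  proof
    fix \<pp> assume "\<pp> \<in> div_supp (content x)"
    then have ne: "height_one_prime OK \<pp>" "Min ((\<lambda>\<alpha>. val OK \<pp> (?c \<alpha>)) ` ?S) \<noteq> 0"
      by (auto simp: div_supp_def content_divisor_def split: if_splits)
    have "Min ((\<lambda>\<alpha>. val OK \<pp> (?c \<alpha>)) ` ?S) \<in> (\<lambda>\<alpha>. val OK \<pp> (?c \<alpha>)) ` ?S"
      using W.coeffs_nonempty[OF x] by (intro Min_in) auto
    then obtain \<alpha> where "\<alpha> \<in> ?S" "Min ((\<lambda>\<alpha>. val OK \<pp> (?c \<alpha>)) ` ?S) = val OK \<pp> (?c \<alpha>)" by blast
    then show "\<pp> \<in> (\<Union>\<alpha>\<in>?S. {\<pp>. height_one_prime OK \<pp> \<and> val OK \<pp> (?c \<alpha>) \<noteq> 0})" using ne by auto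
  qed
  moreover have "finite {\<pp>. height_one_prime OK \<pp> \<and> val OK \<pp> (?c \<alpha>) \<noteq> 0}" if "\<alpha> \<in> ?S" for \<alpha>
    using finite_val_nonzero[of "?c \<alpha>"] W.coeffs_in_K[OF x(1), of \<alpha>] that by (simp add: in_keys_iff)
  ultimately show ?thesis by (meson finite_UN_I finite_keys finite_subset)
qed

lemma type_E_extension:
  assumes "height_one_prime OK \<pp>"
  shows "type_E AA OK (tow \<pp> j t n)"
proof -
  have pp: "prime_of OK \<pp>" using assms by (simp add: OK.height_one_prime_iff)
  obtain g where g: "g \<in> K" "dvr OK \<pp> K g" using height_one_dvr assms by blast
  show ?thesis
    unfolding type_E_def
    using prime_of.dvr_height_one[OF prime_extension[OF pp] extended_prime_dvr(1)[OF pp g(2,1)]]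
      genideal_extension[OF pp] assms by auto
qed

lemma type_E_cases:
  assumes "type_E AA OK P"
  obtains \<pp> where "height_one_prime OK \<pp>" "P = tow \<pp> j t n" "contract OK P = \<pp>"
  using assms genideal_extension extension_Int unfolding type_E_def contract_def
  by (metis OK.height_one_prime_iff)

lemma unit_decomposition:
  assumes S: "finite S" and SE: "SE = {P \<in> S. type_E AA OK P}" and SM: "SM = {P \<in> S. type_M AA OK P}"
    and u: "u \<noteq> 0" "div_supp (Div AA u) \<subseteq> S"
    and p: "\<And>P. P \<in> SM \<Longrightarrow> p P \<in> TT \<and> ring_irreducible\<^bsub>ring_on TT\<^esub> (p P) \<and> P = AA \<inter> PIdl\<^bsub>ring_on TT\<^esub> (p P)"
    and S': "S' = contract OK ` SE \<union> (\<Union>P\<in>SM. div_supp (content (p P)))"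
  shows "\<exists>w. w \<in> K \<and> w \<noteq> 0 \<and> u = w * (\<Prod>P\<in>SM. p P powi val AA P u) \<and>
     Div OK w = (\<lambda>\<pp>. div_contract OK (div_restrict (Div AA u) SE) \<pp> - (\<Sum>P\<in>SM. val AA P u * content (p P) \<pp>)) \<and>
     finite S' \<and> div_supp (Div OK w) \<subseteq> S'"
proof -
  have q: "prime_element TT (p P)" "P = AA \<inter> multiples TT (p P)" if "P \<in> SM" for P
  proof -
    show pe: "prime_element TT (p P)" using T.prime_element_of_irreducible p[OF that] by blast
    then have "p P \<noteq> 0" by (simp add: prime_element_def)
    then show "P = AA \<inter> multiples TT (p P)" using p[OF that] T.cgenideal_ring_on by metis
  qed
  have p0: "p P \<in> TT" "p P \<noteq> 0" if "P \<in> SM" for P using q(1)[OF that] by (auto simp: prime_element_def)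
  have fin: "finite SM" "finite SE" using S SM SE by auto
  define prd where "prd = (\<Prod>P\<in>SM. p P powi val AA P u)"
  have prd0: "prd \<noteq> 0" using p0 fin by (auto simp: prd_def)
  define w where "w = u / prd"
  have w0: "w \<noteq> 0" and uw: "u = w * prd" using u prd0 by (auto simp: w_def)
  \<comment> \<open>Stated for any prime with a uniformizer, since it is used at moving primes to
    locate \<open>w\<close> in \<open>K\<close> and at extended primes to find its divisor.\<close>
  have val_u: "val A P u = val A P w + (\<Sum>Q\<in>SM. val AA Q u * val A P (p Q))"
    if "prime_of A P" "dvr A P UNIV g" for A P g
  proof -
    have "val A P u = val A P (w * prd)" using uw by (rule arg_cong)
    also have "\<dots> = val A P w + val A P prd" by (rule prime_of.val_mult[OF that]) (use w0 prd0 in auto)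
    also have "val A P prd = (\<Sum>Q\<in>SM. val AA Q u * val A P (p Q))"
      unfolding prd_def by (rule prime_of.val_prod_powi[OF that fin(1)]) (rule p0(2))
    finally show ?thesis .
  qed
  have w_zero: "val AA (AA \<inter> multiples TT r) w = 0" if r: "prime_element TT r" for r
  proof -
    let ?P = "AA \<inter> multiples TT r"
    note P = moving_prime(1)[OF r] and d = moving_prime(2)[OF r]
    have val_p: "val AA ?P (p Q) = (if Q = ?P then 1 else 0)" if "Q \<in> SM" for Q
    proof (cases "Q = ?P")
      case True
      then show ?thesis using moving_prime_val q[OF \<open>Q \<in> SM\<close>] by metis
    next
      case False
      then show ?thesis using moving_primes_disjoint[OF r q(1)[OF that]] q(2)[OF that] by metis
    qed
    \<comment> \<open>Only \<open>Q = ?P\<close> contributes. If \<open>?P\<close> is not in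
      \<open>SM\<close> the sum is 0, and so is the value of \<open>u\<close>: a moving prime
      outside \<open>SM\<close> lies outside \<open>S\<close>, which contains the support of the
      divisor of \<open>u\<close>.\<close>
    have "(\<Sum>Q\<in>SM. val AA Q u * val AA ?P (p Q)) = (\<Sum>Q\<in>SM. if Q = ?P then val AA ?P u else 0)"
      using val_p by (intro sum.cong) auto
    also have "\<dots> = (if ?P \<in> SM then val AA ?P u else 0)" using fin by simp
    also have "\<dots> = val AA ?P u"
    proof (cases "val AA ?P u = 0")
      case False
      have h1: "height_one_prime AA ?P" by (rule prime_of.dvr_height_one[OF P d]) simp
      then have "?P \<in> S" using False u(2) by (auto simp: div_supp_def Div_def)
      moreover have "type_M AA OK ?P" using h1 moving_prime(3)[OF r] by (simp add: type_M_def)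
      ultimately show ?thesis using SM by simp
    qed simp
    finally show ?thesis using val_u[OF P d] by simp
  qed
  have "inverse w \<in> TT"
  proof (rule in_TT_if_val_nonneg)
    fix r assume r: "prime_element TT r"
    interpret P: prime_of AA "AA \<inter> multiples TT r" by (rule moving_prime(1)[OF r])
    have "val AA (AA \<inter> multiples TT r) 1 = 0"
      using P.val_outside[OF moving_prime(2)[OF r] A.one P.one_notin] .
    then show "0 \<le> val AA (AA \<inter> multiples TT r) (inverse w)"
      using P.val_mult[OF moving_prime(2)[OF r], of w "inverse w"] w0 w_zero[OF r] by simp
  qed (use w0 in simp)
  moreover have "w \<in> TT" using in_TT_if_val_nonneg w_zero w0 by simp
  ultimately have wK: "w \<in> K" using unit_TT w0 by blast
  have Div_w: "Div OK w \<pp> = div_contract OK (div_restrict (Div AA u) SE) \<pp> - (\<Sum>P\<in>SM. val AA P u * content (p P) \<pp>)"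
    for \<pp>
  proof (cases "height_one_prime OK \<pp>")
    case True
    let ?P = "tow \<pp> j t n" and ?E = "div_restrict (Div AA u) SE"
    have pp: "prime_of OK \<pp>" using True by (simp add: OK.height_one_prime_iff)
    obtain g where g: "g \<in> K" "dvr OK \<pp> K g" using height_one_dvr True by blast
    have "val AA ?P u = val OK \<pp> w + (\<Sum>Q\<in>SM. val AA Q u * content (p Q) \<pp>)"
      using val_u[OF prime_extension[OF pp] extended_prime_dvr(1)[OF pp g(2,1)]]
        extended_prime_dvr(3)[OF pp g(2,1) wK w0] content_eq_val[OF True p0] by simp
    moreover have "div_contract OK ?E \<pp> = val AA ?P u"
    proof -
      have E: "type_E AA OK ?P" by (rule type_E_extension[OF True])
      have EP: "?E ?P = val AA ?P u"
      proof (cases "?P \<in> S")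
        case True
        then show ?thesis using E SE by (simp add: div_restrict_def Div_def type_E_def)
      next
        case False
        then have "Div AA u ?P = 0" using u(2) by (auto simp: div_supp_def)
        then show ?thesis using False E SE by (simp add: div_restrict_def Div_def type_E_def)
      qed
      \<comment> \<open>Contraction is injective on primes of type E, so the sum in
        \<open>div_contract\<close> has at most one term.\<close>
      have "{P. P \<in> div_supp ?E \<and> contract OK P = \<pp>} = (if ?E ?P = 0 then {} else {?P})"
      proof -
        have "P = ?P" if "P \<in> div_supp ?E" "contract OK P = \<pp>" for P
        proof -
          have "type_E AA OK P" using that SE by (auto simp: div_supp_def div_restrict_def split: if_splits)
          then show ?thesis using that(2) by (elim type_E_cases) simp
        qed
        moreover have "contract OK ?P = \<pp>" using extension_Int[OF pp] by (simp add: contract_def)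
        ultimately have "{P. P \<in> div_supp ?E \<and> contract OK P = \<pp>} = div_supp ?E \<inter> {?P}" by blast
        then show ?thesis by (simp add: div_supp_def)
      qed
      then show ?thesis using EP by (simp add: div_contract_def)
    qed
    ultimately show ?thesis using True by (simp add: Div_def)
  next
    case False
    \<comment> \<open>Divisors are functions on all sets, so the equation must also hold off the
      height-one primes; there every term is 0 by convention.\<close>
    have none: "{P. P \<in> div_supp (div_restrict (Div AA u) SE) \<and> contract OK P = \<pp>} = {}"
    proof (intro equals0I)
      fix P assume "P \<in> {P. P \<in> div_supp (div_restrict (Div AA u) SE) \<and> contract OK P = \<pp>}"
      then have P: "type_E AA OK P" "contract OK P = \<pp>"
        using SE by (auto simp: div_supp_def div_restrict_def split: if_splits)
      show False using type_E_cases[OF P(1)] P(2) False by metis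
    qed
    have "content x \<pp> = 0" for x using False by (simp add: content_divisor_def)
    moreover have "div_contract OK (div_restrict (Div AA u) SE) \<pp> = 0"
      unfolding div_contract_def none by simp
    ultimately show ?thesis using False by (simp add: Div_def)
  qed
  have "finite S'" unfolding S' using fin finite_content p0 by auto
  moreover have "div_supp (Div OK w) \<subseteq> S'"
  proof
    fix \<pp> assume "\<pp> \<in> div_supp (Div OK w)"
    then have "div_contract OK (div_restrict (Div AA u) SE) \<pp> \<noteq> 0 \<or> (\<Sum>P\<in>SM. val AA P u * content (p P) \<pp>) \<noteq> 0"
      using Div_w by (auto simp: div_supp_def)
    then show "\<pp> \<in> S'"
    proof
      assume "div_contract OK (div_restrict (Div AA u) SE) \<pp> \<noteq> 0"
      then obtain P where "P \<in> div_supp (div_restrict (Div AA u) SE)" "contract OK P = \<pp>"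
        unfolding div_contract_def using sum.not_neutral_contains_not_neutral by blast
      then show ?thesis by (auto simp: S' div_supp_def div_restrict_def split: if_splits)
    next
      assume "(\<Sum>P\<in>SM. val AA P u * content (p P) \<pp>) \<noteq> 0"
      then obtain P where "P \<in> SM" "val AA P u * content (p P) \<pp> \<noteq> 0"
        using sum.not_neutral_contains_not_neutral by blast
      then show ?thesis by (auto simp: S' div_supp_def)
    qed
  qed
  ultimately show ?thesis using wK w0 uw Div_w unfolding prd_def by blast
qed

end

section \<open>The tower of the statement as an instance\<close>

lemma root_extension:
  fixes R :: "'a::field set"
  assumes "ufd R" and m: "1 \<le> m" and y: "y ^ m \<in> R" and K: "field_set K" and R: "R \<subseteq> K"
    and gen: "K \<subseteq> localization (adj R y) {0}"
  shows "finite_extension R K m"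
proof -
  interpret ufd R by fact
  interpret Y: subrng "adj R y" by (rule subrng_adj)
  have red: "\<exists>r. (\<forall>l<m. r l \<in> R) \<and> x = (\<Sum>l<m. r l * y ^ l)" if x: "x \<in> adj R y" for x
  proof -
    obtain f where f: "f \<in> poly_over R" "x = poly f y" using x by (auto simp: adj_def)
    \<comment> \<open>Since \<open>y ^ m\<close> lies in \<open>R\<close>, exponents of
      \<open>y\<close> may be reduced modulo \<open>m\<close>, so every element of
      \<open>adj R y\<close> has \<open>m\<close> coordinates over \<open>R\<close>.\<close>
    define r where "r l = (\<Sum>i\<in>{i\<in>{..degree f}. i mod m = l}. coeff f i * (y ^ m) ^ (i div m))" for l
    have "r l \<in> R" for l using f y by (auto simp: r_def poly_over_def)
    have "x = (\<Sum>i\<in>{..degree f}. coeff f i * y ^ i)" using f by (simp add: poly_altdef)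
    also have "\<dots> = (\<Sum>l\<in>{..<m}. \<Sum>i\<in>{i\<in>{..degree f}. i mod m = l}. coeff f i * y ^ i)"
      using m by (intro sum.group[symmetric]) auto
    also have "\<dots> = (\<Sum>l<m. r l * y ^ l)"
    proof (intro sum.cong refl)
      fix l
      have "coeff f i * y ^ i = coeff f i * (y ^ m) ^ (i div m) * y ^ l" if "i mod m = l" for i
        unfolding mult.assoc power_mult[symmetric] power_add[symmetric] that[symmetric] by simp
      then show "(\<Sum>i\<in>{i\<in>{..degree f}. i mod m = l}. coeff f i * y ^ i) = r l * y ^ l"
        unfolding r_def sum_distrib_right by (intro sum.cong refl) blast
    qed
    finally have "x = (\<Sum>l<m. r l * y ^ l)" .
    then show ?thesis using \<open>\<And>l. r l \<in> R\<close> by (intro exI[of _ r]) simp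
  qed
  interpret K: subrng K using K by (simp add: field_set_def)
  show ?thesis
  proof unfold_locales
    show "R \<subseteq> K" by fact
    show "x \<in> K \<Longrightarrow> inverse x \<in> K" for x using K by (simp add: field_set_def)
    fix z :: "nat \<Rightarrow> 'a" assume z: "\<And>i. i \<le> m \<Longrightarrow> z i \<in> K"
    interpret Z: prime_of "adj R y" "{0}" by (rule Y.prime_of_zero)
    have "z i \<in> localization (adj R y) {0}" if "i \<in> {..m}" for i using z gen that by auto
    then obtain b where b: "b \<in> adj R y" "b \<noteq> 0" "\<And>i. i \<le> m \<Longrightarrow> b * z i \<in> adj R y"
      using Z.common_denominator[of "{..m}" z] by auto
    have "\<forall>i. \<exists>r. i \<le> m \<longrightarrow> (\<forall>l<m. r l \<in> R) \<and> b * z i = (\<Sum>l<m. r l * y ^ l)"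
      using red[OF b(3)] by blast
    from choice[OF this] obtain r
      where "\<forall>i. i \<le> m \<longrightarrow> (\<forall>l<m. r i l \<in> R) \<and> b * z i = (\<Sum>l<m. r i l * y ^ l)" ..
    then have r: "\<And>i l. i \<le> m \<Longrightarrow> l < m \<Longrightarrow> r i l \<in> R"
      "\<And>i. i \<le> m \<Longrightarrow> b * z i = (\<Sum>l<m. r i l * y ^ l)" by blast+
    \<comment> \<open>With m + 1 elements and \<open>m\<close> coordinates each, elimination gives a
      nontrivial relation; hence the constant N = m. The common factor \<open>b\<close> cancels
      afterwards.\<close>
    obtain c where c: "\<forall>i\<in>{..m}. c i \<in> R" "\<exists>i\<in>{..m}. c i \<noteq> 0"
      "\<And>l. l < m \<Longrightarrow> (\<Sum>i\<in>{..m}. c i * r i l) = 0"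
      using linear_relation[of "{..m}" m r] r by auto
    have "b * (\<Sum>i\<le>m. c i * z i) = (\<Sum>i\<le>m. c i * (b * z i))" by (simp add: sum_distrib_left mult.left_commute)
    also have "\<dots> = (\<Sum>i\<le>m. \<Sum>l<m. c i * r i l * y ^ l)"
      by (intro sum.cong) (auto simp: r(2) sum_distrib_left mult.assoc)
    also have "\<dots> = (\<Sum>l<m. (\<Sum>i\<le>m. c i * r i l) * y ^ l)"
      by (subst sum.swap) (simp add: sum_distrib_right)
    also have "\<dots> = 0" using c(3) by simp
    finally have "(\<Sum>i\<le>m. c i * z i) = 0" using b by simp
    then show "\<exists>c. (\<forall>i\<le>m. c i \<in> R) \<and> (\<exists>i\<le>m. c i \<noteq> 0) \<and> (\<Sum>i\<le>m. c i * z i) = 0"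
      using c by (intro exI[of _ c]) auto
  qed
qed

text \<open>\<open>R\<^sub>0\<close> is itself a tower with offset 0 over the field
  \<open>F\<close>, which makes it factorial. Transcendence is assumed over the adjoined fields and
  passes to the polynomial rings inside them.\<close>

lemma differential_tower_extension:
  assumes tower: "differential_tower F D j m n q y t"
    and R0: "R\<^sub>0 = ring_adjoin F (t ` {1..j})"
    and K: "K = field_adjoin F (insert y (t ` {1..j}))"
  shows "tower_extension R\<^sub>0 K m j t (n - j)"
proof -
  interpret differential_tower F D j m n q y t by fact
  have F: "field_set F" using field_set_subfield subfield_F .
  interpret F: subrng F using F by (simp add: field_set_def)
  have fK: "field_set K" unfolding K by (rule field_set_field_adjoin)
  interpret K: subrng K using fK by (simp add: field_set_def)
  have incl: "F \<subseteq> K" "y \<in> K" "t ` {1..j} \<subseteq> K" using field_adjoin_incl[of F "insert y (t ` {1..j})"] K by auto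
  have Rtow: "R\<^sub>0 = tow F 0 t j" using F.ring_adjoin_tow[of t 0 j] R0 by simp
  interpret R: subrng R\<^sub>0 unfolding Rtow by (rule F.subrng_tow)
  have "ufd R\<^sub>0" unfolding Rtow
  proof (rule ufd.ufd_tow)
    show "ufd F" using F by (intro F.ufd_field) (simp add: field_set_def)
    fix k assume k: "k < j"
    have "tow F 0 t k \<subseteq> field_adjoin F (t ` {1..<Suc k})"
      using field_set_field_adjoin field_adjoin_incl[of F "t ` {1..<Suc k}"]
      by (intro F.tow_subset) (auto simp: field_set_def)
    then show "\<not> algebraic_over (tow F 0 t k) (t (Suc (0 + k)))"
      using lower_transcendental[of "Suc k"] k algebraic_over_mono by auto
  qed
  have RK: "R\<^sub>0 \<subseteq> K" unfolding Rtow using incl by (intro F.tow_subset K.subrng_axioms) auto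
  have "finite_extension R\<^sub>0 K m"
  proof (rule root_extension)
    show "y ^ m \<in> R\<^sub>0" using q_in y_power R0 by simp
    interpret Y: subrng "adj R\<^sub>0 y" by (rule R.subrng_adj)
    interpret Z: prime_of "adj R\<^sub>0 y" "{0}" by (rule Y.prime_of_zero)
    have "F \<union> insert y (t ` {1..j}) \<subseteq> adj R\<^sub>0 y"
      using ring_adjoin_incl[of F "t ` {1..j}"] R.subset_adj[of y] R.gen_in_adj R0 by auto
    then show "K \<subseteq> localization (adj R\<^sub>0 y) {0}"
      unfolding K using Y.field_set_fractions Z.subset_localization by (intro field_adjoin_subset) auto
  qed (use \<open>ufd R\<^sub>0\<close> m_pos fK RK in auto)
  moreover have "poly_tower K j t (n - j)"
  proof unfold_locales
    fix k assume k: "k < n - j"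
    let ?G = "insert y (t ` {1..j}) \<union> t ` {j+1..<Suc (j + k)}"
    have G: "field_set (field_adjoin F ?G)" by (rule field_set_field_adjoin)
    have "K \<subseteq> field_adjoin F ?G"
      unfolding K using field_adjoin_incl[of F ?G] by (intro field_adjoin_subset G) blast
    then have sub: "tow K j t k \<subseteq> field_adjoin F ?G"
      using field_adjoin_incl[of F ?G] G by (intro K.tow_subset) (auto simp: field_set_def)
    show "\<not> algebraic_over (tow K j t k) (t (Suc (j + k)))"
      using upper_transcendental[of "Suc (j + k)"] algebraic_over_mono[OF sub] less_diff_conv[of k n j] k
      by (auto simp: add.commute)
  qed
  moreover have "localization (tow K j t (n - j)) {0} = UNIV"
  proof -
    interpret T: subrng "tow K j t (n - j)" by (rule K.subrng_tow)
    interpret Z: prime_of "tow K j t (n - j)" "{0}" by (rule T.prime_of_zero)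
    have "t i \<in> tow K j t (n - j)" if "i \<in> {1..n}" for i
    proof (cases "i \<le> j")
      case True
      then have "t i \<in> K" using that incl(3) by (auto simp: image_subset_iff)
      then show ?thesis using K.subset_tow by blast
    next
      case False
      then show ?thesis using that by (intro K.gen_in_tow) auto
    qed
    then have "F \<union> insert y (t ` {1..n}) \<subseteq> tow K j t (n - j)"
      using incl(1,2) K.subset_tow[of j t "n - j"] by auto
    then have "field_adjoin F (insert y (t ` {1..n})) \<subseteq> localization (tow K j t (n - j)) {0}"
      using T.field_set_fractions Z.subset_localization by (intro field_adjoin_subset) auto
    then show ?thesis using generates_L by auto
  qed
  ultimately show ?thesis by (simp add: tower_extension_def tower_extension_axioms_def)
qed

theorem proposition7p2:
  fixes F R\<^sub>0 K \<O> \<A> T :: "'a::field_char_0 set" and D :: "'a \<Rightarrow> 'a"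
    and j m n :: nat and q y u :: 'a and t :: "nat \<Rightarrow> 'a"
    and S S\<^sub>E S\<^sub>M S' :: "'a set set" and p :: "'a set \<Rightarrow> 'a"
    and \<gamma> :: "'a \<Rightarrow> 'a divisor"
  assumes tower: "differential_tower F D j m n q y t"
    and R0: "R\<^sub>0 = ring_adjoin F (t ` {1..j})"
    and K: "K = field_adjoin F (insert y (t ` {1..j}))"
    and O: "\<O> = integral_closure R\<^sub>0 K"
    and A: "\<A> = ring_adjoin \<O> (t ` {j+1..n})"
    and T: "T = ring_adjoin K (t ` {j+1..n})"
    and gamma: "\<gamma> = content_divisor \<O> K {j+1..n} t"
    and S: "finite S" "\<And>P. P \<in> S \<Longrightarrow> height_one_prime \<A> P"
    and SE: "S\<^sub>E = {P \<in> S. type_E \<A> \<O> P}"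
    and SM: "S\<^sub>M = {P \<in> S. type_M \<A> \<O> P}"
    and u: "u \<noteq> 0" "div_supp (Div \<A> u) \<subseteq> S"
    and p: "\<And>P. P \<in> S\<^sub>M \<Longrightarrow>
          p P \<in> T \<and> ring_irreducible\<^bsub>ring_on T\<^esub> (p P) \<and> P = \<A> \<inter> PIdl\<^bsub>ring_on T\<^esub> (p P)"
    and S': "S' = contract \<O> ` S\<^sub>E \<union> (\<Union>P\<in>S\<^sub>M. div_supp (\<gamma> (p P)))"
  shows "\<exists>w. w \<in> K \<and> w \<noteq> 0 \<and>
           u = w * (\<Prod>P\<in>S\<^sub>M. p P powi val \<A> P u) \<and>
           Div \<O> w = (\<lambda>\<pp>. div_contract \<O> (div_restrict (Div \<A> u) S\<^sub>E) \<pp>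
                            - (\<Sum>P\<in>S\<^sub>M. val \<A> P u * \<gamma> (p P) \<pp>)) \<and>
           finite S' \<and> div_supp (Div \<O> w) \<subseteq> S'"
proof -
  interpret tower_extension R\<^sub>0 K m j t "n - j"
    using differential_tower_extension[OF tower R0 K] .
  interpret OK: subrng OK by (rule subrng_OK)
  \<comment> \<open>The general setting counts the upper variables from \<open>j\<close>, so the
    truncated difference has to be undone; this uses \<open>j \<le> n\<close>.\<close>
  have n: "j + (n - j) = n" using tower by (simp add: differential_tower_def)
  have O': "\<O> = OK" by (simp add: O OK_def)
  have A': "\<A> = AA" using OK.ring_adjoin_tow[of t j "n - j"] by (simp add: A O' n)
  have T': "T = TT" using W.ring_adjoin_tow[of t j "n - j"] by (simp add: T n)
  have gamma': "\<gamma> = content" by (simp add: gamma O' n)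
  show ?thesis
    using unit_decomposition[OF S(1) SE[unfolded O' A'] SM[unfolded O' A'] u(1) u(2)[unfolded A']
        p[unfolded A' T'] S'[unfolded O' gamma']]
    unfolding O' A' gamma' .
qed

end
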